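(* Let $p\in\{0,1,\ldots,6\}$, let $\underline{\eta}\in\mathbb{S}$ and let $U$ be a bounded domain in $\mathbb{O}$ such that $U_{\underline{\eta}}$ has smooth boundary $\partial U_{\underline{\eta}}$. If $f\in C^1(\overline{U_{\underline{\eta}}},\mathbb{O})$, then $$f(\boldsymbol{x})=\int_{\partial U_{\underline{\eta}}}E_{\boldsymbol{y}}(\boldsymbol{x})\big(\boldsymbol{n}(\boldsymbol{y})f(\boldsymbol{y})\big)\,dS(\boldsymbol{y})-\int_{U_{\underline{\eta}}}E_{\boldsymbol{y}}(\boldsymbol{x})\big(D_{\underline{\eta}}f(\boldsymbol{y})\big)\,dV(\boldsymbol{y}),\qquad\boldsymbol{x}\in U_{\underline{\eta}},$$ where $\boldsymbol{n}(\boldsymbol{y})=\sum_{i=0}^pn_i(\boldsymbol{y})e_i+n_{p+1}(\boldsymbol{y})\underline{\eta}$ is the unit exterior normal to $\partial U_{\underline{\eta}}$ at $\boldsymbol{y}$, and $dS$ and $dV$ are the classical Lebesgue surface element and volume element in $\mathbb{R}^{p+2}$, respectively.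
   Context: $\mathbb{O}$ is the real, non-associative, alternative algebra of octonions with basis $e_0=1,e_1,\ldots,e_7$ and product $e_ie_j=-\delta_{ij}+\sum_k\epsilon_{ijk}e_k$ for $1\le i,j\le 7$, where $\epsilon_{ijk}$ is totally antisymmetric, equals $1$ on the triples $(1,2,3),(1,4,5),(2,4,6),(3,4,7),(5,3,6),(6,1,7),(7,2,5)$, and vanishes on triples that are not permutations of these. $\mathbb{O}$ is identified with $\mathbb{R}^8$ with Euclidean norm $|\cdot|$; conjugation is $\overline{x}=x_0-\sum_{i=1}^7x_ie_i$. A domain is a connected open set. Fix $p\in\{0,\ldots,6\}$. $\mathbb{R}^{p+1}$ denotes the real span of $e_0,\ldots,e_p$, and $\mathbb{S}=\{\sum_{i=p+1}^7x_ie_i:\sum_{i=p+1}^7x_i^2=1\}$. For $U\subseteq\mathbb{O}$ open and $\underline{\eta}\in\mathbb{S}$, $U_{\underline{\eta}}=U\cap(\mathbb{R}^{p+1}\oplus\underline{\eta}\mathbb{R})$ is viewed as an open subset of $\mathbb{R}^{p+2}$ with coordinates $(x_0,\ldots,x_p,r)\leftrightarrow\sum_{i=0}^px_ie_i+r\underline{\eta}$; its boundary and closure are taken in $\mathbb{R}^{p+1}\oplus\underline{\eta}\mathbb{R}$. $D_{\underline{\eta}}f=\sum_{i=0}^pe_i\,\partial_{x_i}f+\underline{\eta}\,\partial_rf$. The Cauchy kernel is $E(\boldsymbol{x})=\frac{1}{\sigma_{p+1}}\frac{\overline{\boldsymbol{x}}}{|\boldsymbol{x}|^{p+2}}$ for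 $\boldsymbol{x}\in\mathbb{O}\setminus\{0\}$, with $\sigma_{p+1}=2\,\Gamma(\tfrac12)^{p+2}/\Gamma(\tfrac{p+2}{2})$ (the area of the unit sphere of $\mathbb{R}^{p+2}$), and $E_{\boldsymbol{y}}(\boldsymbol{x}):=E(\boldsymbol{y}-\boldsymbol{x})$. *)

theory Defs
  imports "HOL-Analysis.Analysis" "HOL-Combinatorics.Permutations"
begin

section \<open>Octonions\<close>

text \<open>
  The octonions are identified with Euclidean 8-space, so norm, inner product and topology are those
  of \<^typ>\<open>real^8\<close>.  The library's \<open>*\<close> on \<^typ>\<open>real^8\<close> is componentwise and is not used; the octonion
  product is \<open>\<star>\<close>.
\<close>

type_synonym octonion = "real^8"

text \<open>The index type \<open>8\<close> is arithmetic modulo 8, so \<open>of_nat\<close> is a bijection from \<open>{0..7}\<close> onto it;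
  \<open>oe i\<close> is used only for \<open>i \<le> 7\<close>.\<close>

definition oe :: "nat \<Rightarrow> octonion" where
  "oe i = axis (of_nat i) 1"

definition oct_triples :: "(nat \<times> nat \<times> nat) set" where
  "oct_triples = {(1,2,3), (1,4,5), (2,4,6), (3,4,7), (5,3,6), (6,1,7), (7,2,5)}"

definition oct_eps :: "nat \<Rightarrow> nat \<Rightarrow> nat \<Rightarrow> real" where
  "oct_eps i j k =
    (if (i,j,k) \<in> oct_triples \<or> (j,k,i) \<in> oct_triples \<or> (k,i,j) \<in> oct_triples then 1
     else if (j,i,k) \<in> oct_triples \<or> (i,k,j) \<in> oct_triples \<or> (k,j,i) \<in> oct_triples then -1
     else 0)"

definition oe_mult :: "nat \<Rightarrow> nat \<Rightarrow> octonion" where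
  "oe_mult i j =
    (if i = 0 then oe j
     else if j = 0 then oe i
     else (if i = j then - oe 0 else 0) + (\<Sum>k=1..7. oct_eps i j k *\<^sub>R oe k))"

definition omult :: "octonion \<Rightarrow> octonion \<Rightarrow> octonion" (infixl \<open>\<star>\<close> 70) where
  "x \<star> y = (\<Sum>i\<le>7. \<Sum>j\<le>7. ((x \<bullet> oe i) * (y \<bullet> oe j)) *\<^sub>R oe_mult i j)"

definition oconj :: "octonion \<Rightarrow> octonion" where
  "oconj x = (x \<bullet> oe 0) *\<^sub>R oe 0 - (\<Sum>i=1..7. (x \<bullet> oe i) *\<^sub>R oe i)"


section \<open>Slices\<close>

definition pbasis :: "nat \<Rightarrow> octonion set" where
  "pbasis p = oe ` {..p}"

definition unit_sphere :: "nat \<Rightarrow> octonion set" where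
  "unit_sphere p = {\<Sum>i=p+1..7. c i *\<^sub>R oe i | c. (\<Sum>i=p+1..7. (c i)\<^sup>2) = 1}"

text \<open>For \<open>\<eta> \<in> unit_sphere p\<close> this is the orthonormal basis of \<open>\<real>\<^bsup>p+1\<^esup> \<oplus> \<eta>\<real>\<close> that carries the
  coordinates \<open>(x\<^sub>0, \<dots>, x\<^sub>p, r)\<close>.\<close>

definition slice_basis :: "nat \<Rightarrow> octonion \<Rightarrow> octonion set" where
  "slice_basis p \<eta> = insert \<eta> (pbasis p)"

definition slice :: "nat \<Rightarrow> octonion \<Rightarrow> octonion set \<Rightarrow> octonion set" where
  "slice p \<eta> U = U \<inter> span (slice_basis p \<eta>)"


section \<open>Calculus on subspaces\<close>

text \<open>
  In what follows \<open>B\<close> is a finite orthonormal set and \<open>span B\<close> plays the role of \<open>\<real>\<^bsup>card B\<^esup>\<close>, with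
  coordinates taken with respect to \<open>B\<close>; all sets and functions of interest live on \<open>span B\<close>.
\<close>

definition pderiv_along ::
    "'a::real_normed_vector \<Rightarrow> ('a \<Rightarrow> 'b::real_normed_vector) \<Rightarrow> 'a \<Rightarrow> 'b" where
  "pderiv_along b f x = vector_derivative (\<lambda>t. f (x + t *\<^sub>R b)) (at 0)"

text \<open>\<open>k\<close>-fold continuous differentiability on a relatively open subset \<open>S\<close> of \<open>span B\<close>, through
  iterated partial derivatives.\<close>

primrec Ck_on ::
    "'a::real_normed_vector set \<Rightarrow> 'a set \<Rightarrow> nat \<Rightarrow> ('a \<Rightarrow> 'b::real_normed_vector) \<Rightarrow> bool" where
  "Ck_on B S 0 f \<longleftrightarrow> continuous_on S f"
| "Ck_on B S (Suc k) f \<longleftrightarrow> continuous_on S f \<and>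
     (\<forall>b\<in>B. (\<forall>x\<in>S. (\<lambda>t. f (x + t *\<^sub>R b)) differentiable (at 0)) \<and> Ck_on B S k (pderiv_along b f))"

definition smooth_on :: "'a::real_normed_vector set \<Rightarrow> 'a set \<Rightarrow> ('a \<Rightarrow> 'b::real_normed_vector) \<Rightarrow> bool" where
  "smooth_on B S f \<longleftrightarrow> (\<forall>k. Ck_on B S k f)"

definition closure_in :: "octonion set \<Rightarrow> octonion set \<Rightarrow> octonion set" where
  "closure_in B S = top_of_set (span B) closure_of S"

definition boundary_in :: "octonion set \<Rightarrow> octonion set \<Rightarrow> octonion set" where
  "boundary_in B S = top_of_set (span B) frontier_of S"

text \<open>\<open>C\<^sup>1\<close> up to the boundary: \<open>f\<close> is continuous on the closure and \<open>C\<^sup>1\<close> on \<open>S\<close>, and its first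
  partial derivatives extend continuously to the closure.\<close>

definition C1_closure :: "octonion set \<Rightarrow> octonion set \<Rightarrow> (octonion \<Rightarrow> octonion) \<Rightarrow> bool" where
  "C1_closure B S f \<longleftrightarrow>
     continuous_on (closure_in B S) f \<and> Ck_on B S 1 f \<and>
     (\<forall>b\<in>B. \<exists>g. continuous_on (closure_in B S) g \<and> (\<forall>x\<in>S. g x = pderiv_along b f x))"

text \<open>Near each boundary point, \<open>S\<close> is the part of \<open>span B\<close> strictly on one side of the graph of a
  \<open>C\<^sup>\<infinity>\<close> function over one of the coordinate hyperplanes.\<close>

definition has_smooth_boundary :: "octonion set \<Rightarrow> octonion set \<Rightarrow> bool" where
  "has_smooth_boundary B S \<longleftrightarrow>
     (\<forall>y\<in>boundary_in B S. \<exists>b\<in>B. \<exists>s\<in>{1,-1::real}. \<exists>r>0. \<exists>\<gamma>::octonion \<Rightarrow> real.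
        smooth_on (B - {b}) (span (B - {b})) \<gamma> \<and>
        (\<forall>x\<in>span B \<inter> ball y r. x \<in> S \<longleftrightarrow> s * (x \<bullet> b) > \<gamma> (x - (x \<bullet> b) *\<^sub>R b)))"

definition tangent_vector :: "octonion set \<Rightarrow> octonion \<Rightarrow> octonion \<Rightarrow> bool" where
  "tangent_vector M y v \<longleftrightarrow>
     (\<exists>c::real \<Rightarrow> octonion. (\<forall>t. c t \<in> M) \<and> c 0 = y \<and> (c has_vector_derivative v) (at 0))"

definition exterior_normal :: "octonion set \<Rightarrow> octonion set \<Rightarrow> octonion \<Rightarrow> octonion" where
  "exterior_normal B S y = (THE \<nu>. \<nu> \<in> span B \<and> norm \<nu> = 1 \<and>
     (\<forall>v. tangent_vector (boundary_in B S) y v \<longrightarrow> \<nu> \<bullet> v = 0) \<and>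
     (\<exists>\<epsilon>>0. \<forall>t. 0 < t \<and> t < \<epsilon> \<longrightarrow> y + t *\<^sub>R \<nu> \<notin> closure_in B S \<and> y - t *\<^sub>R \<nu> \<in> S))"


section \<open>Volume and surface measure\<close>

text \<open>Lebesgue measure of \<open>span B\<close>, pushed forward from coordinate space in the same way as \<^const>\<open>lborel\<close>.
  It is a measure on the Borel sets of the whole octonion space that is concentrated on \<open>span B\<close>.\<close>

definition vol :: "octonion set \<Rightarrow> octonion measure" where
  "vol B = distr (\<Pi>\<^sub>M b\<in>B. (lborel :: real measure)) borel (\<lambda>c. \<Sum>b\<in>B. c b *\<^sub>R b)"

text \<open>The Gram determinant of the partial derivatives of \<open>\<phi>\<close> (Leibniz formula, since the size \<open>p + 1\<close>
  of the matrix is a variable).\<close>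

definition gram_det :: "nat \<Rightarrow> (octonion \<Rightarrow> octonion) \<Rightarrow> octonion \<Rightarrow> real" where
  "gram_det p \<phi> u = (\<Sum>\<pi> | \<pi> permutes {..p}.
     of_int (sign \<pi>) * (\<Prod>i\<le>p. pderiv_along (oe i) \<phi> u \<bullet> pderiv_along (oe (\<pi> i)) \<phi> u))"

text \<open>Regular local \<open>C\<^sup>1\<close> parametrisations of a \<open>(p+1)\<close>-dimensional surface \<open>M\<close>; the parameter space
  \<open>\<real>\<^bsup>p+1\<^esup>\<close> is \<open>span (pbasis p)\<close>.\<close>

definition local_param :: "nat \<Rightarrow> octonion set \<Rightarrow> octonion set \<Rightarrow> (octonion \<Rightarrow> octonion) \<Rightarrow> bool" where
  "local_param p M V \<phi> \<longleftrightarrow>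
     openin (top_of_set (span (pbasis p))) V \<and>
     Ck_on (pbasis p) V 1 \<phi> \<and>
     openin (top_of_set M) (\<phi> ` V) \<and>
     (\<exists>\<psi>. homeomorphism V (\<phi> ` V) \<phi> \<psi>) \<and>
     (\<forall>u\<in>V. gram_det p \<phi> u \<noteq> 0)"

text \<open>The classical surface measure: the unique Borel measure on \<open>M\<close> that in every regular local
  parametrisation has the density \<open>sqrt (gram_det p \<phi>)\<close>.\<close>

definition surface_measure :: "nat \<Rightarrow> octonion set \<Rightarrow> octonion measure" where
  "surface_measure p M = (THE \<sigma>. space \<sigma> = M \<and> sets \<sigma> = sets (restrict_space borel M) \<and>
     (\<forall>V \<phi> A. local_param p M V \<phi> \<and> A \<in> sets borel \<and> A \<subseteq> V \<longrightarrow>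
        emeasure \<sigma> (\<phi> ` A) = (\<integral>\<^sup>+u\<in>A. ennreal (sqrt (gram_det p \<phi> u)) \<partial>vol (pbasis p))))"


section \<open>Dirac operator and Cauchy kernel\<close>

definition dirac :: "nat \<Rightarrow> octonion \<Rightarrow> (octonion \<Rightarrow> octonion) \<Rightarrow> octonion \<Rightarrow> octonion" where
  "dirac p \<eta> f x = (\<Sum>i\<le>p. oe i \<star> pderiv_along (oe i) f x) + \<eta> \<star> pderiv_along \<eta> f x"

text \<open>Area of the unit sphere of \<open>\<real>\<^bsup>p+2\<^esup>\<close>.\<close>

definition sphere_area :: "nat \<Rightarrow> real" where
  "sphere_area p = 2 * Gamma (1/2) ^ (p + 2) / Gamma ((real p + 2) / 2)"

text \<open>The value at the origin (which is 0 here) is irrelevant.\<close>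

definition cauchy_kernel :: "nat \<Rightarrow> octonion \<Rightarrow> octonion" where
  "cauchy_kernel p x = (1 / sphere_area p) *\<^sub>R ((1 / norm x ^ (p + 2)) *\<^sub>R oconj x)"

definition cauchy_kernel_at :: "nat \<Rightarrow> octonion \<Rightarrow> octonion \<Rightarrow> octonion" where
  "cauchy_kernel_at p y x = cauchy_kernel p (y - x)"

end

theory Submission
  imports Defs
begin

text \<open>
  Write \<open>B\<close> for the slice basis, \<open>n = p + 2\<close> for its size and \<open>S\<close> for the slice of
  \<open>U\<close>.  Instead of cutting a small ball around the singularity \<open>x\<close> out of \<open>S\<close>, the kernel is regularised:
  \<open>E\<^sub>\<epsilon>(z) = (\<epsilon>\<^sup>2 + |z|\<^sup>2)\<close> to the power \<open>-n/2\<close>, times the conjugate of \<open>z\<close>, is smooth on the whole slice space.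
  The divergence theorem in \<open>S\<close> can therefore be applied to \<open>y \<mapsto> E\<^sub>\<epsilon>(y - x) \<star> (c \<star> f y)\<close> in each direction \<open>c \<in> B\<close>;
  summed over \<open>c\<close> the boundary term is the integral of \<open>E\<^sub>\<epsilon>(y - x) \<star> (n(y) \<star> f y)\<close>, where \<open>n(y)\<close> is the exterior
  normal, and the derivatives of \<open>f\<close> give \<open>E\<^sub>\<epsilon>(y - x) \<star> D f(y)\<close>.  What remains is the sum over \<open>c\<close> of
  \<open>(\<partial>\<^sub>c E\<^sub>\<epsilon>)(z) \<star> (c \<star> w)\<close>.  The octonion product is not associative, but the bracketing is such that only the
  alternative law in the form \<open>oconj a \<star> (a \<star> w) = |a|\<^sup>2 w\<close> enters (\<open>oconj_omult_omult\<close>), and the sum collapses to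
  \<open>n \<epsilon>\<^sup>2 (\<epsilon>\<^sup>2 + |z|\<^sup>2)\<close> to the power \<open>-n/2 - 1\<close>, times \<open>w\<close> (\<open>reg_kernel_divergence\<close>).

  As \<open>\<epsilon>\<close> tends to \<open>0\<close> this scalar factor is an approximate identity whose total mass is the area of the unit
  sphere; the mass is computed by writing the negative power as a Gamma integral over Gaussians
  (\<open>vol_identity_profile\<close>).  Hence the extra term converges to a multiple of \<open>f x\<close> (\<open>approximate_identity\<close>).  The other
  two terms converge by dominated convergence, since \<open>|E\<^sub>\<epsilon>(z)|\<close> is at most \<open>|z|\<close> to the power \<open>1 - n\<close>, which is
  integrable near the origin of an \<open>n\<close>-dimensional space (\<open>vol_riesz_finite\<close>) and bounded on the boundary.

  The divergence theorem (\<open>divergence_theorem\<close>) is reduced by a partition of unity to functions supported in a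
  ball in which \<open>S\<close> is the region strictly above a graph.  There a shear makes the graph flat, and the fundamental
  theorem of calculus along coordinate lines gives the formula with the weighted normal \<open>grad \<gamma> - s b\<close>
  (\<open>divergence_epigraph_extended\<close>).

  It remains to identify the measure and the normal, which are given by definite descriptions, with what the graph
  produces.  A measure with the defining property of the surface measure is unique, because a finite set of charts
  covers the boundary, and it exists, because the weighted measures of these charts can be glued: that an arbitrary
  regular parametrisation assigns the same area as a graph is a change of variables together with a Gram
  determinant (\<open>graph_area\<close>).  The normal is normalised \<open>grad \<gamma> - s b\<close> (\<open>exterior_normal_eq\<close>).
\<close>

section \<open>Octonions in coordinates\<close>

lemma inj_of_nat8: "inj_on (of_nat :: nat \<Rightarrow> 8) {..7}"
proof (rule inj_onI)
  fix i j :: nat assume "i \<in> {..7}" "j \<in> {..7}" "(of_nat i :: 8) = of_nat j"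
  then have "(of_int (int i) :: 8) = of_int (int j)" by simp
  then have "Rep_bit0 (of_int (int i) :: 4 bit0) = Rep_bit0 (of_int (int j) :: 4 bit0)" by simp
  then have "int i mod 8 = int j mod 8" using bit0.Rep_Abs_mod[where ?'a=4, of "int i"] bit0.Rep_Abs_mod[where ?'a=4, of "int j"] by (simp add: bit0.of_int_eq)
  then show "i = j" using \<open>i \<in> {..7}\<close> \<open>j \<in> {..7}\<close> by simp
qed

lemma range_of_nat8: "(of_nat :: nat \<Rightarrow> 8) ` {..7} = UNIV"
  by (intro card_subset_eq) (auto simp: card_image[OF inj_of_nat8])

lemma oe_inner: "i \<le> 7 \<Longrightarrow> j \<le> 7 \<Longrightarrow> oe i \<bullet> oe j = (if i = j then 1 else 0)"
  using inj_of_nat8 by (auto simp: oe_def inner_axis_axis inj_on_def)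

lemma Basis_oct: "(Basis :: octonion set) = oe ` {..7}"
proof -
  have "(Basis :: octonion set) = (\<lambda>i. axis i 1) ` UNIV" by (auto simp: Basis_vec_def)
  also have "\<dots> = oe ` {..7}" unfolding range_of_nat8[symmetric] image_image oe_def ..
  finally show ?thesis .
qed

lemma inj_oe: "inj_on oe {..7}"
proof (rule inj_onI)
  fix i j :: nat assume "i \<in> {..7}" "j \<in> {..7}" "oe i = oe j"
  then show "i = j" using oe_inner[of i j] oe_inner[of i i] by (auto split: if_splits)
qed

lemma oct_expand: "(x::octonion) = (\<Sum>i\<le>7. (x \<bullet> oe i) *\<^sub>R oe i)"
  using euclidean_representation[of x] unfolding Basis_oct by (simp add: sum.reindex[OF inj_oe])

lemma oct_inner_expand: "(x::octonion) \<bullet> y = (\<Sum>i\<le>7. (x \<bullet> oe i) * (y \<bullet> oe i))"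
  using euclidean_inner[of x y] unfolding Basis_oct by (simp add: sum.reindex[OF inj_oe])

lemma oct_eqI: "(\<And>i. i \<le> 7 \<Longrightarrow> (x::octonion) \<bullet> oe i = y \<bullet> oe i) \<Longrightarrow> x = y"
  by (subst oct_expand[of x], subst oct_expand[of y]) (auto intro!: sum.cong)

lemma le7: "(i::nat) \<le> 7 \<longleftrightarrow> i = 0 \<or> i = 1 \<or> i = 2 \<or> i = 3 \<or> i = 4 \<or> i = 5 \<or> i = 6 \<or> i = 7"
  by auto

lemma sum_le7: "(\<Sum>i\<le>7. g i) = g 0 + g 1 + g 2 + g 3 + g 4 + g 5 + g 6 + (g (7::nat) :: 'z::comm_monoid_add)"
  by (simp add: numeral_eq_Suc add_ac)

lemma omult_coord:
  "(x \<star> y) \<bullet> oe k = (\<Sum>i\<le>7. \<Sum>j\<le>7. (x \<bullet> oe i) * (y \<bullet> oe j) * (oe_mult i j \<bullet> oe k))"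
  by (simp add: omult_def inner_sum_left)

lemma oe_mult_coord: "i \<le> 7 \<Longrightarrow> j \<le> 7 \<Longrightarrow> k \<le> 7 \<Longrightarrow> oe_mult i j \<bullet> oe k =
   (if i = 0 then (if j = k then 1 else 0) else if j = 0 then (if i = k then 1 else 0)
    else if k = 0 then (if i = j then -1 else 0) else oct_eps i j k)"
proof -
  assume a: "i \<le> 7" "j \<le> 7" "k \<le> 7"
  have "(\<Sum>l=1..7. oct_eps i j l *\<^sub>R oe l) \<bullet> oe k = (\<Sum>l=1..7. if l = k then oct_eps i j k else 0)"
    unfolding inner_sum_left using a by (intro sum.cong refl) (auto simp: oe_inner)
  also have "\<dots> = (if k = 0 then 0 else oct_eps i j k)" using a by (auto simp: sum.delta)
  finally show ?thesis using a by (auto simp: oe_mult_def oe_inner inner_add_left)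
qed

lemma omult_coords:
  fixes x y :: octonion
  defines "a \<equiv> \<lambda>i. x \<bullet> oe i" and "b \<equiv> \<lambda>i. y \<bullet> oe i"
  shows "(x \<star> y) \<bullet> oe 0 = a 0*b 0 - a 1*b 1 - a 2*b 2 - a 3*b 3 - a 4*b 4 - a 5*b 5 - a 6*b 6 - a 7*b 7"
    "(x \<star> y) \<bullet> oe 1 = a 0*b 1 + a 1*b 0 + a 2*b 3 - a 3*b 2 + a 4*b 5 - a 5*b 4 - a 6*b 7 + a 7*b 6"
    "(x \<star> y) \<bullet> oe 2 = a 0*b 2 + a 2*b 0 - a 1*b 3 + a 3*b 1 + a 4*b 6 - a 6*b 4 + a 5*b 7 - a 7*b 5"
    "(x \<star> y) \<bullet> oe 3 = a 0*b 3 + a 3*b 0 + a 1*b 2 - a 2*b 1 + a 4*b 7 - a 7*b 4 - a 5*b 6 + a 6*b 5"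
    "(x \<star> y) \<bullet> oe 4 = a 0*b 4 + a 4*b 0 - a 1*b 5 + a 5*b 1 - a 2*b 6 + a 6*b 2 - a 3*b 7 + a 7*b 3"
    "(x \<star> y) \<bullet> oe 5 = a 0*b 5 + a 5*b 0 + a 1*b 4 - a 4*b 1 - a 2*b 7 + a 7*b 2 + a 3*b 6 - a 6*b 3"
    "(x \<star> y) \<bullet> oe 6 = a 0*b 6 + a 6*b 0 + a 1*b 7 - a 7*b 1 + a 2*b 4 - a 4*b 2 - a 3*b 5 + a 5*b 3"
    "(x \<star> y) \<bullet> oe 7 = a 0*b 7 + a 7*b 0 - a 1*b 6 + a 6*b 1 + a 2*b 5 - a 5*b 2 + a 3*b 4 - a 4*b 3"
  unfolding a_def b_def omult_coord sum_le7
  by (simp_all add: oe_mult_coord oct_eps_def oct_triples_def)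

lemma oconj_coord: "k \<le> 7 \<Longrightarrow> oconj x \<bullet> oe k = (if k = 0 then x \<bullet> oe 0 else - (x \<bullet> oe k))"
proof -
  assume a: "k \<le> 7"
  have "(\<Sum>l=1..7. (x \<bullet> oe l) *\<^sub>R oe l) \<bullet> oe k = (\<Sum>l=1..7. if l = k then x \<bullet> oe k else 0)"
    unfolding inner_sum_left using a by (intro sum.cong refl) (auto simp: oe_inner)
  also have "\<dots> = (if k = 0 then 0 else x \<bullet> oe k)" using a by (auto simp: sum.delta)
  finally show ?thesis using a by (auto simp: oconj_def oe_inner inner_diff_left)
qed

text \<open>
  This is the only algebraic law of the octonions that the formula rests on: the left alternative law together with
  \<open>oconj a \<star> a = |a|\<^sup>2\<close>.  In coordinates it consists of eight polynomial identities.
\<close>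

lemma oconj_omult_omult: "oconj a \<star> (a \<star> f) = (norm a)\<^sup>2 *\<^sub>R f"
proof -
  have n: "(norm a)\<^sup>2 = (\<Sum>i\<le>7. (a \<bullet> oe i) * (a \<bullet> oe i))"
    unfolding power2_norm_eq_inner by (rule oct_inner_expand)
  have c: "oconj a \<bullet> oe 0 = a \<bullet> oe 0" "oconj a \<bullet> oe 1 = - (a \<bullet> oe 1)" "oconj a \<bullet> oe 2 = - (a \<bullet> oe 2)"
    "oconj a \<bullet> oe 3 = - (a \<bullet> oe 3)" "oconj a \<bullet> oe 4 = - (a \<bullet> oe 4)" "oconj a \<bullet> oe 5 = - (a \<bullet> oe 5)"
    "oconj a \<bullet> oe 6 = - (a \<bullet> oe 6)" "oconj a \<bullet> oe 7 = - (a \<bullet> oe 7)"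
    by (simp_all add: oconj_coord)
  obtain a0 a1 a2 a3 a4 a5 a6 a7 where A: "a \<bullet> oe 0 = a0" "a \<bullet> oe 1 = a1" "a \<bullet> oe 2 = a2" "a \<bullet> oe 3 = a3"
    "a \<bullet> oe 4 = a4" "a \<bullet> oe 5 = a5" "a \<bullet> oe 6 = a6" "a \<bullet> oe 7 = a7" by blast
  obtain f0 f1 f2 f3 f4 f5 f6 f7 where F: "f \<bullet> oe 0 = f0" "f \<bullet> oe 1 = f1" "f \<bullet> oe 2 = f2" "f \<bullet> oe 3 = f3"
    "f \<bullet> oe 4 = f4" "f \<bullet> oe 5 = f5" "f \<bullet> oe 6 = f6" "f \<bullet> oe 7 = f7" by blast
  have "(oconj a \<star> (a \<star> f)) \<bullet> oe 0 = ((norm a)\<^sup>2 *\<^sub>R f) \<bullet> oe 0"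
    "(oconj a \<star> (a \<star> f)) \<bullet> oe 1 = ((norm a)\<^sup>2 *\<^sub>R f) \<bullet> oe 1"
    "(oconj a \<star> (a \<star> f)) \<bullet> oe 2 = ((norm a)\<^sup>2 *\<^sub>R f) \<bullet> oe 2"
    "(oconj a \<star> (a \<star> f)) \<bullet> oe 3 = ((norm a)\<^sup>2 *\<^sub>R f) \<bullet> oe 3"
    "(oconj a \<star> (a \<star> f)) \<bullet> oe 4 = ((norm a)\<^sup>2 *\<^sub>R f) \<bullet> oe 4"
    "(oconj a \<star> (a \<star> f)) \<bullet> oe 5 = ((norm a)\<^sup>2 *\<^sub>R f) \<bullet> oe 5"
    "(oconj a \<star> (a \<star> f)) \<bullet> oe 6 = ((norm a)\<^sup>2 *\<^sub>R f) \<bullet> oe 6"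
    "(oconj a \<star> (a \<star> f)) \<bullet> oe 7 = ((norm a)\<^sup>2 *\<^sub>R f) \<bullet> oe 7"
    by (unfold inner_scaleR_left n sum_le7 omult_coords c A F) algebra+
  then show ?thesis by (intro oct_eqI) (auto simp only: le7)
qed

lemma bounded_bilinear_omult: "bounded_bilinear (\<star>)"
proof -
  have "linear (\<lambda>y. x \<star> y)" for x
    unfolding omult_def by (intro linear_compose_sum ballI linearI) (simp_all add: inner_add_left distrib_left scaleR_add_left mult.left_commute)
  moreover have "linear (\<lambda>x. x \<star> y)" for y
    unfolding omult_def by (intro linear_compose_sum ballI linearI) (simp_all add: inner_add_left distrib_right scaleR_add_left mult.assoc)
  ultimately have "bilinear (\<star>)" unfolding bilinear_def by blast
  then show ?thesis by (simp add: bilinear_conv_bounded_bilinear)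
qed

interpretation omult: bounded_bilinear "(\<star>)" by (rule bounded_bilinear_omult)

lemma linear_oconj: "linear oconj"
  unfolding oconj_def[abs_def]
  by (intro linear_compose_sub linear_compose_sum ballI linearI) (simp_all add: inner_add_left scaleR_add_left)

lemma norm_oconj: "norm (oconj x) = norm x"
proof -
  have "(norm (oconj x))\<^sup>2 = (norm x)\<^sup>2"
    unfolding power2_norm_eq_inner oct_inner_expand[of "oconj x" "oconj x"] oct_inner_expand[of x x]
    by (intro sum.cong) (auto simp: oconj_coord)
  then show ?thesis by simp
qed

section \<open>Orthonormal sets\<close>

definition orthonormal :: "octonion set \<Rightarrow> bool" where
  "orthonormal B \<longleftrightarrow> finite B \<and> (\<forall>a\<in>B. \<forall>b\<in>B. a \<bullet> b = (if a = b then 1 else 0))"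

definition oproj :: "octonion set \<Rightarrow> octonion \<Rightarrow> octonion" where
  "oproj B x = (\<Sum>b\<in>B. (x \<bullet> b) *\<^sub>R b)"

lemma orthonormal_finite: "orthonormal B \<Longrightarrow> finite B"
  by (simp add: orthonormal_def)

lemma orthonormal_inner: "orthonormal B \<Longrightarrow> a \<in> B \<Longrightarrow> b \<in> B \<Longrightarrow> a \<bullet> b = (if a = b then 1 else 0)"
  by (simp add: orthonormal_def)

lemma orthonormal_norm: "orthonormal B \<Longrightarrow> b \<in> B \<Longrightarrow> norm b = 1"
  by (simp add: orthonormal_def norm_eq_1)

lemma orthonormal_subset: "orthonormal B \<Longrightarrow> A \<subseteq> B \<Longrightarrow> orthonormal A"
  unfolding orthonormal_def by (meson finite_subset subsetD)

lemma orthonormal_sum_inner: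
  assumes "orthonormal B" "b \<in> B"
  shows "(\<Sum>a\<in>B. c a *\<^sub>R a) \<bullet> b = c b"
proof -
  have "(\<Sum>a\<in>B. c a *\<^sub>R a) \<bullet> b = (\<Sum>a\<in>B. if a = b then c b else 0)"
    unfolding inner_sum_left using assms by (intro sum.cong) (auto simp: orthonormal_inner)
  then show ?thesis using assms by (simp add: orthonormal_finite)
qed

lemma orthonormal_perp:
  assumes "orthonormal B" "A \<subseteq> B" "b \<in> B" "b \<notin> A" "x \<in> span A"
  shows "x \<bullet> b = 0"
proof -
  have "orthogonal b x"
    using assms(5)
  proof (rule orthogonal_to_span)
    fix a assume "a \<in> A"
    then show "orthogonal b a" using assms by (auto simp: orthogonal_def orthonormal_inner)
  qed
  then show ?thesis by (simp add: orthogonal_def inner_commute)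
qed

lemma linear_oproj: "linear (oproj B)"
  unfolding oproj_def[abs_def] linear_iff
  by (auto simp: inner_add_left scaleR_add_left sum.distrib scaleR_sum_right)

lemma bounded_linear_oproj: "bounded_linear (oproj B)"
  using linear_oproj by (simp add: linear_conv_bounded_linear)

lemma continuous_oproj[continuous_intros]:
  "continuous_on S f \<Longrightarrow> continuous_on S (\<lambda>x. oproj B (f x))"
  by (rule bounded_linear.continuous_on[OF bounded_linear_oproj])

lemma measurable_oproj[measurable]: "oproj B \<in> borel_measurable borel"
  by (intro borel_measurable_continuous_onI continuous_intros)

lemma oproj_in_span: "oproj B x \<in> span B"
  unfolding oproj_def by (intro span_sum span_scale span_base)

lemma oproj_span:
  assumes "orthonormal B" "x \<in> span B" shows "oproj B x = x"
  using assms(2)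
proof (induction rule: span_induct_alt)
  case base show ?case using linear_0[OF linear_oproj] .
next
  case (step c a y)
  have "oproj B a = (\<Sum>b\<in>B. if b = a then a else 0)"
    unfolding oproj_def using assms step by (intro sum.cong) (auto simp: orthonormal_inner)
  also have "\<dots> = a" using assms step by (simp add: orthonormal_finite)
  finally show ?case using step
    by (simp add: linear_add[OF linear_oproj] linear_scale[OF linear_oproj])
qed

lemma oproj_inner: "orthonormal B \<Longrightarrow> b \<in> B \<Longrightarrow> oproj B x \<bullet> b = x \<bullet> b"
  unfolding oproj_def by (rule orthonormal_sum_inner)

lemma norm_oproj_le:
  assumes "orthonormal B" shows "norm (oproj B x) \<le> norm x"
proof -
  have *: "oproj B x \<bullet> z = (\<Sum>b\<in>B. (x \<bullet> b) * (z \<bullet> b))" for z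
    unfolding oproj_def by (simp add: inner_sum_left inner_sum_right inner_commute[of _ z])
  have "oproj B x \<bullet> oproj B x = oproj B x \<bullet> x"
    by (subst *[of "oproj B x"], subst *[of x], intro sum.cong) (simp_all add: oproj_inner[OF assms])
  then have "(norm x)\<^sup>2 = (norm (oproj B x))\<^sup>2 + (norm (x - oproj B x))\<^sup>2"
    by (simp add: power2_norm_eq_inner inner_diff_left inner_diff_right inner_commute)
  then have "(norm (oproj B x))\<^sup>2 \<le> (norm x)\<^sup>2" by simp
  then show ?thesis by simp
qed

lemma oproj_remove:
  assumes "finite B" "b \<in> B" shows "oproj (B - {b}) x = oproj B x - (x \<bullet> b) *\<^sub>R b"
  using sum.remove[OF assms, of "\<lambda>b. (x \<bullet> b) *\<^sub>R b"] by (simp add: oproj_def)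

lemma inner_span:
  assumes "orthonormal B" "x \<in> span B" shows "x \<bullet> y = (\<Sum>b\<in>B. (x \<bullet> b) * (y \<bullet> b))"
  using arg_cong[OF oproj_span[OF assms], of "\<lambda>z. z \<bullet> y"]
  by (simp add: oproj_def inner_sum_left inner_sum_right inner_commute[of _ y])

lemma borel_span[measurable]: "span B \<in> sets (borel :: octonion measure)"
  by (intro borel_closed closed_span)

section \<open>Lebesgue measure on the span of an orthonormal set\<close>

interpretation PL: product_sigma_finite "\<lambda>_::octonion. lborel :: real measure" ..

lemma sets_vol[simp, measurable_cong]: "sets (vol B) = sets borel"
  and space_vol[simp]: "space (vol B) = UNIV"
  by (simp_all add: vol_def)

lemma measurable_comb[measurable]:
  "(\<lambda>c. \<Sum>b\<in>B. c b *\<^sub>R b) \<in> (\<Pi>\<^sub>M b\<in>B. (lborel :: real measure)) \<rightarrow>\<^sub>M (borel :: octonion measure)"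
  by measurable

lemma vol_nn_integral_empty:
  assumes "F \<in> borel_measurable borel"
  shows "(\<integral>\<^sup>+x. F x \<partial>vol {}) = F 0"
  unfolding vol_def using assms by (subst nn_integral_distr) (simp, simp, subst PL.nn_integral_empty, auto)

text \<open>
  Tonelli's theorem, one basis vector at a time: the recursion by which facts about \<open>vol\<close> are proved by induction on
  the basis.
\<close>

lemma vol_nn_integral_insert:
  assumes "finite B" "b \<notin> B" and [measurable]: "F \<in> borel_measurable borel"
  shows "(\<integral>\<^sup>+x. F x \<partial>vol (insert b B)) = (\<integral>\<^sup>+x. (\<integral>\<^sup>+t. F (x + t *\<^sub>R b) \<partial>lborel) \<partial>vol B)"
proof -
  have "(\<integral>\<^sup>+x. F x \<partial>vol (insert b B)) = (\<integral>\<^sup>+c. F (\<Sum>a\<in>insert b B. c a *\<^sub>R a) \<partial>(\<Pi>\<^sub>M b\<in>insert b B. lborel))"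
    unfolding vol_def by (intro nn_integral_distr) auto
  also have "\<dots> = (\<integral>\<^sup>+c. (\<integral>\<^sup>+t. F (\<Sum>a\<in>insert b B. (c(b := t)) a *\<^sub>R a) \<partial>lborel) \<partial>(\<Pi>\<^sub>M b\<in>B. lborel))"
    using assms by (intro PL.product_nn_integral_insert) auto
  also have "\<dots> = (\<integral>\<^sup>+c. (\<integral>\<^sup>+t. F ((\<Sum>a\<in>B. c a *\<^sub>R a) + t *\<^sub>R b) \<partial>lborel) \<partial>(\<Pi>\<^sub>M b\<in>B. lborel))"
  proof (intro nn_integral_cong arg_cong[where f = F])
    fix c t
    have "(\<Sum>a\<in>B. (c(b := t)) a *\<^sub>R a) = (\<Sum>a\<in>B. c a *\<^sub>R a)" using assms by (intro sum.cong) auto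
    then show "(\<Sum>a\<in>insert b B. (c(b := t)) a *\<^sub>R a) = (\<Sum>a\<in>B. c a *\<^sub>R a) + t *\<^sub>R b"
      using assms by (simp add: add.commute)
  qed
  also have "\<dots> = (\<integral>\<^sup>+x. (\<integral>\<^sup>+t. F (x + t *\<^sub>R b) \<partial>lborel) \<partial>vol B)"
    unfolding vol_def by (intro nn_integral_distr[symmetric]) auto
  finally show ?thesis .
qed

text \<open>
  For fixed \<open>x\<close> the map \<open>t \<mapsto> s (h x + t)\<close> is an isometry of the line, so heights may be measured from a graph
  \<open>h\<close> instead of from the plane.  This flattens the boundary in the divergence theorem.
\<close>

lemma vol_shear:
  fixes h :: "octonion \<Rightarrow> real"
  assumes "finite B" "b \<notin> B" "s \<in> {1, -1::real}" and [measurable]: "h \<in> borel_measurable borel"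
  shows "vol (insert b B) = distr (vol B \<Otimes>\<^sub>M lborel) borel (\<lambda>(x, t). x + (s * (h x + t)) *\<^sub>R b)"
proof (rule measure_eqI)
  fix A assume "A \<in> sets (vol (insert b B))"
  then have A[measurable]: "A \<in> sets borel" by simp
  have "emeasure (vol (insert b B)) A = (\<integral>\<^sup>+x. indicator A x \<partial>vol (insert b B))" by simp
  also have "\<dots> = (\<integral>\<^sup>+x. (\<integral>\<^sup>+t. indicator A (x + t *\<^sub>R b) \<partial>lborel) \<partial>vol B)"
    using assms by (intro vol_nn_integral_insert) auto
  also have "\<dots> = (\<integral>\<^sup>+x. (\<integral>\<^sup>+t. indicator A (x + (s * h x + s * t) *\<^sub>R b) \<partial>lborel) \<partial>vol B)"
  proof (rule nn_integral_cong)
    fix x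
    have "(\<integral>\<^sup>+t. (indicator A (x + t *\<^sub>R b) :: ennreal) \<partial>lborel) = ennreal \<bar>s\<bar> * (\<integral>\<^sup>+t. indicator A (x + (s * h x + s * t) *\<^sub>R b) \<partial>lborel)"
      using assms(3) by (intro nn_integral_real_affine) auto
    then show "(\<integral>\<^sup>+t. (indicator A (x + t *\<^sub>R b) :: ennreal) \<partial>lborel) = (\<integral>\<^sup>+t. indicator A (x + (s * h x + s * t) *\<^sub>R b) \<partial>lborel)"
      using assms(3) by auto
  qed
  also have "\<dots> = (\<integral>\<^sup>+z. indicator A (fst z + (s * (h (fst z) + snd z)) *\<^sub>R b) \<partial>(vol B \<Otimes>\<^sub>M lborel))"
    by (subst lborel.nn_integral_fst[symmetric]) (auto simp: distrib_left)
  also have "\<dots> = (\<integral>\<^sup>+x. indicator A x \<partial>distr (vol B \<Otimes>\<^sub>M lborel) borel (\<lambda>(x, t). x + (s * (h x + t)) *\<^sub>R b))"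
    by (subst nn_integral_distr) (auto simp: case_prod_beta)
  finally show "emeasure (vol (insert b B)) A = emeasure (distr (vol B \<Otimes>\<^sub>M lborel) borel (\<lambda>(x, t). x + (s * (h x + t)) *\<^sub>R b)) A"
    by simp
qed simp

lemma AE_vol_span: assumes "finite B" shows "AE x in vol B. x \<in> span B"
  unfolding vol_def
proof (subst AE_distr_iff)
  show "AE c in Pi\<^sub>M B (\<lambda>b. lborel). (\<Sum>b\<in>B. c b *\<^sub>R b) \<in> span B"
    by (intro AE_I2 span_sum span_scale span_base)
qed auto

lemma emeasure_vol_cball:
  assumes "orthonormal B"
  shows "emeasure (vol B) (cball 0 R) < \<infinity>"
proof -
  let ?P = "\<Pi>\<^sub>M b\<in>B. (lborel :: real measure)"
  have "emeasure (vol B) (cball 0 R) = emeasure ?P ((\<lambda>c. \<Sum>b\<in>B. c b *\<^sub>R b) -` cball 0 R \<inter> space ?P)"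
    unfolding vol_def by (intro emeasure_distr) auto
  also have "\<dots> \<le> emeasure ?P (Pi\<^sub>E B (\<lambda>_. {-R..R}))"
  proof (intro emeasure_mono subsetI)
    fix c assume c: "c \<in> (\<lambda>c. \<Sum>b\<in>B. c b *\<^sub>R b) -` cball 0 R \<inter> space ?P"
    have "\<bar>c b\<bar> \<le> R" if "b \<in> B" for b
    proof -
      have "\<bar>c b\<bar> = \<bar>(\<Sum>b\<in>B. c b *\<^sub>R b) \<bullet> b\<bar>" by (subst orthonormal_sum_inner[OF assms that]) simp
      also have "\<dots> \<le> norm (\<Sum>b\<in>B. c b *\<^sub>R b) * norm b" by (rule Cauchy_Schwarz_ineq2)
      also have "\<dots> \<le> R" using c by (simp add: orthonormal_norm[OF assms that])
      finally show ?thesis .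
    qed
    then show "c \<in> Pi\<^sub>E B (\<lambda>_. {-R..R})" using c
      by (auto simp: space_PiM PiE_iff abs_le_iff) (metis minus_le_iff)
  qed (use assms in \<open>auto intro!: sets_PiM_I_finite simp: orthonormal_finite\<close>)
  also have "\<dots> = (\<Prod>b\<in>B. emeasure lborel {-R..R})"
    using assms by (intro PL.emeasure_PiM) (auto simp: orthonormal_finite)
  also have "\<dots> < \<infinity>" by (simp add: emeasure_lborel_Icc_eq power_less_top_ennreal)
  finally show ?thesis .
qed

lemma sigma_finite_vol: assumes "orthonormal B" shows "sigma_finite_measure (vol B)"
proof
  show "\<exists>A. countable A \<and> A \<subseteq> sets (vol B) \<and> \<Union>A = space (vol B) \<and> (\<forall>a\<in>A. emeasure (vol B) a \<noteq> \<infinity>)"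
  proof (intro exI conjI)
    show "\<Union>(range (\<lambda>n::nat. cball 0 (real n))) = space (vol B)"
      by (auto simp: real_arch_simple)
    show "\<forall>a\<in>range (\<lambda>n::nat. cball 0 (real n)). emeasure (vol B) a \<noteq> \<infinity>"
    proof safe
      fix n assume "emeasure (vol B) (cball 0 (real n)) = \<infinity>"
      then show False using emeasure_vol_cball[OF assms, of "real n"] by simp
    qed
  qed auto
qed

lemma vol_integral_shear:
  fixes F :: "octonion \<Rightarrow> 'c::{banach, second_countable_topology}" and h :: "octonion \<Rightarrow> real"
  assumes "orthonormal (insert b B)" "b \<notin> B" "s \<in> {1, -1::real}" and [measurable]: "h \<in> borel_measurable borel"
    and F: "integrable (vol (insert b B)) F"
  shows "(\<integral>x. F x \<partial>vol (insert b B)) = (\<integral>x. (\<integral>t. F (x + (s * (h x + t)) *\<^sub>R b) \<partial>lborel) \<partial>vol B)"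
    and "(\<integral>x. F x \<partial>vol (insert b B)) = (\<integral>t. (\<integral>x. F (x + (s * (h x + t)) *\<^sub>R b) \<partial>vol B) \<partial>lborel)"
proof -
  have oB: "orthonormal B" using assms(1) by (rule orthonormal_subset) auto
  have fin: "finite B" by (rule orthonormal_finite[OF oB])
  note shear = vol_shear[OF fin assms(2,3,4)]
  interpret V: sigma_finite_measure "vol B" by (rule sigma_finite_vol[OF oB])
  interpret P: pair_sigma_finite "vol B" "lborel :: real measure" ..
  have [measurable]: "F \<in> borel_measurable borel" using F by (simp add: measurable_cong_sets[OF sets_vol refl])
  have meas: "(\<lambda>(x, t). x + (s * (h x + t)) *\<^sub>R b) \<in> vol B \<Otimes>\<^sub>M lborel \<rightarrow>\<^sub>M borel" by measurable
  have "integrable (vol B \<Otimes>\<^sub>M lborel) (\<lambda>z. F (case z of (x, t) \<Rightarrow> x + (s * (h x + t)) *\<^sub>R b))"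
    using F unfolding shear by (rule integrable_distr[OF meas])
  then have I': "integrable (vol B \<Otimes>\<^sub>M lborel) (\<lambda>(x, t). F (x + (s * (h x + t)) *\<^sub>R b))" by (simp add: case_prod_beta')
  have eq: "(\<integral>x. F x \<partial>vol (insert b B)) = (\<integral>(x, t). F (x + (s * (h x + t)) *\<^sub>R b) \<partial>(vol B \<Otimes>\<^sub>M lborel))"
    unfolding shear by (subst integral_distr[OF meas]) (auto simp: case_prod_beta')
  show "(\<integral>x. F x \<partial>vol (insert b B)) = (\<integral>x. (\<integral>t. F (x + (s * (h x + t)) *\<^sub>R b) \<partial>lborel) \<partial>vol B)"
    unfolding eq using P.integral_fst[OF I'] by simp
  show "(\<integral>x. F x \<partial>vol (insert b B)) = (\<integral>t. (\<integral>x. F (x + (s * (h x + t)) *\<^sub>R b) \<partial>vol B) \<partial>lborel)"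
    unfolding eq using P.integral_snd[OF I'] by simp
qed

lemma integrable_vol_bounded_support:
  fixes F :: "octonion \<Rightarrow> 'c::{banach, second_countable_topology}"
  assumes "orthonormal B" "F \<in> borel_measurable borel"
    and "\<And>x. x \<in> span B \<Longrightarrow> norm x \<le> R \<Longrightarrow> norm (F x) \<le> C"
    and "\<And>x. x \<in> span B \<Longrightarrow> R < norm x \<Longrightarrow> F x = 0"
  shows "integrable (vol B) F"
proof (rule integrableI_bounded_set[where A = "cball 0 R" and B = C])
  show "AE x in vol B. x \<in> cball 0 R \<longrightarrow> norm (F x) \<le> C" "AE x in vol B. x \<notin> cball 0 R \<longrightarrow> F x = 0"
    using AE_vol_span[OF orthonormal_finite[OF assms(1)]] by (eventually_elim, use assms(3,4) in auto)+
qed (use assms emeasure_vol_cball in \<open>auto simp: measurable_cong_sets[OF sets_vol refl]\<close>)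

lemma vol_nn_integral_affine:
  assumes "finite B" "a \<in> span B" "0 < \<epsilon>" and "F \<in> borel_measurable borel"
  shows "(\<integral>\<^sup>+x. F x \<partial>vol B) = ennreal (\<epsilon> ^ card B) * (\<integral>\<^sup>+x. F (a + \<epsilon> *\<^sub>R x) \<partial>vol B)"
  using assms(1,2,4)
proof (induction B arbitrary: a F rule: finite_induct)
  case empty then show ?case by (simp add: vol_nn_integral_empty)
next
  case (insert b B)
  note [measurable] = insert.prems(2)
  obtain k where "a - k *\<^sub>R b \<in> span B" using insert.prems(1) by (auto simp: span_breakdown_eq)
  define a' where "a' = a - k *\<^sub>R b"
  have a': "a' \<in> span B" "a = a' + k *\<^sub>R b" using \<open>a - k *\<^sub>R b \<in> span B\<close> by (auto simp: a'_def)
  have "(\<integral>\<^sup>+x. F x \<partial>vol (insert b B)) = (\<integral>\<^sup>+x. (\<integral>\<^sup>+t. F (x + t *\<^sub>R b) \<partial>lborel) \<partial>vol B)"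
    by (rule vol_nn_integral_insert) (use insert in auto)
  also have "\<dots> = ennreal (\<epsilon> ^ card B) * (\<integral>\<^sup>+x. (\<integral>\<^sup>+t. F ((a' + \<epsilon> *\<^sub>R x) + t *\<^sub>R b) \<partial>lborel) \<partial>vol B)"
    by (rule insert.IH[OF a'(1)]) simp
  also have "(\<integral>\<^sup>+x. (\<integral>\<^sup>+t. F ((a' + \<epsilon> *\<^sub>R x) + t *\<^sub>R b) \<partial>lborel) \<partial>vol B) =
      (\<integral>\<^sup>+x. ennreal \<epsilon> * (\<integral>\<^sup>+t. F ((a' + \<epsilon> *\<^sub>R x) + (k + \<epsilon> * t) *\<^sub>R b) \<partial>lborel) \<partial>vol B)"
    using \<open>0 < \<epsilon>\<close> by (intro nn_integral_cong) (subst nn_integral_real_affine[where c = \<epsilon> and t = k], auto)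
  also have "\<dots> = ennreal \<epsilon> * (\<integral>\<^sup>+x. (\<integral>\<^sup>+t. F ((a' + \<epsilon> *\<^sub>R x) + (k + \<epsilon> * t) *\<^sub>R b) \<partial>lborel) \<partial>vol B)"
    by (intro nn_integral_cmult) simp
  also have "(\<integral>\<^sup>+x. (\<integral>\<^sup>+t. F ((a' + \<epsilon> *\<^sub>R x) + (k + \<epsilon> * t) *\<^sub>R b) \<partial>lborel) \<partial>vol B) =
     (\<integral>\<^sup>+x. (\<integral>\<^sup>+t. F (a + \<epsilon> *\<^sub>R (x + t *\<^sub>R b)) \<partial>lborel) \<partial>vol B)"
    by (intro nn_integral_cong arg_cong[where f = F]) (simp add: a'(2) algebra_simps)
  also have "\<dots> = (\<integral>\<^sup>+x. F (a + \<epsilon> *\<^sub>R x) \<partial>vol (insert b B))"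
    by (subst vol_nn_integral_insert[where F = "\<lambda>x. F (a + \<epsilon> *\<^sub>R x)"]) (use insert in auto)
  finally show ?case using insert \<open>0 < \<epsilon>\<close> by (simp add: ennreal_mult' mult_ac)
qed

text \<open>
  Used to split \<open>real^8\<close> into a coordinate subspace and its complement.
\<close>

lemma vol_nn_integral_union:
  assumes "finite A" "finite B" "A \<inter> B = {}" and "F \<in> borel_measurable borel"
  shows "(\<integral>\<^sup>+x. F x \<partial>vol (A \<union> B)) = (\<integral>\<^sup>+x. (\<integral>\<^sup>+y. F (x + y) \<partial>vol B) \<partial>vol A)"
  using assms(2,3,4)
proof (induction B arbitrary: F rule: finite_induct)
  case empty
  note [measurable] = empty(2)
  show ?case by (simp add: vol_nn_integral_empty)
next
  case (insert b B)
  note [measurable] = insert.prems(2)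
  have "(\<integral>\<^sup>+x. F x \<partial>vol (A \<union> insert b B)) = (\<integral>\<^sup>+x. (\<integral>\<^sup>+t. F (x + t *\<^sub>R b) \<partial>lborel) \<partial>vol (A \<union> B))"
    using insert assms(1) by (simp add: vol_nn_integral_insert)
  also have "\<dots> = (\<integral>\<^sup>+x. (\<integral>\<^sup>+y. (\<integral>\<^sup>+t. F (x + y + t *\<^sub>R b) \<partial>lborel) \<partial>vol B) \<partial>vol A)"
    by (intro insert.IH) (use insert in auto)
  also have "\<dots> = (\<integral>\<^sup>+x. (\<integral>\<^sup>+y. F (x + y) \<partial>vol (insert b B)) \<partial>vol A)"
    by (intro nn_integral_cong) (use insert in \<open>simp add: vol_nn_integral_insert add.assoc\<close>)
  finally show ?case .
qed

text \<open>
  Both measures are push-forwards of the product measure on coordinates, and \<open>J\<close> carries the point with coordinates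
  \<open>c\<close> in \<open>B\<close> to the point with the same coordinates in \<open>J ` B\<close>.
\<close>

lemma vol_image:
  assumes "finite B" "linear J" "inj_on J B"
  shows "vol (J ` B) = distr (vol B) borel J"
proof -
  have cJ: "continuous_on UNIV J"
    using assms(2) by (simp add: linear_continuous_on linear_conv_bounded_linear)
  have [measurable]: "J \<in> borel_measurable borel" by (intro borel_measurable_continuous_onI cJ)
  have nn: "(\<integral>\<^sup>+x. F x \<partial>vol (J ` B)) = (\<integral>\<^sup>+x. F (J x) \<partial>vol B)" if "F \<in> borel_measurable borel" for F
    using assms(1,3) that
  proof (induction B arbitrary: F rule: finite_induct)
    case empty then show ?case by (simp add: vol_nn_integral_empty linear_0[OF assms(2)])
  next
    case (insert b B)
    note [measurable] = insert.prems(2)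
    have *: "J b \<notin> J ` B" using insert by auto
    have "(\<integral>\<^sup>+x. F x \<partial>vol (J ` insert b B)) = (\<integral>\<^sup>+x. (\<integral>\<^sup>+t. F (x + t *\<^sub>R J b) \<partial>lborel) \<partial>vol (J ` B))"
      using insert * by (simp add: vol_nn_integral_insert)
    also have "\<dots> = (\<integral>\<^sup>+x. (\<integral>\<^sup>+t. F (J x + t *\<^sub>R J b) \<partial>lborel) \<partial>vol B)"
      by (intro insert.IH) (use insert in auto)
    also have "\<dots> = (\<integral>\<^sup>+x. F (J x) \<partial>vol (insert b B))"
      using insert by (simp add: vol_nn_integral_insert linear_add[OF assms(2)] linear_scale[OF assms(2)])
    finally show ?case .
  qed
  show ?thesis
  proof (rule measure_eqI)
    fix A assume "A \<in> sets (vol (J ` B))"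
    then have [measurable]: "A \<in> sets borel" by simp
    show "emeasure (vol (J ` B)) A = emeasure (distr (vol B) borel J) A"
      using nn[of "indicator A"] nn_integral_distr[of J "vol B" borel "indicator A"] by simp
  qed simp
qed

lemma vol_Basis: "vol Basis = lborel"
  unfolding vol_def by (rule lborel_eq[symmetric])

section \<open>Differentiability\<close>

text \<open>
  The increment is telescoped along the basis: in the
  induction on \<open>A \<subseteq> B\<close> the direction \<open>c\<close> is added by moving from \<open>x + w\<close> with \<open>w \<in> span A\<close> to \<open>x + w + \<tau> c\<close>, which the
  mean value inequality controls because the partial derivative along \<open>c\<close> varies little near \<open>x\<close>.
\<close>

lemma C1_partials_imp_has_derivative:
  fixes f :: "octonion \<Rightarrow> 'b::real_normed_vector"
  assumes B: "orthonormal B" and S: "openin (top_of_set (span B)) S" and x: "x \<in> S"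
    and der: "\<And>b y. b \<in> B \<Longrightarrow> y \<in> S \<Longrightarrow> ((\<lambda>t. f (y + t *\<^sub>R b)) has_vector_derivative g b y) (at 0)"
    and cont: "\<And>b. b \<in> B \<Longrightarrow> continuous_on S (g b)"
  shows "(f has_derivative (\<lambda>v. \<Sum>b\<in>B. (v \<bullet> b) *\<^sub>R g b x)) (at x within span B)"
proof -
  obtain r where r: "r > 0" "ball x r \<inter> span B \<subseteq> S"
    using S x unfolding openin_contains_ball by blast
  have xB: "x \<in> span B" using S x openin_imp_subset by blast
  have "\<exists>d>0. \<forall>v\<in>span A. norm v < d \<longrightarrow> norm (f (x + v) - f x - (\<Sum>b\<in>A. (v \<bullet> b) *\<^sub>R g b x)) \<le> e * norm v"
    if "A \<subseteq> B" "e > 0" for A e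
    using orthonormal_finite[OF orthonormal_subset[OF B that(1)]] that
  proof (induction A arbitrary: e rule: finite_induct)
    case empty then show ?case by (intro exI[of _ 1]) auto
  next
    case (insert c A)
    have oA: "orthonormal A" "orthonormal (insert c A)" using B insert.prems by (auto intro: orthonormal_subset)
    have c: "c \<in> B" "norm c = 1" using insert.prems B by (auto intro: orthonormal_norm)
    obtain d1 where d1: "d1 > 0" "\<And>v. v \<in> span A \<Longrightarrow> norm v < d1 \<Longrightarrow>
        norm (f (x + v) - f x - (\<Sum>b\<in>A. (v \<bullet> b) *\<^sub>R g b x)) \<le> (e/2) * norm v"
      using insert.IH[of "e/2"] insert.prems by auto
    obtain d3 where d3: "d3 > 0" "\<And>y. y \<in> S \<Longrightarrow> dist y x < d3 \<Longrightarrow> dist (g c y) (g c x) < e/2"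
      using cont[OF c(1)] x insert.prems(2) unfolding continuous_on_iff by (metis half_gt_zero)
    define d where "d = min d1 (min r d3) / 2"
    have d: "d > 0" "2 * d \<le> d1" "2 * d \<le> r" "2 * d \<le> d3" using d1 r d3 by (auto simp: d_def)
    show ?case
    proof (intro exI[of _ d] conjI ballI impI d(1))
      fix v assume v: "v \<in> span (insert c A)" "norm v < d"
      define \<tau> where "\<tau> = v \<bullet> c"
      define w where "w = oproj A v"
      have w: "w \<in> span A" "norm w \<le> norm v" by (auto simp: w_def oproj_in_span norm_oproj_le[OF oA(1)])
      have vw: "v = w + \<tau> *\<^sub>R c"
        using oproj_span[OF oA(2) v(1)] insert.hyps by (simp add: w_def \<tau>_def oproj_def add.commute)
      have \<tau>: "\<bar>\<tau>\<bar> \<le> norm v" using Cauchy_Schwarz_ineq2[of v c] by (simp add: \<tau>_def c(2))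
      have spAB: "span A \<subseteq> span B" using insert.prems by (intro span_mono) auto
      have inS: "x + w + t *\<^sub>R c \<in> S \<and> dist (x + w + t *\<^sub>R c) x < d3" if "\<bar>t\<bar> \<le> \<bar>\<tau>\<bar>" for t
      proof -
        have "norm (w + t *\<^sub>R c) \<le> norm w + \<bar>t\<bar>" using norm_triangle_ineq[of w "t *\<^sub>R c"] c(2) by simp
        also have "\<dots> < 2 * d" using w \<tau> that v(2) by linarith
        finally have n: "norm (w + t *\<^sub>R c) < 2 * d" .
        moreover have "x + w + t *\<^sub>R c \<in> span B"
          using w spAB xB c by (intro span_add span_scale) (auto intro: span_base)
        ultimately show ?thesis using r d by (auto simp: dist_norm norm_minus_commute add.assoc subset_iff)
      qed
      have "norm (f (x + w + \<tau> *\<^sub>R c) - f (x + w + 0 *\<^sub>R c) - \<tau> *\<^sub>R g c x) \<le> \<bar>\<tau>\<bar> * (e/2)"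
      proof -
        define h where "h t = f (x + w + t *\<^sub>R c) - t *\<^sub>R g c x" for t
        have "(h has_derivative (\<lambda>s. s *\<^sub>R (g c (x + w + t *\<^sub>R c) - g c x))) (at t within closed_segment 0 \<tau>)"
          if "t \<in> closed_segment 0 \<tau>" for t
        proof -
          have tt: "\<bar>t\<bar> \<le> \<bar>\<tau>\<bar>" using that by (auto simp: closed_segment_eq_real_ivl split: if_splits)
          have "((\<lambda>s. f ((x + w + t *\<^sub>R c) + s *\<^sub>R c)) has_vector_derivative g c (x + w + t *\<^sub>R c)) (at 0)"
            by (rule der) (use inS[OF tt] c in auto)
          then have "((\<lambda>s. f ((x + w + t *\<^sub>R c) + s *\<^sub>R c)) has_vector_derivative g c (x + w + t *\<^sub>R c)) (at (t - t))"
            by simp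
          then have "(((\<lambda>s. f ((x + w + t *\<^sub>R c) + s *\<^sub>R c)) \<circ> (\<lambda>u. u - t)) has_vector_derivative 1 *\<^sub>R g c (x + w + t *\<^sub>R c)) (at t)"
            by (intro vector_diff_chain_at) (auto intro!: derivative_eq_intros)
          moreover have "(\<lambda>s. f ((x + w + t *\<^sub>R c) + s *\<^sub>R c)) \<circ> (\<lambda>u. u - t) = (\<lambda>u. f (x + w + u *\<^sub>R c))"
            by (auto simp: algebra_simps)
          ultimately have "((\<lambda>u. f (x + w + u *\<^sub>R c)) has_vector_derivative g c (x + w + t *\<^sub>R c)) (at t)" by simp
          then have "(h has_vector_derivative (g c (x + w + t *\<^sub>R c) - g c x)) (at t)"
            unfolding h_def by (auto intro!: derivative_eq_intros)
          then show ?thesis by (auto simp: has_vector_derivative_def intro: has_derivative_at_withinI)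
        qed
        moreover have "onorm (\<lambda>s. s *\<^sub>R (g c (x + w + t *\<^sub>R c) - g c x)) \<le> e/2" if "t \<in> closed_segment 0 \<tau>" for t
        proof -
          have tt: "\<bar>t\<bar> \<le> \<bar>\<tau>\<bar>" using that by (auto simp: closed_segment_eq_real_ivl split: if_splits)
          have "norm (g c (x + w + t *\<^sub>R c) - g c x) \<le> e/2"
            using d3(2)[of "x + w + t *\<^sub>R c"] inS[OF tt] by (simp add: dist_norm less_imp_le)
          then have "norm (s *\<^sub>R (g c (x + w + t *\<^sub>R c) - g c x)) \<le> (e/2) * norm s" for s
            by (metis abs_ge_zero mult.commute mult_left_mono norm_scaleR real_norm_def)
          then show ?thesis by (intro onorm_bound) (use insert.prems in auto)
        qed
        ultimately have "norm (h \<tau> - h 0) \<le> (e/2) * norm (\<tau> - 0)"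
          by (intro differentiable_bound[where S = "closed_segment 0 \<tau>"]) auto
        then show ?thesis by (simp add: h_def algebra_simps)
      qed
      moreover have "norm (f (x + w) - f x - (\<Sum>b\<in>A. (w \<bullet> b) *\<^sub>R g b x)) \<le> (e/2) * norm w"
        by (intro d1(2)) (use w v d in auto)
      moreover have "(\<Sum>b\<in>insert c A. (v \<bullet> b) *\<^sub>R g b x) = \<tau> *\<^sub>R g c x + (\<Sum>b\<in>A. (w \<bullet> b) *\<^sub>R g b x)"
        using insert.hyps by (simp add: \<tau>_def w_def oproj_inner[OF oA(1)])
      moreover have "f (x + v) - f x - (\<tau> *\<^sub>R g c x + P) = (f (x + w + \<tau> *\<^sub>R c) - f (x + w + 0 *\<^sub>R c) - \<tau> *\<^sub>R g c x) + (f (x + w) - f x - P)" for P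
        by (simp add: vw add.assoc)
      ultimately have "norm (f (x + v) - f x - (\<Sum>b\<in>insert c A. (v \<bullet> b) *\<^sub>R g b x)) \<le> \<bar>\<tau>\<bar> * (e/2) + (e/2) * norm w"
        by (smt (verit, best) norm_triangle_ineq)
      also have "\<dots> \<le> norm v * (e/2) + (e/2) * norm v"
        using \<tau> w insert.prems by (intro add_mono mult_right_mono mult_left_mono) auto
      finally show "norm (f (x + v) - f x - (\<Sum>b\<in>insert c A. (v \<bullet> b) *\<^sub>R g b x)) \<le> e * norm v" by simp
    qed
  qed
  from this[OF order.refl] have *: "\<exists>d>0. \<forall>v\<in>span B. norm v < d \<longrightarrow> norm (f (x + v) - f x - (\<Sum>b\<in>B. (v \<bullet> b) *\<^sub>R g b x)) \<le> e * norm v"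
    if "e > 0" for e using that by blast
  show ?thesis
    unfolding has_derivative_within_alt
  proof (intro conjI allI impI)
    show "bounded_linear (\<lambda>v. \<Sum>b\<in>B. (v \<bullet> b) *\<^sub>R g b x)"
      by (intro bounded_linear_sum bounded_linear_scaleR_const bounded_linear_inner_left)
    fix e :: real assume "e > 0"
    then obtain d where d: "d > 0" "\<And>v. v \<in> span B \<Longrightarrow> norm v < d \<Longrightarrow> norm (f (x + v) - f x - (\<Sum>b\<in>B. (v \<bullet> b) *\<^sub>R g b x)) \<le> e * norm v"
      using * by blast
    show "\<exists>d>0. \<forall>y\<in>span B. norm (y - x) < d \<longrightarrow> norm (f y - f x - (\<Sum>b\<in>B. ((y - x) \<bullet> b) *\<^sub>R g b x)) \<le> e * norm (y - x)"
    proof (intro exI[of _ d] conjI ballI impI d(1))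
      fix y assume "y \<in> span B" "norm (y - x) < d"
      then show "norm (f y - f x - (\<Sum>b\<in>B. ((y - x) \<bullet> b) *\<^sub>R g b x)) \<le> e * norm (y - x)"
        using d(2)[of "y - x"] xB by (simp add: span_diff)
    qed
  qed
qed

lemma has_vector_derivative_along_curve:
  fixes f :: "octonion \<Rightarrow> 'b::real_normed_vector"
  assumes f: "(f has_derivative D) (at (c t) within T)"
    and c: "(c has_vector_derivative v) (at t)" and cT: "\<And>u. c u \<in> T"
  shows "((\<lambda>u. f (c u)) has_vector_derivative D v) (at t)"
proof -
  interpret D: bounded_linear D using f by (rule has_derivative_bounded_linear)
  have "((\<lambda>u. f (c u)) has_derivative (\<lambda>h. D (h *\<^sub>R v))) (at t)"
    using c unfolding has_vector_derivative_def
    by (rule has_derivative_in_compose) (rule has_derivative_subset[OF f], use cT in auto)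
  then show ?thesis by (simp add: has_vector_derivative_def D.scaleR)
qed

text \<open>
  The height function of a graph and its gradient are defined on the whole octonion space rather than only on
  \<open>span A\<close>: then measurability and continuity can be stated globally.
\<close>

definition C1_field :: "octonion set \<Rightarrow> (octonion \<Rightarrow> real) \<Rightarrow> (octonion \<Rightarrow> octonion) \<Rightarrow> bool" where
  "C1_field A \<gamma> grad \<longleftrightarrow> continuous_on UNIV \<gamma> \<and> continuous_on UNIV grad \<and> (\<forall>x. grad x \<in> span A) \<and>
     (\<forall>x\<in>span A. (\<gamma> has_derivative (\<lambda>v. grad x \<bullet> v)) (at x within span A))"

section \<open>Divergence theorem above a graph\<close>

lemma FTC_lborel:
  fixes F f :: "real \<Rightarrow> 'b::euclidean_space"
  assumes "a \<le> b" "continuous_on {a..b} F" "continuous_on {a..b} f"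
    and "\<And>x. a < x \<Longrightarrow> x < b \<Longrightarrow> (F has_vector_derivative f x) (at x)"
  shows "(\<integral>x. indicator {a..b} x *\<^sub>R f x \<partial>lborel) = F b - F a"
proof -
  have "(LINT x:{a..b}|lborel. f x) = integral {a..b} f"
    by (intro set_borel_integral_eq_integral borel_integrable_atLeastAtMost' assms)
  also have "\<dots> = F b - F a"
    using fundamental_theorem_of_calculus_interior[OF assms(1,2)] assms(4) by (intro integral_unique) auto
  finally show ?thesis by (simp add: set_lebesgue_integral_def)
qed

text \<open>
  The fibres of the region above a graph are half-lines, on which the functions vanish from some height \<open>T\<close> on.
\<close>

lemma FTC_lborel_half_line:
  fixes F f :: "real \<Rightarrow> 'b::euclidean_space"
  assumes "0 \<le> T" "continuous_on {0..T} F" "continuous_on {0..T} f"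
    and "\<And>x. 0 < x \<Longrightarrow> (F has_vector_derivative f x) (at x)"
    and "\<And>x. T < x \<Longrightarrow> f x = 0" "F T = 0"
  shows "(\<integral>x. indicator {0<..} x *\<^sub>R f x \<partial>lborel) = - F 0"
proof -
  have eq: "indicator {0..T} x *\<^sub>R f x = indicator {0<..} x *\<^sub>R f x" if "x \<noteq> 0" for x
    using that assms(1) assms(5)[of x] by (cases "T < x") (auto simp: indicator_def)
  have "(\<integral>x. indicator {0<..} x *\<^sub>R f x \<partial>lborel) = (\<integral>x. indicator {0..T} x *\<^sub>R f x \<partial>lborel)"
  proof (rule integral_cong_AE)
    have m: "(\<lambda>x. indicator {0..T} x *\<^sub>R f x) \<in> borel_measurable borel"
      using assms(3) by (rule borel_measurable_continuous_on_indicator[rotated]) simp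
    then show "(\<lambda>x. indicator {0..T} x *\<^sub>R f x) \<in> borel_measurable lborel" by simp
    have "(\<lambda>x. indicator {0<..} x *\<^sub>R f x) = (\<lambda>x. indicator {0<..} x *\<^sub>R indicator {0..T} x *\<^sub>R f x)"
    proof
      fix x show "indicator {0<..} x *\<^sub>R f x = indicator {0<..} x *\<^sub>R indicator {0..T} x *\<^sub>R f x"
        using assms(5)[of x] by (cases "T < x") (auto simp: indicator_def)
    qed
    also have "\<dots> \<in> borel_measurable lborel" using m by measurable
    finally show "(\<lambda>x. indicator {0<..} x *\<^sub>R f x) \<in> borel_measurable lborel" .
    show "AE x in lborel. indicator {0<..} x *\<^sub>R f x = indicator {0..T} x *\<^sub>R f x"
      using AE_lborel_singleton[of "0::real"] by eventually_elim (simp add: eq)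
  qed
  also have "\<dots> = F T - F 0" by (rule FTC_lborel) (use assms in auto)
  finally show ?thesis using assms(6) by simp
qed

text \<open>
  Points of \<open>W\<close> are written as \<open>P x t\<close>, at height \<open>t > 0\<close> above the graph.  For \<open>c = b\<close> the formula is the fundamental theorem of
  calculus on the half-lines \<open>P x\<close>.  For \<open>c \<noteq> b\<close> the derivative of \<open>x \<mapsto> G (P x t)\<close> along \<open>c\<close> is \<open>D c + h D b\<close> with
  \<open>h = s (grad \<gamma> \<bullet> c)\<close>; at fixed \<open>t\<close> this function has compact support in \<open>x\<close>, so its integral vanishes, and the
  integral of \<open>D c\<close> is minus that of \<open>h D b\<close>, which the first case evaluates.

  \<open>G\<close> and \<open>D\<close> are continuous on the whole space but related by differentiation only inside \<open>W\<close>, so that functions which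
  are merely \<open>C\<^sup>1\<close> up to the boundary can be extended continuously without extending their derivatives compatibly.
\<close>

lemma divergence_epigraph_extended:
  fixes G :: "octonion \<Rightarrow> 'b::euclidean_space" and D :: "octonion \<Rightarrow> octonion \<Rightarrow> 'b"
  assumes B: "orthonormal B" and b: "b \<in> B" and s: "s \<in> {1, -1::real}"
    and \<gamma>: "C1_field (B - {b}) \<gamma> grad"
  defines "W \<equiv> {x \<in> span B. \<gamma> (x - (x \<bullet> b) *\<^sub>R b) < s * (x \<bullet> b)}"
  assumes contG: "continuous_on UNIV G" and contD: "\<And>c. c \<in> B \<Longrightarrow> continuous_on UNIV (D c)"
    and der: "\<And>x c. x \<in> W \<Longrightarrow> c \<in> B \<Longrightarrow> ((\<lambda>t. G (x + t *\<^sub>R c)) has_vector_derivative D c x) (at 0)"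
    and suppG: "\<And>x. x \<in> span B \<Longrightarrow> \<gamma> (x - (x \<bullet> b) *\<^sub>R b) \<le> s * (x \<bullet> b) \<Longrightarrow> R \<le> norm x \<Longrightarrow> G x = 0"
    and suppD: "\<And>x c. c \<in> B \<Longrightarrow> x \<in> span B \<Longrightarrow> \<gamma> (x - (x \<bullet> b) *\<^sub>R b) \<le> s * (x \<bullet> b) \<Longrightarrow> R \<le> norm x \<Longrightarrow> D c x = 0"
    and c: "c \<in> B"
  shows "(\<integral>x. indicator W x *\<^sub>R D c x \<partial>vol B) =
         (\<integral>x. ((grad x - s *\<^sub>R b) \<bullet> c) *\<^sub>R G (x + (s * \<gamma> x) *\<^sub>R b) \<partial>vol (B - {b}))"
proof -
  define A where "A = B - {b}"
  have BA: "B = insert b A" and bA: "b \<notin> A" using b by (auto simp: A_def)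
  have oA: "orthonormal A" using B by (rule orthonormal_subset) (auto simp: A_def)
  have finB: "finite B" by (rule orthonormal_finite[OF B])
  note finA = orthonormal_finite[OF oA]
  have nb: "b \<bullet> b = 1" "norm b = 1" using orthonormal_inner[OF B b b] orthonormal_norm[OF B b] by auto
  have s2: "s * s = 1" "\<bar>s\<bar> = 1" using s by auto
  have spA: "span A \<subseteq> span B" unfolding A_def by (intro span_mono) auto
  have perp: "x \<bullet> b = 0" if "x \<in> span A" for x
    by (rule orthonormal_perp[OF B _ b bA that]) (auto simp: A_def)
  have bsp: "b \<in> span B" using b by (rule span_base)
  have c\<gamma>: "continuous_on UNIV \<gamma>" and cgr: "continuous_on UNIV grad" and gsp: "\<And>x. grad x \<in> span A"
    and dg: "\<And>x. x \<in> span A \<Longrightarrow> (\<gamma> has_derivative (\<lambda>v. grad x \<bullet> v)) (at x within span A)"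
    using \<gamma> by (auto simp: C1_field_def A_def)
  note c\<gamma>' = continuous_on_compose2[OF c\<gamma> _ subset_UNIV]
  note cgr' = continuous_on_compose2[OF cgr _ subset_UNIV]
  note cG' = continuous_on_compose2[OF contG _ subset_UNIV]
  note cD' = continuous_on_compose2[OF contD _ subset_UNIV]
  have [measurable]: "\<gamma> \<in> borel_measurable borel" "grad \<in> borel_measurable borel" "G \<in> borel_measurable borel"
    by (auto intro!: borel_measurable_continuous_onI c\<gamma> cgr contG)
  have [measurable]: "D c \<in> borel_measurable borel" "D b \<in> borel_measurable borel"
    using contD b c by (auto intro!: borel_measurable_continuous_onI)
  have [measurable]: "W \<in> sets borel" unfolding W_def by measurable
  define P where "P x t = x + (s * (\<gamma> x + t)) *\<^sub>R b" for x t
  have Pb: "P x t \<bullet> b = s * (\<gamma> x + t)" and Pm: "P x t - (P x t \<bullet> b) *\<^sub>R b = x" and Psp: "P x t \<in> span B"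
    if "x \<in> span A" for x t
    using perp[OF that] nb spA that bsp by (auto simp: P_def inner_add_left intro!: span_add span_scale)
  have PW: "P x t \<in> W \<longleftrightarrow> 0 < t" if "x \<in> span A" for x t
    using Pb[OF that] Pm[OF that] Psp[OF that] s2 by (auto simp: W_def simp flip: mult.assoc)
  have PWc: "\<gamma> (P x t - (P x t \<bullet> b) *\<^sub>R b) \<le> s * (P x t \<bullet> b)" if "x \<in> span A" "0 \<le> t" for x t
    unfolding Pm[OF that(1)] using Pb[OF that(1)] s2 that by (simp flip: mult.assoc)
  have normP: "norm x \<le> norm (P x t)" "\<bar>\<gamma> x + t\<bar> \<le> norm (P x t)" if "x \<in> span A" for x t
  proof -
    have "(norm (P x t))\<^sup>2 = (norm x)\<^sup>2 + (\<gamma> x + t)\<^sup>2"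
      unfolding P_def by (subst norm_add_Pythagorean) (use perp[OF that] nb s2 in \<open>auto simp: orthogonal_def abs_mult power_mult_distrib\<close>)
    then have "(norm x)\<^sup>2 \<le> (norm (P x t))\<^sup>2" "\<bar>\<gamma> x + t\<bar>\<^sup>2 \<le> (norm (P x t))\<^sup>2" by simp_all
    then show "norm x \<le> norm (P x t)" "\<bar>\<gamma> x + t\<bar> \<le> norm (P x t)"
      by (simp_all only: abs_le_square_iff[symmetric] abs_norm_cancel abs_abs)
  qed
  have opW: "openin (top_of_set (span B)) W"
  proof -
    have "open {x. \<gamma> (x - (x \<bullet> b) *\<^sub>R b) < s * (x \<bullet> b)}"
      by (rule open_Collect_less; (rule c\<gamma>')?; intro continuous_intros)
    moreover have "W = span B \<inter> {x. \<gamma> (x - (x \<bullet> b) *\<^sub>R b) < s * (x \<bullet> b)}" by (auto simp: W_def)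
    ultimately show ?thesis by (simp add: openin_open_Int)
  qed
  have chain: "((\<lambda>u. G (k u)) has_vector_derivative (\<Sum>a\<in>B. (v \<bullet> a) *\<^sub>R D a (k u))) (at u)"
    if "k u \<in> W" "\<And>u. k u \<in> span B" "(k has_vector_derivative v) (at u)" for k u v
  proof (rule has_vector_derivative_along_curve[where T = "span B", OF _ that(3,2)])
    show "(G has_derivative (\<lambda>v. \<Sum>a\<in>B. (v \<bullet> a) *\<^sub>R D a (k u))) (at (k u) within span B)"
      by (rule C1_partials_imp_has_derivative[OF B opW that(1)])
         (use der contD continuous_on_subset in blast)+
  qed
  \<comment> \<open>along \<open>b\<close> the fibre of \<open>W\<close> over \<open>x\<close> is a half-line that starts on the graph\<close>
  have inner_b: "(\<integral>t. indicator W (P x t) *\<^sub>R D b (P x t) \<partial>lborel) = - s *\<^sub>R G (P x 0)" if x: "x \<in> span A" for x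
  proof -
    define T where "T = \<bar>R\<bar> + \<bar>\<gamma> x\<bar>"
    have big: "R \<le> norm (P x t)" if "T \<le> t" for t
      using normP(2)[OF x, of t] that unfolding T_def by linarith
    have T0: "0 \<le> T" by (simp add: T_def)
    have cP: "continuous_on X (P x)" for X unfolding P_def by (intro continuous_intros)
    have "(\<integral>t. indicator {0<..} t *\<^sub>R (s *\<^sub>R D b (P x t)) \<partial>lborel) = - G (P x 0)"
    proof (rule FTC_lborel_half_line[OF T0])
      show "continuous_on {0..T} (\<lambda>t. G (P x t))" by (rule cG'[OF cP])
      show "continuous_on {0..T} (\<lambda>t. s *\<^sub>R D b (P x t))" by (intro continuous_intros cD'[OF b cP])
      fix t :: real assume t: "0 < t"
      have "((\<lambda>t. P x t) has_vector_derivative s *\<^sub>R b) (at t)"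
        unfolding P_def by (auto intro!: derivative_eq_intros)
      then have "((\<lambda>t. G (P x t)) has_vector_derivative (\<Sum>a\<in>B. ((s *\<^sub>R b) \<bullet> a) *\<^sub>R D a (P x t))) (at t)"
        by (intro chain) (use t PW[OF x] Psp[OF x] in auto)
      also have "(\<Sum>a\<in>B. ((s *\<^sub>R b) \<bullet> a) *\<^sub>R D a (P x t)) = (\<Sum>a\<in>B. if a = b then s *\<^sub>R D b (P x t) else 0)"
        using b by (intro sum.cong) (auto simp: orthonormal_inner[OF B])
      also have "\<dots> = s *\<^sub>R D b (P x t)" using b finB by simp
      finally show "((\<lambda>t. G (P x t)) has_vector_derivative s *\<^sub>R D b (P x t)) (at t)" .
    next
      fix t :: real assume "T < t"
      then show "s *\<^sub>R D b (P x t) = 0" using suppD[OF b Psp[OF x] PWc[OF x] big] T0 by simp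
    next
      show "G (P x T) = 0" using suppG[OF Psp[OF x] PWc[OF x] big] T0 by simp
    qed
    moreover have "(\<integral>t. indicator {0<..} t *\<^sub>R (s *\<^sub>R D b (P x t)) \<partial>lborel) = s *\<^sub>R (\<integral>t. indicator W (P x t) *\<^sub>R D b (P x t) \<partial>lborel)"
      unfolding integral_scaleR_right[symmetric] using PW[OF x]
      by (intro Bochner_Integration.integral_cong) (auto simp: indicator_def)
    ultimately have "- G (P x 0) = s *\<^sub>R (\<integral>t. indicator W (P x t) *\<^sub>R D b (P x t) \<partial>lborel)" by (rule trans[OF sym])
    then have "s *\<^sub>R (- G (P x 0)) = s *\<^sub>R s *\<^sub>R (\<integral>t. indicator W (P x t) *\<^sub>R D b (P x t) \<partial>lborel)" by (rule arg_cong)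
    then show ?thesis using s2 by simp
  qed
  have bddD: "\<exists>C. \<forall>x\<in>W. norm (D a x) \<le> C" if a: "a \<in> B" for a
  proof -
    have "compact (D a ` cball 0 R)" by (intro compact_continuous_image continuous_on_subset[OF contD[OF a]]) auto
    then obtain C where "\<And>y. y \<in> cball 0 R \<Longrightarrow> norm (D a y) \<le> C" by (meson bounded_iff compact_imp_bounded imageI)
    moreover have "D a x = 0" if "x \<in> W" "x \<notin> cball 0 R" for x
      using suppD[OF a, of x] that by (auto simp: W_def)
    ultimately have "norm (D a x) \<le> max C 0" if "x \<in> W" for x using that by (cases "x \<in> cball 0 R") (auto intro: max.coboundedI1)
    then show ?thesis by blast
  qed
  have intD: "integrable (vol B) (\<lambda>x. indicator W x *\<^sub>R D a x)"
    if a: "a \<in> B" for a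
  proof -
    obtain C where C: "\<And>x. x \<in> W \<Longrightarrow> norm (D a x) \<le> C" using bddD[OF a] by blast
    have "D a \<in> borel_measurable borel" using contD[OF a] by (rule borel_measurable_continuous_onI)
    then show ?thesis
      by (intro integrable_vol_bounded_support[OF B, where R = R and C = "\<bar>C\<bar>"])
         (use C suppD[OF a] in \<open>force simp: indicator_def W_def\<close>)+
  qed
  \<comment> \<open>a weight \<open>h\<close> that is constant on the fibres can be integrated after them\<close>
  have weighted: "(\<integral>x. h (oproj A x) *\<^sub>R (indicator W x *\<^sub>R D b x) \<partial>vol B) = (\<integral>x. h x *\<^sub>R (- s *\<^sub>R G (P x 0)) \<partial>vol A)"
    and weighted_int: "integrable (vol B) (\<lambda>x. h (oproj A x) *\<^sub>R (indicator W x *\<^sub>R D b x))"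
    if h: "continuous_on UNIV h" for h :: "octonion \<Rightarrow> real"
  proof -
    have [measurable]: "h \<in> borel_measurable borel" using h by (rule borel_measurable_continuous_onI)
    obtain C where C: "\<And>x. x \<in> W \<Longrightarrow> norm (D b x) \<le> C" using bddD[OF b] by blast
    have "compact (h ` cball 0 R)" by (intro compact_continuous_image continuous_on_subset[OF h]) auto
    then obtain K where K: "\<And>y. y \<in> cball 0 R \<Longrightarrow> norm (h y) \<le> K" by (meson bounded_iff compact_imp_bounded imageI)
    show int: "integrable (vol B) (\<lambda>x. h (oproj A x) *\<^sub>R (indicator W x *\<^sub>R D b x))"
    proof (rule integrable_vol_bounded_support[OF B, where R = R and C = "\<bar>K\<bar> * \<bar>C\<bar>"])
      fix x assume x: "x \<in> span B" "norm x \<le> R"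
      have "norm (oproj A x) \<le> R" using norm_oproj_le[OF oA, of x] x by simp
      then have "norm (h (oproj A x)) \<le> \<bar>K\<bar>" using K[of "oproj A x"] by auto
      moreover have "norm (indicator W x *\<^sub>R D b x) \<le> \<bar>C\<bar>" using C[of x] by (auto simp: indicator_def)
      ultimately show "norm (h (oproj A x) *\<^sub>R (indicator W x *\<^sub>R D b x)) \<le> \<bar>K\<bar> * \<bar>C\<bar>"
        unfolding norm_scaleR[of "h _"] by (intro mult_mono) auto
    qed (use suppD[OF b] in \<open>auto simp: indicator_def W_def\<close>)
    have "(\<integral>x. h (oproj A x) *\<^sub>R (indicator W x *\<^sub>R D b x) \<partial>vol B) =
      (\<integral>x. (\<integral>t. h (oproj A (P x t)) *\<^sub>R (indicator W (P x t) *\<^sub>R D b (P x t)) \<partial>lborel) \<partial>vol A)"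
      unfolding P_def using vol_integral_shear(1)[OF B[unfolded BA] bA s _ int[unfolded BA]]
      by (simp add: BA)
    also have "\<dots> = (\<integral>x. h x *\<^sub>R (- s *\<^sub>R G (P x 0)) \<partial>vol A)"
    proof (rule integral_cong_AE)
      show "AE x in vol A. (\<integral>t. h (oproj A (P x t)) *\<^sub>R (indicator W (P x t) *\<^sub>R D b (P x t)) \<partial>lborel) = h x *\<^sub>R (- s *\<^sub>R G (P x 0))"
        using AE_vol_span[OF finA]
      proof eventually_elim
        fix x assume x: "x \<in> span A"
        have "oproj A (P x t) = x" for t
          using oproj_remove[OF finB b, of "P x t"] oproj_span[OF B Psp[OF x]] Pm[OF x] by (simp add: A_def)
        then show "(\<integral>t. h (oproj A (P x t)) *\<^sub>R (indicator W (P x t) *\<^sub>R D b (P x t)) \<partial>lborel) = h x *\<^sub>R (- s *\<^sub>R G (P x 0))"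
          using inner_b[OF x] by (simp del: scaleR_scaleR)
      qed
    qed (unfold P_def, measurable)
    finally show "(\<integral>x. h (oproj A x) *\<^sub>R (indicator W x *\<^sub>R D b x) \<partial>vol B) = (\<integral>x. h x *\<^sub>R (- s *\<^sub>R G (P x 0)) \<partial>vol A)" .
  qed
  show ?thesis
  proof (cases "c = b")
    case True
    have "(\<integral>x. indicator W x *\<^sub>R D b x \<partial>vol B) = (\<integral>x. - s *\<^sub>R G (P x 0) \<partial>vol A)"
      using weighted[of "\<lambda>_. 1"] by simp
    also have "\<dots> = (\<integral>x. ((grad x - s *\<^sub>R b) \<bullet> b) *\<^sub>R G (x + (s * \<gamma> x) *\<^sub>R b) \<partial>vol A)"
      using perp[OF gsp] nb by (intro Bochner_Integration.integral_cong) (auto simp: P_def inner_diff_left)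
    finally show ?thesis using True by (simp add: A_def)
  next
    case False
    then have cA: "c \<in> A" using c by (simp add: A_def)
    have ncb: "b \<bullet> c = 0" "c \<bullet> c = 1" using orthonormal_inner[OF B] b c False by auto
    define A' where "A' = A - {c}"
    have AA: "A = insert c A'" and cA': "c \<notin> A'" using cA by (auto simp: A'_def)
    have oA': "orthonormal A'" using oA by (rule orthonormal_subset) (auto simp: A'_def)
    have spA': "span A' \<subseteq> span A" unfolding A'_def by (intro span_mono) auto
    define h where "h x = s * (grad x \<bullet> c)" for x
    have ch: "continuous_on UNIV h" unfolding h_def by (intro continuous_intros cgr)
    have [measurable]: "h \<in> borel_measurable borel" using ch by (rule borel_measurable_continuous_onI)
    define K where "K t x = D c (P x t) + h x *\<^sub>R D b (P x t)" for t x
    \<comment> \<open>\<open>K t\<close> is the derivative along \<open>c\<close> of \<open>\<lambda>x. G (P x t)\<close>, which has compact support\<close>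
    have K0: "(\<integral>x. K t x \<partial>vol A) = 0" if t: "0 < t" for t
    proof -
      have cP: "continuous_on UNIV (\<lambda>x. P x t)" unfolding P_def by (intro continuous_intros c\<gamma>)
      have cK: "continuous_on UNIV (K t)" unfolding K_def
        by (intro continuous_intros cD'[OF c cP] cD'[OF b cP] ch)
      have Kz: "K t x = 0" if "x \<in> span A" "R \<le> norm x" for x
        using suppD[OF c Psp[OF that(1)] PWc[OF that(1)], of t] suppD[OF b Psp[OF that(1)] PWc[OF that(1)], of t]
          normP(1)[OF that(1), of t] that t by (simp add: K_def)
      have "compact (K t ` cball 0 R)" by (intro compact_continuous_image continuous_on_subset[OF cK]) auto
      then obtain C where C: "\<And>y. y \<in> cball 0 R \<Longrightarrow> norm (K t y) \<le> C" by (meson bounded_iff compact_imp_bounded imageI)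
      have iK: "integrable (vol A) (K t)"
        by (rule integrable_vol_bounded_support[OF oA, where R = R and C = C])
           (use C Kz in \<open>auto intro!: borel_measurable_continuous_onI cK\<close>)
      have "(\<integral>x. K t x \<partial>vol A) = (\<integral>x. (\<integral>\<tau>. K t (x + \<tau> *\<^sub>R c) \<partial>lborel) \<partial>vol A')"
        using vol_integral_shear(1)[OF oA[unfolded AA] cA', of 1 "\<lambda>_. 0" "K t"] iK by (simp add: AA)
      also have "\<dots> = (\<integral>x. 0 \<partial>vol A')"
      proof (rule integral_cong_AE)
        show "AE x in vol A'. (\<integral>\<tau>. K t (x + \<tau> *\<^sub>R c) \<partial>lborel) = 0"
          using AE_vol_span[OF orthonormal_finite[OF oA']]
        proof eventually_elim
          fix x assume "x \<in> span A'"
          have xc: "x \<bullet> c = 0" by (rule orthonormal_perp[OF oA _ cA cA' \<open>x \<in> span A'\<close>]) (auto simp: A'_def)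
          have xA: "x + \<tau> *\<^sub>R c \<in> span A" for \<tau>
            using \<open>x \<in> span A'\<close> spA' cA by (intro span_add span_scale) (auto intro: span_base)
          have nx: "\<bar>\<tau>\<bar> \<le> norm (x + \<tau> *\<^sub>R c)" for \<tau>
            using Cauchy_Schwarz_ineq2[of "x + \<tau> *\<^sub>R c" c] xc ncb by (simp add: inner_add_left norm_eq_1[symmetric])
          define T where "T = \<bar>R\<bar>"
          have "(\<integral>\<tau>. indicator {-T..T} \<tau> *\<^sub>R K t (x + \<tau> *\<^sub>R c) \<partial>lborel) = G (P (x + T *\<^sub>R c) t) - G (P (x + (-T) *\<^sub>R c) t)"
          proof (rule FTC_lborel)
            show "continuous_on {-T..T} (\<lambda>\<tau>. G (P (x + \<tau> *\<^sub>R c) t))"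
              by (intro cG' continuous_on_compose2[OF cP _ subset_UNIV] continuous_intros)
            show "continuous_on {-T..T} (\<lambda>\<tau>. K t (x + \<tau> *\<^sub>R c))"
              by (intro continuous_on_compose2[OF cK _ subset_UNIV] continuous_intros)
            fix \<tau> :: real
            have "((\<lambda>u. \<gamma> (x + u *\<^sub>R c)) has_vector_derivative grad (x + \<tau> *\<^sub>R c) \<bullet> c) (at \<tau>)"
              by (rule has_vector_derivative_along_curve[OF dg[OF xA] _ xA]) (auto intro!: derivative_eq_intros)
            then have "((\<lambda>u. P (x + u *\<^sub>R c) t) has_vector_derivative c + h (x + \<tau> *\<^sub>R c) *\<^sub>R b) (at \<tau>)"
              unfolding P_def h_def by (auto intro!: derivative_eq_intros simp: algebra_simps has_real_derivative_iff_has_vector_derivative)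
            then have "((\<lambda>u. G (P (x + u *\<^sub>R c) t)) has_vector_derivative
                (\<Sum>a\<in>B. ((c + h (x + \<tau> *\<^sub>R c) *\<^sub>R b) \<bullet> a) *\<^sub>R D a (P (x + \<tau> *\<^sub>R c) t))) (at \<tau>)"
              by (intro chain) (use t PW[OF xA] Psp[OF xA] in auto)
            also have "(\<Sum>a\<in>B. ((c + h (x + \<tau> *\<^sub>R c) *\<^sub>R b) \<bullet> a) *\<^sub>R D a (P (x + \<tau> *\<^sub>R c) t)) =
               (\<Sum>a\<in>B. (if a = c then D c (P (x + \<tau> *\<^sub>R c) t) else 0) +
                   (if a = b then h (x + \<tau> *\<^sub>R c) *\<^sub>R D b (P (x + \<tau> *\<^sub>R c) t) else 0))"
              using b c False by (intro sum.cong) (auto simp: orthonormal_inner[OF B] inner_add_left)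
            also have "\<dots> = K t (x + \<tau> *\<^sub>R c)" using b c finB by (simp add: sum.distrib K_def)
            finally show "((\<lambda>u. G (P (x + u *\<^sub>R c) t)) has_vector_derivative K t (x + \<tau> *\<^sub>R c)) (at \<tau>)" .
          qed (simp add: T_def)
          moreover have Gz: "G (P (x + \<tau> *\<^sub>R c) t) = 0" if "R \<le> \<bar>\<tau>\<bar>" for \<tau>
            using suppG[OF Psp[OF xA] PWc[OF xA], of t \<tau>] normP(1)[OF xA, of \<tau> t] nx[of \<tau>] t that by simp
          moreover have "(\<integral>\<tau>. indicator {-T..T} \<tau> *\<^sub>R K t (x + \<tau> *\<^sub>R c) \<partial>lborel) = (\<integral>\<tau>. K t (x + \<tau> *\<^sub>R c) \<partial>lborel)"
          proof (rule Bochner_Integration.integral_cong[OF refl])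
            fix \<tau> :: real
            have "K t (x + \<tau> *\<^sub>R c) = 0" if "\<tau> \<notin> {-T..T}"
              using Kz[OF xA, of \<tau>] nx[of \<tau>] that by (auto simp: T_def)
            then show "indicator {-T..T} \<tau> *\<^sub>R K t (x + \<tau> *\<^sub>R c) = K t (x + \<tau> *\<^sub>R c)" by (auto simp: indicator_def)
          qed
          ultimately show "(\<integral>\<tau>. K t (x + \<tau> *\<^sub>R c) \<partial>lborel) = 0"
            using Gz[of T] Gz[of "- T"] by (simp add: T_def)
        qed
        have "K t \<in> borel_measurable borel" by (intro borel_measurable_continuous_onI cK)
        then show "(\<lambda>x. \<integral>\<tau>. K t (x + \<tau> *\<^sub>R c) \<partial>lborel) \<in> borel_measurable (vol A')" by measurable
      qed simp
      finally show ?thesis by simp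
    qed
    define \<Psi> where "\<Psi> x = indicator W x *\<^sub>R D c x + h (oproj A x) *\<^sub>R (indicator W x *\<^sub>R D b x)" for x
    have i\<Psi>: "integrable (vol B) \<Psi>" unfolding \<Psi>_def
      by (intro Bochner_Integration.integrable_add intD[OF c] weighted_int ch)
    have [measurable]: "\<Psi> \<in> borel_measurable borel" unfolding \<Psi>_def by measurable
    have "(\<integral>x. \<Psi> x \<partial>vol B) = (\<integral>t. (\<integral>x. \<Psi> (P x t) \<partial>vol A) \<partial>lborel)"
      unfolding P_def using vol_integral_shear(2)[OF B[unfolded BA] bA s _ i\<Psi>[unfolded BA]] by (simp add: BA)
    also have "\<dots> = (\<integral>t. 0 \<partial>(lborel :: real measure))"
    proof (rule Bochner_Integration.integral_cong[OF refl])
      fix t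
      have "(\<integral>x. \<Psi> (P x t) \<partial>vol A) = (\<integral>x. indicator {0<..} t *\<^sub>R K t x \<partial>vol A)"
      proof (rule integral_cong_AE)
        show "AE x in vol A. \<Psi> (P x t) = indicator {0<..} t *\<^sub>R K t x"
          using AE_vol_span[OF finA]
        proof eventually_elim
          fix x assume x: "x \<in> span A"
          have "oproj A (P x t) = x"
            using oproj_remove[OF finB b, of "P x t"] oproj_span[OF B Psp[OF x]] Pm[OF x] by (simp add: A_def)
          then show "\<Psi> (P x t) = indicator {0<..} t *\<^sub>R K t x"
            using PW[OF x] by (auto simp: \<Psi>_def K_def indicator_def)
        qed
      qed (unfold K_def P_def, measurable)
      also have "\<dots> = 0" using K0[of t] by (cases "0 < t") (auto simp: indicator_def)
      finally show "(\<integral>x. \<Psi> (P x t) \<partial>vol A) = 0" .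
    qed
    finally have "(\<integral>x. indicator W x *\<^sub>R D c x \<partial>vol B) + (\<integral>x. h (oproj A x) *\<^sub>R (indicator W x *\<^sub>R D b x) \<partial>vol B) = 0"
      unfolding \<Psi>_def using intD[OF c] weighted_int[OF ch] by simp
    then have "(\<integral>x. indicator W x *\<^sub>R D c x \<partial>vol B) = - (\<integral>x. h x *\<^sub>R (- s *\<^sub>R G (P x 0)) \<partial>vol A)"
      unfolding weighted[OF ch] by (simp add: add_eq_0_iff2)
    also have "\<dots> = (\<integral>x. - (h x *\<^sub>R (- s *\<^sub>R G (P x 0))) \<partial>vol A)" by simp
    also have "\<dots> = (\<integral>x. ((grad x - s *\<^sub>R b) \<bullet> c) *\<^sub>R G (x + (s * \<gamma> x) *\<^sub>R b) \<partial>vol A)"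
      using ncb s2 by (intro Bochner_Integration.integral_cong) (auto simp: P_def h_def inner_diff_left mult.commute mult.left_commute)
    finally show ?thesis by (simp add: A_def)
  qed
qed

section \<open>Determinants\<close>

text \<open>
  The parameter dimension \<open>p + 1\<close> is a variable, whereas the size of a matrix is a type.  A matrix of size \<open>p + 1\<close> is
  therefore completed by an identity block to size 8: a permutation that moves an index of that block picks up a
  zero entry, so only the permutations of \<open>{..p}\<close> contribute to the determinant.
\<close>

lemma det_eq_leibniz_block:
  fixes M :: "real^8^8"
  assumes p: "p \<le> 7"
    and block: "\<And>i j. i \<le> p \<Longrightarrow> j \<le> p \<Longrightarrow> M $ of_nat i $ of_nat j = c i j"
    and rest: "\<And>i j. i \<notin> of_nat ` {..p} \<Longrightarrow> M $ i $ j = (if i = j then 1 else 0)"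
  shows "det M = (\<Sum>\<pi> | \<pi> permutes {..p}. of_int (sign \<pi>) * (\<Prod>i\<le>p. c i (\<pi> i)))"
proof -
  let ?f = "of_nat :: nat \<Rightarrow> 8"
  let ?I = "?f ` {..p}"
  have inj: "inj_on ?f {..p}" by (rule inj_on_subset[OF inj_of_nat8]) (use p in auto)
  have bij: "bij_betw ?f {..p} ?I" using inj by (simp add: bij_betw_def)
  have bm: "bij_betw (map_permutation {..p} ?f) {\<pi>. \<pi> permutes {..p}} {\<pi>. \<pi> permutes ?I}"
  proof -
    have "map_permutation {..p} ?f = (\<lambda>\<pi> x. if x \<in> ?I then ?f (\<pi> (inv_into {..p} ?f x)) else x)"
      by (auto simp: map_permutation_def restrict_id_def fun_eq_iff)
    then show ?thesis using bij_betw_permutations[OF bij] by simp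
  qed
  have "det M = (\<Sum>\<pi> | \<pi> permutes UNIV. of_int (sign \<pi>) * (\<Prod>i\<in>UNIV. M $ i $ \<pi> i))"
    by (simp add: det_def)
  also have "\<dots> = (\<Sum>\<pi> | \<pi> permutes ?I. of_int (sign \<pi>) * (\<Prod>i\<in>UNIV. M $ i $ \<pi> i))"
  proof (rule sum.mono_neutral_right)
    show "{\<pi>. \<pi> permutes ?I} \<subseteq> {\<pi>. \<pi> permutes UNIV}" by (auto intro: permutes_subset)
    show "\<forall>\<pi>\<in>{\<pi>. \<pi> permutes UNIV} - {\<pi>. \<pi> permutes ?I}. of_int (sign \<pi>) * (\<Prod>i\<in>UNIV. M $ i $ \<pi> i) = 0"
    proof
      fix \<pi> assume \<pi>: "\<pi> \<in> {\<pi>. \<pi> permutes (UNIV :: 8 set)} - {\<pi>. \<pi> permutes ?I}"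
      then obtain i where "i \<notin> ?I" "\<pi> i \<noteq> i" using permutes_superset[of \<pi> UNIV ?I] by auto
      then have "M $ i $ \<pi> i = 0" by (simp add: rest)
      then have "(\<Prod>i\<in>UNIV. M $ i $ \<pi> i) = 0" by (meson UNIV_I finite prod_zero)
      then show "of_int (sign \<pi>) * (\<Prod>i\<in>UNIV. M $ i $ \<pi> i) = 0" by simp
    qed
  qed (simp add: finite_permutations)
  also have "\<dots> = (\<Sum>\<pi> | \<pi> permutes {..p}. of_int (sign (map_permutation {..p} ?f \<pi>)) *
      (\<Prod>i\<in>UNIV. M $ i $ (map_permutation {..p} ?f \<pi>) i))"
    by (rule sum.reindex_bij_betw[OF bm, symmetric])
  also have "\<dots> = (\<Sum>\<pi> | \<pi> permutes {..p}. of_int (sign \<pi>) * (\<Prod>i\<le>p. c i (\<pi> i)))"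
  proof (rule sum.cong[OF refl])
    fix \<pi> assume "\<pi> \<in> {\<pi>. \<pi> permutes {..p}}"
    then have \<pi>: "\<pi> permutes {..p}" by simp
    let ?\<sigma> = "map_permutation {..p} ?f \<pi>"
    have \<sigma>: "?\<sigma> permutes ?I" by (rule map_permutation_permutes[OF bij \<pi>])
    have "(\<Prod>i\<in>UNIV. M $ i $ ?\<sigma> i) = (\<Prod>i\<in>?I. M $ i $ ?\<sigma> i)"
      using permutes_not_in[OF \<sigma>] by (intro prod.mono_neutral_right) (auto simp: rest)
    also have "\<dots> = (\<Prod>i\<le>p. M $ ?f i $ ?\<sigma> (?f i))" by (simp add: prod.reindex[OF inj])
    also have "\<dots> = (\<Prod>i\<le>p. c i (\<pi> i))"
      using permutes_in_image[OF \<pi>] by (intro prod.cong) (auto simp: map_permutation_apply[OF inj] block)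
    finally show "of_int (sign ?\<sigma>) * (\<Prod>i\<in>UNIV. M $ i $ ?\<sigma> i) = of_int (sign \<pi>) * (\<Prod>i\<le>p. c i (\<pi> i))"
      using sign_map_permutation[OF inj \<pi>] by simp
  qed
  finally show ?thesis .
qed

text \<open>
  A rotation that takes \<open>g\<close> to a multiple of a coordinate axis makes the matrix diagonal.
\<close>

lemma det_rank_one_update:
  fixes g :: "real^'n"
  shows "det (matrix (\<lambda>x. x + (g \<bullet> x) *\<^sub>R g)) = 1 + (norm g)\<^sup>2"
proof (cases "g = 0")
  case True then show ?thesis by (simp add: matrix_id_mat_1[unfolded id_def])
next
  case False
  obtain k :: 'n where True by simp
  define e where "e = axis k (1::real)"
  obtain R where R: "orthogonal_transformation R" "R (sgn g) = e"
    using orthogonal_transformation_exists_1[of "sgn g" e] False by (auto simp: e_def norm_sgn)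
  have lR: "linear R" using R(1) by (simp add: orthogonal_transformation_linear)
  have Rg: "R g = norm g *\<^sub>R e"
    using linear_scale[OF lR, of "norm g" "sgn g"] R(2) False by (simp add: sgn_div_norm)
  have lin: "linear (\<lambda>x. x + (a \<bullet> x) *\<^sub>R a)" for a :: "real^'n"
    by (intro linearI) (simp_all add: inner_add_right algebra_simps)
  have "R \<circ> (\<lambda>x. x + (g \<bullet> x) *\<^sub>R g) = (\<lambda>x. x + (R g \<bullet> x) *\<^sub>R R g) \<circ> R"
    using R(1) by (auto simp: fun_eq_iff linear_add[OF lR] linear_scale[OF lR] orthogonal_transformation_def)
  then have "matrix R ** matrix (\<lambda>x. x + (g \<bullet> x) *\<^sub>R g) = matrix (\<lambda>x. x + (R g \<bullet> x) *\<^sub>R R g) ** matrix R"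
    by (simp add: matrix_compose[OF lin lR, symmetric] matrix_compose[OF lR lin, symmetric])
  then have "det (matrix R) * det (matrix (\<lambda>x. x + (g \<bullet> x) *\<^sub>R g)) = det (matrix (\<lambda>x. x + (R g \<bullet> x) *\<^sub>R R g)) * det (matrix R)"
    unfolding det_mul[symmetric] by (rule arg_cong)
  moreover have "det (matrix R) \<noteq> 0"
    using det_orthogonal_matrix[of "matrix R"] R(1) by (auto simp: orthogonal_transformation_matrix)
  ultimately have "det (matrix (\<lambda>x. x + (g \<bullet> x) *\<^sub>R g)) = det (matrix (\<lambda>x. x + (R g \<bullet> x) *\<^sub>R R g))" by simp
  also have "\<dots> = (\<Prod>i\<in>UNIV. if i = k then 1 + (norm g)\<^sup>2 else 1)"
  proof -
    have entry: "matrix (\<lambda>x. x + (R g \<bullet> x) *\<^sub>R R g) $ i $ j =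
      (if i = j then 1 else 0) + (if i = k \<and> j = k then (norm g)\<^sup>2 else 0)" for i j
      unfolding matrix_def Rg e_def by (simp add: inner_axis_axis) (simp add: axis_def power2_eq_square)
    have "det (matrix (\<lambda>x. x + (R g \<bullet> x) *\<^sub>R R g)) = (\<Prod>i\<in>UNIV. matrix (\<lambda>x. x + (R g \<bullet> x) *\<^sub>R R g) $ i $ i)"
      by (rule det_diagonal) (auto simp: entry)
    also have "\<dots> = (\<Prod>i\<in>UNIV. if i = k then 1 + (norm g)\<^sup>2 else 1)"
      by (rule prod.cong) (simp_all add: entry)
    finally show ?thesis .
  qed
  also have "\<dots> = 1 + (norm g)\<^sup>2" by simp
  finally show ?thesis .
qed

lemma orthonormal_Basis: "orthonormal Basis"
  by (auto simp: orthonormal_def inner_Basis)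

text \<open>
  The matrix with entries \<open>c i j\<close> is \<open>D\<^sup>T (I + g0 g0\<^sup>T) D\<close>, where \<open>D\<close> has the columns \<open>d i\<close>, and the determinant is
  multiplicative.  Vectors tangent to a graph with gradient \<open>g0\<close> that lie over \<open>d i\<close> and \<open>d j\<close> have the inner product
  \<open>c i j\<close>, so this is the Gram determinant of a parametrisation of the graph.  The map \<open>f\<close> extends \<open>D\<close> to dimension 8
  by the identity.
\<close>

lemma gram_graph:
  fixes d :: "nat \<Rightarrow> octonion" and g0 :: octonion
  assumes p: "p \<le> 7" and f: "linear f" "\<And>i. i \<le> p \<Longrightarrow> f (oe i) = d i" "\<And>i. p < i \<Longrightarrow> i \<le> 7 \<Longrightarrow> f (oe i) = oe i"
    and d: "\<And>i. i \<le> p \<Longrightarrow> d i \<in> span (pbasis p)" and g0: "g0 \<in> span (pbasis p)"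
    and c: "\<And>i j. i \<le> p \<Longrightarrow> j \<le> p \<Longrightarrow> c i j = d i \<bullet> d j + (g0 \<bullet> d i) * (g0 \<bullet> d j)"
  shows "(\<Sum>\<pi> | \<pi> permutes {..p}. of_int (sign \<pi>) * (\<Prod>i\<le>p. c i (\<pi> i))) = (det (matrix f))\<^sup>2 * (1 + (norm g0)\<^sup>2)"
proof -
  let ?T = "\<lambda>x. x + (g0 \<bullet> x) *\<^sub>R g0"
  have lT: "linear ?T" by (intro linearI) (simp_all add: inner_add_right algebra_simps)
  have oB: "orthonormal (oe ` {..7})" using orthonormal_Basis by (simp add: Basis_oct)
  have perp: "x \<bullet> oe i = 0" if "x \<in> span (pbasis p)" "p < i" "i \<le> 7" for x i
  proof (rule orthonormal_perp[OF oB _ _ _ that(1)])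
    show "oe i \<notin> pbasis p"
      using inj_on_image_mem_iff[OF inj_oe, of i "{..p}"] that p by (auto simp: pbasis_def)
  qed (use that p in \<open>auto simp: pbasis_def\<close>)
  let ?M = "transpose (matrix f) ** (matrix ?T ** matrix f)"
  have M: "?M $ i $ j = f (axis i 1) \<bullet> ?T (f (axis j 1))" for i j
  proof -
    have "?M = transpose (matrix f) ** matrix (?T \<circ> f)" using matrix_compose[OF f(1) lT] by simp
    then show ?thesis
      by (simp add: matrix_matrix_mult_def transpose_def matrix_def inner_vec_def o_def)
  qed
  have ax: "\<exists>k\<le>7. i = of_nat k" for i :: 8 using range_of_nat8 by (metis UNIV_I atMost_iff imageE)
  have "det ?M = (\<Sum>\<pi> | \<pi> permutes {..p}. of_int (sign \<pi>) * (\<Prod>i\<le>p. c i (\<pi> i)))"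
  proof (rule det_eq_leibniz_block[OF p])
    fix i j assume "i \<le> p" "j \<le> p"
    then show "?M $ of_nat i $ of_nat j = c i j"
      unfolding M oe_def[symmetric] by (simp add: f c inner_add_right inner_commute)
  next
    fix i j :: 8 assume i: "i \<notin> of_nat ` {..p}"
    obtain k where k: "k \<le> 7" "i = of_nat k" using ax by blast
    obtain l where l: "l \<le> 7" "j = of_nat l" using ax by blast
    have kp: "p < k" using i k by (meson atMost_iff image_eqI not_le_imp_less)
    have gk: "g0 \<bullet> oe k = 0" by (rule perp[OF g0 kp k(1)])
    have eq: "i = j \<longleftrightarrow> k = l" using inj_of_nat8 k l by (auto simp: inj_on_def)
    show "?M $ i $ j = (if i = j then 1 else 0)"
    proof (cases "l \<le> p")
      case True
      then show ?thesis unfolding M eq using kp k l gk perp[OF d[OF True] kp k(1)]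
        by (simp add: f inner_add_right inner_commute flip: oe_def)
    next
      case False
      then show ?thesis unfolding M eq using kp k l gk
        by (simp add: f inner_add_right inner_commute oe_inner flip: oe_def)
    qed
  qed
  then show ?thesis
    by (simp add: det_mul det_transpose det_rank_one_update power2_eq_square mult_ac)
qed

section \<open>Change of variables in a coordinate subspace\<close>

lemma closed_cube: "closed {y::octonion. \<forall>c\<in>C. 0 \<le> y \<bullet> c \<and> y \<bullet> c \<le> 1}"
proof -
  have "{y::octonion. \<forall>c\<in>C. 0 \<le> y \<bullet> c \<and> y \<bullet> c \<le> 1} = (\<Inter>c\<in>C. {y. 0 \<le> y \<bullet> c} \<inter> {y. y \<bullet> c \<le> 1})" by auto
  also have "closed \<dots>" by (intro closed_INT ballI closed_Int closed_Collect_le continuous_intros)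
  finally show ?thesis .
qed

text \<open>
  Thickening a subspace by the unit cube of the complementary coordinates turns its measure into that of \<open>real^8\<close>,
  to which the classical change of variables theorem applies.
\<close>

lemma thick_vol:
  assumes P0: "P0 \<subseteq> Basis" and [measurable]: "F \<in> borel_measurable borel"
  defines "Q \<equiv> {y::octonion. \<forall>c\<in>Basis - P0. 0 \<le> y \<bullet> c \<and> y \<bullet> c \<le> 1}"
  shows "(\<integral>\<^sup>+x. F (oproj P0 x) * indicator Q x \<partial>lborel) = (\<integral>\<^sup>+x. F x \<partial>vol P0)"
proof -
  let ?C = "Basis - P0"
  have ob: "orthonormal Basis" by (rule orthonormal_Basis)
  have oP: "orthonormal P0" by (rule orthonormal_subset[OF ob P0])
  have finC: "finite ?C" by simp
  have Q[measurable]: "Q \<in> sets borel"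
    unfolding Q_def by (rule borel_closed[OF closed_cube])
  have "(\<integral>\<^sup>+x. F (oproj P0 x) * indicator Q x \<partial>lborel) = (\<integral>\<^sup>+x. F (oproj P0 x) * indicator Q x \<partial>vol (P0 \<union> ?C))"
    using P0 by (simp add: Un_absorb1 vol_Basis)
  also have "\<dots> = (\<integral>\<^sup>+x. (\<integral>\<^sup>+y. F (oproj P0 (x + y)) * indicator Q (x + y) \<partial>vol ?C) \<partial>vol P0)"
    using orthonormal_finite[OF oP] by (intro vol_nn_integral_union) auto
  also have "\<dots> = (\<integral>\<^sup>+x. F x * emeasure (vol ?C) Q \<partial>vol P0)"
  proof (rule nn_integral_cong_AE)
    show "AE x in vol P0. (\<integral>\<^sup>+y. F (oproj P0 (x + y)) * indicator Q (x + y) \<partial>vol ?C) = F x * emeasure (vol ?C) Q"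
      using AE_vol_span[OF orthonormal_finite[OF oP]]
    proof eventually_elim
      fix x assume x: "x \<in> span P0"
      have "(\<integral>\<^sup>+y. F (oproj P0 (x + y)) * indicator Q (x + y) \<partial>vol ?C) = (\<integral>\<^sup>+y. F x * indicator Q y \<partial>vol ?C)"
      proof (rule nn_integral_cong_AE)
        show "AE y in vol ?C. F (oproj P0 (x + y)) * indicator Q (x + y) = F x * indicator Q y"
          using AE_vol_span[OF finC]
        proof eventually_elim
          fix y assume y: "y \<in> span ?C"
          have "y \<bullet> b = 0" if "b \<in> P0" for b
            by (rule orthonormal_perp[OF ob _ _ _ y]) (use P0 that in auto)
          then have "oproj P0 y = 0" by (simp add: oproj_def)
          moreover have "x \<bullet> c = 0" if "c \<in> ?C" for c
            by (rule orthonormal_perp[OF ob P0 _ _ x]) (use that in auto)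
          ultimately show "F (oproj P0 (x + y)) * indicator Q (x + y) = F x * indicator Q y"
            using oproj_span[OF oP x] by (auto simp: linear_add[OF linear_oproj] Q_def inner_add_left indicator_def)
        qed
      qed
      then show "(\<integral>\<^sup>+y. F (oproj P0 (x + y)) * indicator Q (x + y) \<partial>vol ?C) = F x * emeasure (vol ?C) Q"
        by (simp add: nn_integral_cmult)
    qed
  qed
  also have "emeasure (vol ?C) Q = 1"
  proof -
    let ?P = "\<Pi>\<^sub>M b\<in>?C. (lborel :: real measure)"
    have oC: "orthonormal ?C" by (rule orthonormal_subset[OF ob]) auto
    have "emeasure (vol ?C) Q = emeasure ?P ((\<lambda>c. \<Sum>b\<in>?C. c b *\<^sub>R b) -` Q \<inter> space ?P)"
      unfolding vol_def by (intro emeasure_distr) auto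
    also have "(\<lambda>c. \<Sum>b\<in>?C. c b *\<^sub>R b) -` Q \<inter> space ?P = Pi\<^sub>E ?C (\<lambda>_. {0..1})"
      using orthonormal_sum_inner[OF oC] by (auto simp: Q_def space_PiM PiE_iff)
    also have "emeasure ?P \<dots> = (\<Prod>b\<in>?C. emeasure lborel {0..1::real})"
      by (intro PL.emeasure_PiM) auto
    finally show ?thesis by simp
  qed
  finally show ?thesis by simp
qed

text \<open>
  The map \<open>h\<close> is extended to the thickened set by the identity in the complementary coordinates; the extension has
  the same Jacobian, and the change of variables formula for \<open>real^8\<close> applies to it.
\<close>

lemma change_of_variables_subspace:
  fixes h :: "octonion \<Rightarrow> octonion" and h' :: "octonion \<Rightarrow> octonion \<Rightarrow> octonion"
  assumes P0: "P0 \<subseteq> Basis" and A[measurable]: "A \<in> sets borel" and AP: "A \<subseteq> span P0" and hA: "h ` A \<subseteq> span P0"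
    and inj: "inj_on h A"
    and der: "\<And>u. u \<in> A \<Longrightarrow> (h has_derivative h' u) (at u within span P0)"
    and im: "\<And>A'. A' \<in> sets borel \<Longrightarrow> A' \<subseteq> A \<Longrightarrow> h ` A' \<in> sets borel"
    and J: "continuous_on A J" "\<And>u. u \<in> A \<Longrightarrow> J u = \<bar>det (matrix (\<lambda>v. h' u (oproj P0 v) + oproj (Basis - P0) v))\<bar>"
    and F[measurable]: "F \<in> borel_measurable borel"
  shows "(\<integral>\<^sup>+v. F v * indicator (h ` A) v \<partial>vol P0) = (\<integral>\<^sup>+u. F (h u) * ennreal (J u) * indicator A u \<partial>vol P0)"
proof -
  let ?C = "Basis - P0"
  have ob: "orthonormal Basis" by (rule orthonormal_Basis)
  have oP: "orthonormal P0" and oC: "orthonormal ?C"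
    by (rule orthonormal_subset[OF ob P0], rule orthonormal_subset[OF ob]) auto
  have finP: "finite P0" by (rule orthonormal_finite[OF oP])
  define Q where "Q = {y::octonion. \<forall>c\<in>?C. 0 \<le> y \<bullet> c \<and> y \<bullet> c \<le> 1}"
  note thick = thick_vol[OF P0, folded Q_def]
  have Q[measurable]: "Q \<in> sets borel"
    unfolding Q_def by (rule borel_closed[OF closed_cube])
  have split: "x = oproj P0 x + oproj ?C x" for x
  proof -
    have "(\<Sum>b\<in>Basis. (x \<bullet> b) *\<^sub>R b) = oproj P0 x + oproj ?C x"
      unfolding oproj_def using P0 by (subst sum.subset_diff[of P0]) (auto simp: add.commute)
    then show ?thesis by (simp add: euclidean_representation)
  qed
  have P0C: "oproj P0 y = 0" "y \<bullet> b = 0" if "y \<in> span ?C" "b \<in> P0" for y b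
  proof -
    have *: "y \<bullet> b = 0" if "b \<in> P0" for b
      by (rule orthonormal_perp[OF ob _ _ _ \<open>y \<in> span ?C\<close>]) (use P0 that in auto)
    then show "y \<bullet> b = 0" "oproj P0 y = 0" using that by (auto simp: oproj_def)
  qed
  have projs: "oproj P0 (x + oproj ?C y) = x" "oproj ?C (x + oproj ?C y) = oproj ?C y" if "x \<in> span P0" for x y
  proof -
    have "oproj P0 (oproj ?C y) = 0"
    proof (cases "P0 = {}")
      case False then show ?thesis using P0C(1)[OF oproj_in_span] by auto
    qed (simp add: oproj_def)
    then show 1: "oproj P0 (x + oproj ?C y) = x" using oproj_span[OF oP that] by (simp add: linear_add[OF linear_oproj])
    show "oproj ?C (x + oproj ?C y) = oproj ?C y" using split[of "x + oproj ?C y"] 1 by simp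
  qed
  define hh where "hh x = h (oproj P0 x) + oproj ?C x" for x
  define thk where "thk A' = {x. oproj P0 x \<in> A'} \<inter> Q" for A'
  have Qp: "x + oproj ?C y \<in> Q \<longleftrightarrow> y \<in> Q" if "x \<in> span P0" for x y
  proof -
    have "x \<bullet> c = 0" if "c \<in> ?C" for c
      by (rule orthonormal_perp[OF ob P0 _ _ \<open>x \<in> span P0\<close>]) (use that in auto)
    then show ?thesis by (simp add: Q_def inner_add_left oproj_inner[OF oC])
  qed
  \<comment> \<open>first for bounded sets on which the Jacobian is bounded by \<open>k\<close>, so that all integrals are finite\<close>
  have vol_im: "emeasure (vol P0) (h ` A') = (\<integral>\<^sup>+u. ennreal (J u) * indicator A' u \<partial>vol P0)"
    if [measurable]: "A' \<in> sets borel" and A': "A' \<subseteq> A" and bd: "bounded A'" "\<And>u. u \<in> A' \<Longrightarrow> J u \<le> k" for A' k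
  proof -
    have [measurable]: "h ` A' \<in> sets borel" by (rule im) (use A' in auto)
    have mJ[measurable]: "(\<lambda>u. J u * indicator A' u) \<in> borel_measurable borel"
      using borel_measurable_continuous_on_indicator[OF _ continuous_on_subset[OF J(1) A']] by (simp add: mult.commute)
    have img: "hh ` thk A' = thk (h ` A')"
    proof safe
      fix x assume "x \<in> thk A'"
      then have x: "oproj P0 x \<in> A'" "x \<in> Q" by (auto simp: thk_def)
      have "h (oproj P0 x) \<in> span P0" using x A' hA by auto
      then show "hh x \<in> thk (h ` A')" using x Qp[of "h (oproj P0 x)" x] projs(1)[of "h (oproj P0 x)" x]
        by (auto simp: thk_def hh_def)
    next
      fix x assume "x \<in> thk (h ` A')"
      then obtain u where u: "u \<in> A'" "oproj P0 x = h u" and xQ: "x \<in> Q" by (auto simp: thk_def)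
      have uP: "u \<in> span P0" using u A' AP by auto
      have "hh (u + oproj ?C x) = x" using split[of x] u projs[OF uP, of x] by (simp add: hh_def)
      moreover have "u + oproj ?C x \<in> thk A'" using Qp[OF uP] xQ projs[OF uP, of x] u by (auto simp: thk_def)
      ultimately show "x \<in> hh ` thk A'" by (metis imageI)
    qed
    have injh: "inj_on hh (thk A')"
    proof (rule inj_onI)
      fix x y assume xy: "x \<in> thk A'" "y \<in> thk A'" "hh x = hh y"
      then have px: "oproj P0 x \<in> A" "oproj P0 y \<in> A" using A' by (auto simp: thk_def)
      then have "h (oproj P0 x) \<in> span P0" "h (oproj P0 y) \<in> span P0" using hA by auto
      then have "h (oproj P0 x) = h (oproj P0 y)" "oproj ?C x = oproj ?C y"
        using projs xy(3) unfolding hh_def by metis+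
      moreover from this have "oproj P0 x = oproj P0 y" using inj px by (auto dest: inj_onD)
      ultimately have "oproj P0 x + oproj ?C x = oproj P0 y + oproj ?C y" by simp
      then show "x = y" unfolding split[symmetric] .
    qed
    have [measurable]: "thk A' \<in> sets borel" "thk (h ` A') \<in> sets borel" unfolding thk_def by measurable
    have dh: "(hh has_derivative (\<lambda>v. h' (oproj P0 x) (oproj P0 v) + oproj ?C v)) (at x within thk A')" if "x \<in> thk A'" for x
    proof -
      have "oproj P0 x \<in> A" using that A' by (auto simp: thk_def)
      have "((\<lambda>x. h (oproj P0 x)) has_derivative (\<lambda>v. h' (oproj P0 x) (oproj P0 v))) (at x within thk A')"
        by (rule has_derivative_in_compose[OF bounded_linear.has_derivative[OF bounded_linear_oproj has_derivative_ident]])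
           (rule has_derivative_subset[OF der[OF \<open>oproj P0 x \<in> A\<close>]], use oproj_in_span in auto)
      then show ?thesis unfolding hh_def
        by (intro has_derivative_add bounded_linear.has_derivative[OF bounded_linear_oproj has_derivative_ident])
    qed
    have thkbd: "thk A' \<subseteq> cball 0 r" "0 \<le> r" if r: "r = b1 + real (card ?C)" "0 \<le> b1" "\<And>u. u \<in> A' \<Longrightarrow> norm u \<le> b1" for r b1
    proof safe
      fix x assume x: "x \<in> thk A'"
      have "norm (oproj ?C x) \<le> (\<Sum>c\<in>?C. norm ((x \<bullet> c) *\<^sub>R c))" unfolding oproj_def by (rule norm_sum)
      also have "\<dots> \<le> (\<Sum>c\<in>?C. 1)" using x by (intro sum_mono) (auto simp: thk_def Q_def orthonormal_norm[OF oC])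
      finally have "norm (oproj ?C x) \<le> real (card ?C)" by simp
      moreover have "norm (oproj P0 x) \<le> b1" using x r by (auto simp: thk_def)
      moreover have "norm x \<le> norm (oproj P0 x) + norm (oproj ?C x)" using norm_triangle_ineq[of "oproj P0 x" "oproj ?C x"] unfolding split[symmetric] .
      ultimately show "x \<in> cball 0 r" using r by simp
    qed (use r in auto)
    obtain b0 where b0: "\<And>u. u \<in> A' \<Longrightarrow> norm u \<le> b0" using bd(1) by (auto simp: bounded_iff)
    define r where "r = max 0 b0 + real (card ?C)"
    have thkr: "thk A' \<subseteq> cball 0 r" unfolding r_def by (rule thkbd(1)[of _ "max 0 b0"]) (use b0 in \<open>auto intro: max.coboundedI2\<close>)
    define g where "g x = J (oproj P0 x) * indicator (thk A') x" for x
    have g_eq: "g x = (J (oproj P0 x) * indicator A' (oproj P0 x)) * indicator Q x" for x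
      by (auto simp: g_def thk_def indicator_def)
    have [measurable]: "g \<in> borel_measurable borel"
      unfolding g_eq[abs_def] using measurable_compose[OF measurable_oproj mJ] by measurable
    have Jpos: "0 \<le> J u" if "u \<in> A" for u using J(2)[OF that] by simp
    have g0: "0 \<le> g x" for x using Jpos A' by (auto simp: g_def thk_def indicator_def)
    have gint: "integrable lborel g"
    proof (rule integrableI_bounded_set[where A = "cball 0 r" and B = "\<bar>k\<bar>"])
      show "AE x in lborel. x \<in> cball 0 r \<longrightarrow> norm (g x) \<le> \<bar>k\<bar>"
      proof (intro AE_I2 impI)
        fix x
        show "norm (g x) \<le> \<bar>k\<bar>"
          using bd(2)[of "oproj P0 x"] Jpos[of "oproj P0 x"] A' by (auto simp: g_def thk_def indicator_def)
      qed
      show "AE x in lborel. x \<notin> cball 0 r \<longrightarrow> g x = 0" using thkr by (intro AE_I2) (auto simp: g_def indicator_def)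
      show "emeasure lborel (cball 0 r) < \<infinity>" by (rule emeasure_bounded_finite) simp
    qed auto
    have hi: "((\<lambda>x. \<bar>det (matrix (\<lambda>v. h' (oproj P0 x) (oproj P0 v) + oproj ?C v))\<bar>) has_integral (\<integral>x. g x \<partial>lborel)) (thk A')"
    proof -
      have "(g has_integral (\<integral>x. g x \<partial>lborel)) UNIV" by (rule has_integral_integral_lborel[OF gint])
      moreover have "g = (\<lambda>x. if x \<in> thk A' then J (oproj P0 x) else 0)" by (auto simp: g_def fun_eq_iff)
      ultimately have "((\<lambda>x. J (oproj P0 x)) has_integral (\<integral>x. g x \<partial>lborel)) (thk A')"
        by (simp add: has_integral_restrict_UNIV)
      then show ?thesis
        by (rule has_integral_eq[rotated]) (use J(2) A' in \<open>auto simp: thk_def\<close>)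
    qed
    have "hh ` thk A' \<in> lmeasurable \<and> measure lebesgue (hh ` thk A') = (\<integral>x. g x \<partial>lborel)"
      by (rule iffD2[OF has_measure_differentiable_image[OF _ dh injh] hi]) simp_all
    then have "emeasure lebesgue (thk (h ` A')) = ennreal (\<integral>x. g x \<partial>lborel)"
      unfolding img using emeasure_eq_measure2 by metis
    then have "emeasure lborel (thk (h ` A')) = ennreal (\<integral>x. g x \<partial>lborel)" by simp
    also have "\<dots> = (\<integral>\<^sup>+x. ennreal (g x) \<partial>lborel)" by (rule nn_integral_eq_integral[symmetric, OF gint]) (use g0 in auto)
    also have "\<dots> = (\<integral>\<^sup>+x. ennreal (J (oproj P0 x) * indicator A' (oproj P0 x)) * indicator Q x \<partial>lborel)"
      unfolding g_eq by (intro nn_integral_cong) (auto simp: indicator_def)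
    also have "\<dots> = (\<integral>\<^sup>+u. ennreal (J u * indicator A' u) \<partial>vol P0)"
      by (rule thick[of "\<lambda>u. ennreal (J u * indicator A' u)"]) measurable
    also have "\<dots> = (\<integral>\<^sup>+u. ennreal (J u) * indicator A' u \<partial>vol P0)"
      by (intro nn_integral_cong) (auto simp: indicator_def)
    finally have "emeasure lborel (thk (h ` A')) = (\<integral>\<^sup>+u. ennreal (J u) * indicator A' u \<partial>vol P0)" .
    moreover have "emeasure lborel (thk (h ` A')) = (\<integral>\<^sup>+x. indicator (h ` A') (oproj P0 x) * indicator Q x \<partial>lborel)"
    proof -
      have "emeasure lborel (thk (h ` A')) = (\<integral>\<^sup>+x. indicator (thk (h ` A')) x \<partial>lborel)" by simp
      also have "\<dots> = (\<integral>\<^sup>+x. indicator (h ` A') (oproj P0 x) * indicator Q x \<partial>lborel)"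
        by (intro nn_integral_cong) (auto simp: thk_def indicator_def)
      finally show ?thesis .
    qed
    moreover have "\<dots> = emeasure (vol P0) (h ` A')"
      by (subst thick[of "indicator (h ` A')"]) auto
    ultimately show ?thesis by simp
  qed
  have mJ[measurable]: "(\<lambda>u. J u * indicator A u) \<in> borel_measurable borel"
    using borel_measurable_continuous_on_indicator[OF A J(1)] by (simp add: mult.commute)
  \<comment> \<open>then in general, by exhaustion with such sets\<close>
  have vol_im': "emeasure (vol P0) (h ` A') = (\<integral>\<^sup>+u. ennreal (J u) * indicator A' u \<partial>vol P0)"
    if [measurable]: "A' \<in> sets borel" and A': "A' \<subseteq> A" for A'
  proof -
    define E where "E n = A' \<inter> {u. J u * indicator A u \<le> real n} \<inter> cball 0 (real n)" for n :: nat
    have [measurable]: "E n \<in> sets borel" for n unfolding E_def by measurable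
    have incE: "incseq E"
      unfolding E_def by (intro monoI) (force simp: le_fun_def)
    have UE: "(\<Union>n. E n) = A'"
    proof safe
      fix u assume u: "u \<in> A'"
      obtain n where "max (J u * indicator A u) (norm u) \<le> real n" using real_arch_simple by blast
      then show "u \<in> (\<Union>n. E n)" using u by (auto simp: E_def)
    qed (auto simp: E_def)
    have E: "emeasure (vol P0) (h ` E n) = (\<integral>\<^sup>+u. ennreal (J u) * indicator (E n) u \<partial>vol P0)" for n
    proof (rule vol_im)
      show "E n \<subseteq> A" using A' by (auto simp: E_def)
      show "bounded (E n)" by (rule bounded_subset[OF bounded_cball]) (auto simp: E_def)
      show "J u \<le> real n" if "u \<in> E n" for u using that A' by (auto simp: E_def indicator_def)
    qed auto
    have hE: "h ` E n \<in> sets (vol P0)" for n using im[of "E n"] A' by (auto simp: E_def)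
    have "emeasure (vol P0) (h ` A') = emeasure (vol P0) (\<Union>n. h ` E n)" unfolding UE[symmetric] by (simp add: image_UN)
    also have "\<dots> = (SUP n. emeasure (vol P0) (h ` E n))"
      by (rule SUP_emeasure_incseq[symmetric]) (use hE incE in \<open>auto simp: mono_def le_fun_def intro!: image_mono\<close>)
    also have "\<dots> = (SUP n. (\<integral>\<^sup>+u. ennreal (J u * indicator A u) * indicator (E n) u \<partial>vol P0))"
      unfolding E by (intro SUP_cong refl nn_integral_cong) (use A' in \<open>auto simp: E_def indicator_def\<close>)
    also have "\<dots> = (\<integral>\<^sup>+u. (SUP n. ennreal (J u * indicator A u) * indicator (E n) u) \<partial>vol P0)"
    proof (rule nn_integral_monotone_convergence_SUP[symmetric])
      show "incseq (\<lambda>n u. ennreal (J u * indicator A u) * indicator (E n) u)"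
        using incE by (auto simp: mono_def le_fun_def indicator_def subset_iff)
    qed measurable
    also have "\<dots> = (\<integral>\<^sup>+u. ennreal (J u) * indicator A' u \<partial>vol P0)"
    proof (rule nn_integral_cong)
      fix u
      have "(SUP n. ennreal (J u * indicator A u) * indicator (E n) u) = ennreal (J u * indicator A u) * (SUP n. indicator (E n) u)"
        by (rule SUP_mult_left_ennreal[symmetric])
      also have "(SUP n. indicator (E n) u :: ennreal) = indicator A' u"
      proof (cases "u \<in> A'")
        case True
        then obtain n where "u \<in> E n" using UE by blast
        then have "(SUP n. indicator (E n) u :: ennreal) \<ge> 1" by (intro SUP_upper2[of n]) auto
        moreover have "(SUP n. indicator (E n) u :: ennreal) \<le> 1" by (intro SUP_least) (auto simp: indicator_def)
        ultimately show ?thesis using True by auto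
      next
        case False
        then have "u \<notin> E n" for n using UE by blast
        then show ?thesis using False by simp
      qed
      finally show "(SUP n. ennreal (J u * indicator A u) * indicator (E n) u) = ennreal (J u) * indicator A' u"
        using A' by (auto simp: indicator_def)
    qed
    finally show ?thesis .
  qed
  define h1 where "h1 u = (if u \<in> A then h u else 0)" for u
  have h1[measurable]: "h1 \<in> borel_measurable borel"
  proof -
    have "continuous_on A h"
      by (rule has_derivative_continuous_on) (rule has_derivative_subset[OF der AP])
    then have "(\<lambda>u. indicator A u *\<^sub>R h u) \<in> borel_measurable borel" by (rule borel_measurable_continuous_on_indicator[OF A])
    moreover have "h1 = (\<lambda>u. indicator A u *\<^sub>R h u)" by (auto simp: h1_def fun_eq_iff)
    ultimately show ?thesis by simp
  qed
  have md: "(\<lambda>u. ennreal (J u * indicator A u)) \<in> borel_measurable (vol P0)" by measurable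
  have hAm[measurable]: "h ` A \<in> sets borel" by (rule im) auto
  \<comment> \<open>finally from sets to functions: \<open>h1\<close> is \<open>h\<close> made total, so that a push-forward can be formed\<close>
  have meq: "density (vol P0) (indicator (h ` A)) = distr (density (vol P0) (\<lambda>u. ennreal (J u * indicator A u))) borel h1"
  proof (rule measure_eqI)
    fix X assume "X \<in> sets (density (vol P0) (indicator (h ` A)))"
    then have [measurable]: "X \<in> sets borel" by simp
    have "emeasure (density (vol P0) (indicator (h ` A))) X = emeasure (vol P0) (h ` A \<inter> X)"
      by (subst emeasure_density) (auto simp: indicator_inter_arith[symmetric] intro: arg_cong)
    also have "h ` A \<inter> X = h ` (A \<inter> h1 -` X)" by (auto simp: h1_def)
    also have "emeasure (vol P0) \<dots> = (\<integral>\<^sup>+u. ennreal (J u) * indicator (A \<inter> h1 -` X) u \<partial>vol P0)"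
      by (rule vol_im') (use measurable_sets[OF h1, of X] in auto)
    also have "\<dots> = emeasure (distr (density (vol P0) (\<lambda>u. ennreal (J u * indicator A u))) borel h1) X"
      using measurable_sets[OF h1, of X]
      by (subst emeasure_distr, simp, simp, subst emeasure_density[OF md])
         (auto simp: indicator_def intro!: nn_integral_cong)
    finally show "emeasure (density (vol P0) (indicator (h ` A))) X = emeasure (distr (density (vol P0) (\<lambda>u. ennreal (J u * indicator A u))) borel h1) X" .
  qed simp
  have "(\<integral>\<^sup>+v. F v * indicator (h ` A) v \<partial>vol P0) = (\<integral>\<^sup>+v. F v \<partial>density (vol P0) (indicator (h ` A)))"
    by (subst nn_integral_density) (auto simp: mult.commute)
  also have "\<dots> = (\<integral>\<^sup>+u. ennreal (J u * indicator A u) * F (h1 u) \<partial>vol P0)"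
    unfolding meq by (subst nn_integral_distr, simp, simp, subst nn_integral_density) auto
  also have "\<dots> = (\<integral>\<^sup>+u. F (h u) * ennreal (J u) * indicator A u \<partial>vol P0)"
    by (intro nn_integral_cong) (auto simp: h1_def indicator_def mult.commute)
  finally show ?thesis .
qed

section \<open>The slice basis\<close>

lemma orthonormal_pbasis: "p \<le> 7 \<Longrightarrow> orthonormal (pbasis p)"
  by (rule orthonormal_subset[OF orthonormal_Basis]) (auto simp: pbasis_def Basis_oct)

lemma unit_sphere_perp:
  assumes "\<eta> \<in> unit_sphere p" "i \<le> p" "p \<le> 6"
  shows "\<eta> \<bullet> oe i = 0"
proof -
  obtain c where c: "\<eta> = (\<Sum>i=p+1..7. c i *\<^sub>R oe i)" using assms(1) by (auto simp: unit_sphere_def)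
  show ?thesis unfolding c inner_sum_left using assms by (intro sum.neutral) (auto simp: oe_inner)
qed

lemma unit_sphere_norm:
  assumes "\<eta> \<in> unit_sphere p"
  shows "\<eta> \<bullet> \<eta> = 1"
proof -
  obtain c where c: "\<eta> = (\<Sum>i=p+1..7. c i *\<^sub>R oe i)" "(\<Sum>i=p+1..7. (c i)\<^sup>2) = 1"
    using assms(1) by (auto simp: unit_sphere_def)
  have "oe i \<bullet> \<eta> = c i" if "i \<in> {p+1..7}" for i
  proof -
    have "oe i \<bullet> \<eta> = (\<Sum>j=p+1..7. if j = i then c i else 0)"
      unfolding c inner_sum_right using that by (intro sum.cong) (auto simp: oe_inner)
    then show ?thesis using that by simp
  qed
  then have "\<eta> \<bullet> \<eta> = (\<Sum>i=p+1..7. c i * c i)"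
    by (subst (1) c(1)) (simp add: inner_sum_left)
  then show ?thesis using c(2) by (simp add: power2_eq_square)
qed

lemma eta_notin_pbasis:
  assumes "\<eta> \<in> unit_sphere p" "p \<le> 6" shows "\<eta> \<notin> pbasis p"
proof
  assume "\<eta> \<in> pbasis p"
  then obtain i where "i \<le> p" "\<eta> = oe i" by (auto simp: pbasis_def)
  then show False using unit_sphere_perp[OF assms(1) _ assms(2), of i] oe_inner[of i i] assms(2) by simp
qed

lemma orthonormal_slice_basis:
  assumes "\<eta> \<in> unit_sphere p" "p \<le> 6" shows "orthonormal (slice_basis p \<eta>)"
proof -
  have "a \<bullet> \<eta> = 0" "\<eta> \<bullet> a = 0" if "a \<in> pbasis p" for a
    using that unit_sphere_perp[OF assms(1) _ assms(2)] by (auto simp: pbasis_def inner_commute)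
  then show ?thesis
    using orthonormal_pbasis[of p] assms unit_sphere_norm[OF assms(1)] eta_notin_pbasis[OF assms]
    unfolding orthonormal_def slice_basis_def by auto
qed

lemma card_slice_basis:
  assumes "\<eta> \<in> unit_sphere p" "p \<le> 6" shows "card (slice_basis p \<eta>) = p + 2"
proof -
  have "inj_on oe {..p}" by (rule inj_on_subset[OF inj_oe]) (use assms in auto)
  then have "card (pbasis p) = p + 1" by (simp add: pbasis_def card_image)
  then show ?thesis using eta_notin_pbasis[OF assms] by (simp add: slice_basis_def pbasis_def)
qed

text \<open>
  The parameter space \<open>span (pbasis p)\<close> omits \<open>\<eta>\<close>, while a graph chart in direction \<open>b\<close> lives over \<open>span (B - {b})\<close>.  For
  orthonormal \<open>b\<close> and \<open>\<eta>\<close>, where \<open>|b - \<eta>|\<^sup>2 = 2\<close>, this is the reflection that exchanges them and identifies the two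
  spaces isometrically; for \<open>b = \<eta>\<close> it is the identity.
\<close>

definition swap_reflection :: "octonion \<Rightarrow> octonion \<Rightarrow> octonion \<Rightarrow> octonion" where
  "swap_reflection \<eta> b x = x - (x \<bullet> (b - \<eta>)) *\<^sub>R (b - \<eta>)"

lemma linear_swap_reflection: "linear (swap_reflection \<eta> b)"
  by (rule linearI) (simp_all add: swap_reflection_def inner_add_left algebra_simps)

lemma continuous_swap_reflection[continuous_intros]:
  "continuous_on S f \<Longrightarrow> continuous_on S (\<lambda>x. swap_reflection \<eta> b (f x))"
  unfolding swap_reflection_def by (intro continuous_intros)

lemma swap_reflection_inner:
  assumes "\<eta> \<bullet> \<eta> = 1" "b \<bullet> b = 1" "\<eta> \<bullet> b = 0 \<or> b = \<eta>"
  shows "swap_reflection \<eta> b x \<bullet> swap_reflection \<eta> b y = x \<bullet> y"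
proof (cases "b = \<eta>")
  case False
  define d where "d = b - \<eta>"
  have dd: "d \<bullet> d = 2" using assms False by (simp add: d_def inner_diff_left inner_diff_right inner_commute)
  have yd: "d \<bullet> y = y \<bullet> d" by (rule inner_commute)
  show ?thesis
    unfolding swap_reflection_def d_def[symmetric]
    by (simp add: inner_diff_left inner_diff_right dd yd)
qed (simp add: swap_reflection_def)

lemma swap_reflection_invol:
  assumes "\<eta> \<bullet> \<eta> = 1" "b \<bullet> b = 1" "\<eta> \<bullet> b = 0 \<or> b = \<eta>"
  shows "swap_reflection \<eta> b (swap_reflection \<eta> b x) = x"
proof (cases "b = \<eta>")
  case False
  define d where "d = b - \<eta>"
  have dd: "d \<bullet> d = 2" using assms False by (simp add: d_def inner_diff_left inner_diff_right inner_commute)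
  show ?thesis
    unfolding swap_reflection_def d_def[symmetric] by (simp add: inner_diff_left dd algebra_simps)
qed (simp add: swap_reflection_def)

lemma swap_reflection_image:
  assumes \<eta>: "\<eta> \<in> unit_sphere p" "p \<le> 6" and b: "b \<in> slice_basis p \<eta>"
  shows "swap_reflection \<eta> b ` pbasis p = slice_basis p \<eta> - {b}"
proof -
  have oB: "orthonormal (slice_basis p \<eta>)" by (rule orthonormal_slice_basis[OF \<eta>])
  have nP: "\<eta> \<notin> pbasis p" by (rule eta_notin_pbasis[OF \<eta>])
  have fix_: "swap_reflection \<eta> b a = a" if "a \<in> pbasis p" "a \<noteq> b" for a
    using that b nP oB unfolding swap_reflection_def slice_basis_def
    by (auto simp: inner_diff_right orthonormal_inner)
  have sw: "swap_reflection \<eta> b b = \<eta>"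
  proof (cases "b = \<eta>")
    case False
    then show ?thesis using oB b unfolding swap_reflection_def slice_basis_def
      by (auto simp: inner_diff_right orthonormal_inner)
  qed (simp add: swap_reflection_def)
  show ?thesis
  proof (cases "b = \<eta>")
    case True
    then have "swap_reflection \<eta> b ` pbasis p = pbasis p" by (simp add: swap_reflection_def)
    then show ?thesis using True nP by (auto simp: slice_basis_def)
  next
    case False
    then have "b \<in> pbasis p" using b by (simp add: slice_basis_def)
    then have "pbasis p = insert b (pbasis p - {b})" by auto
    then have "swap_reflection \<eta> b ` pbasis p = insert \<eta> ((\<lambda>a. swap_reflection \<eta> b a) ` (pbasis p - {b}))"
      using sw by (metis image_insert)
    also have "(\<lambda>a. swap_reflection \<eta> b a) ` (pbasis p - {b}) = pbasis p - {b}" using fix_ by auto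
    finally show ?thesis using False by (auto simp: slice_basis_def)
  qed
qed

section \<open>Graph charts and the area of a graph\<close>

definition graph_map :: "octonion \<Rightarrow> real \<Rightarrow> (octonion \<Rightarrow> real) \<Rightarrow> octonion \<Rightarrow> octonion" where
  "graph_map b s \<gamma> x = x + (s * \<gamma> x) *\<^sub>R b"

definition graph_chart ::
    "octonion set \<Rightarrow> octonion set \<Rightarrow> octonion \<Rightarrow> real \<Rightarrow> octonion \<Rightarrow> real \<Rightarrow> (octonion \<Rightarrow> real) \<Rightarrow> (octonion \<Rightarrow> octonion) \<Rightarrow> bool" where
  "graph_chart B M b s y r \<gamma> grad \<longleftrightarrow> b \<in> B \<and> s \<in> {1, -1} \<and> 0 < r \<and> C1_field (B - {b}) \<gamma> grad \<and>
     (\<forall>x\<in>span B \<inter> ball y r. x \<in> M \<longleftrightarrow> \<gamma> (x - (x \<bullet> b) *\<^sub>R b) = s * (x \<bullet> b))"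

lemma local_param_partials:
  assumes "local_param p M V \<phi>" "e \<in> pbasis p"
  shows "\<And>u. u \<in> V \<Longrightarrow> ((\<lambda>t. \<phi> (u + t *\<^sub>R e)) has_vector_derivative pderiv_along e \<phi> u) (at 0)"
    and "continuous_on V (pderiv_along e \<phi>)"
  using assms by (auto simp: local_param_def pderiv_along_def vector_derivative_works)

lemma continuous_gram_det:
  assumes "local_param p M V \<phi>"
  shows "continuous_on V (gram_det p \<phi>)"
  unfolding gram_det_def[abs_def]
proof (intro continuous_intros)
  fix \<pi> i assume "\<pi> \<in> {\<pi>. \<pi> permutes {..p}}" "i \<in> {..p}"
  then have "\<pi> i \<in> {..p}" using permutes_in_image[of \<pi> "{..p}" i] by simp
  then show "continuous_on V (pderiv_along (oe (\<pi> i)) \<phi>)"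
    by (intro local_param_partials(2)[OF assms]) (simp add: pbasis_def)
next
  fix \<pi> i assume "i \<in> {..p}"
  then show "continuous_on V (pderiv_along (oe i) \<phi>)"
    by (intro local_param_partials(2)[OF assms]) (simp add: pbasis_def)
qed

text \<open>
  Images of Borel sets under a homeomorphism onto a Borel set are Borel, as preimages under its inverse.
\<close>

lemma local_param_borel:
  assumes "local_param p M V \<phi>" and M: "M \<in> sets borel"
  shows "V \<in> sets borel" and "continuous_on V \<phi>" and "inj_on \<phi> V" and "\<phi> ` V \<subseteq> M"
    and "\<And>A. A \<in> sets borel \<Longrightarrow> A \<subseteq> V \<Longrightarrow> \<phi> ` A \<in> sets borel"
proof -
  obtain T where T: "open T" "V = span (pbasis p) \<inter> T"
    using assms by (auto simp: local_param_def openin_open)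
  then show "V \<in> sets borel" by auto
  obtain T' where T': "open T'" "\<phi> ` V = M \<inter> T'"
    using assms by (auto simp: local_param_def openin_open)
  have imV: "\<phi> ` V \<in> sets borel" unfolding T' using T'(1) M by auto
  show "\<phi> ` V \<subseteq> M" using T' by auto
  obtain \<psi> where \<psi>: "homeomorphism V (\<phi> ` V) \<phi> \<psi>" using assms by (auto simp: local_param_def)
  show "continuous_on V \<phi>" using \<psi> by (simp add: homeomorphism_def)
  show "inj_on \<phi> V" using \<psi> by (metis homeomorphism_def inj_on_inverseI)
  fix A :: "octonion set" assume A: "A \<in> sets borel" "A \<subseteq> V"
  have "\<psi> \<in> borel_measurable (restrict_space borel (\<phi> ` V))"
    using \<psi> by (intro borel_measurable_continuous_on_restrict) (simp add: homeomorphism_def)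
  then have "\<psi> -` A \<inter> \<phi> ` V \<in> sets (restrict_space borel (\<phi> ` V))"
    using A(1) by (auto dest: measurable_sets simp: space_restrict_space)
  then have "\<psi> -` A \<inter> \<phi> ` V \<in> sets borel" using imV by (simp add: sets_restrict_space_iff)
  moreover have "\<psi> -` A \<inter> \<phi> ` V = \<phi> ` A" using \<psi> A(2) by (force simp: homeomorphism_def)
  ultimately show "\<phi> ` A \<in> sets borel" by simp
qed

text \<open>
  \<open>M\<close> is the hypersurface of the slice space whose area is to be measured.
\<close>

locale slice_setting =
  fixes p :: nat and \<eta> :: octonion and B :: "octonion set" and M :: "octonion set"
  assumes p6: "p \<le> 6" and \<eta>S: "\<eta> \<in> unit_sphere p" and B_def: "B = slice_basis p \<eta>"
    and closed_M: "closed M" and M_span: "M \<subseteq> span B"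
begin

lemma oB: "orthonormal B"
  unfolding B_def by (rule orthonormal_slice_basis[OF \<eta>S p6])

lemma oP: "orthonormal (pbasis p)"
  by (rule orthonormal_pbasis) (use p6 in simp)

lemma finB: "finite B" by (rule orthonormal_finite[OF oB])

lemma M_borel[measurable]: "M \<in> sets borel"
  using closed_M by (rule borel_closed)

end

text \<open>
  A graph chart of \<open>M\<close>: \<open>\<Gamma>\<close> maps the plane \<open>span A\<close> to the graph, \<open>J\<close> identifies the plane with the parameter space
  \<open>span (pbasis p)\<close>, and \<open>weight\<close> is the area density of the graph.
\<close>

locale chart = slice_setting +
  fixes b :: octonion and s :: real and y :: octonion and r :: real
    and \<gamma> :: "octonion \<Rightarrow> real" and grad :: "octonion \<Rightarrow> octonion"
  assumes gc: "graph_chart B M b s y r \<gamma> grad"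
begin

abbreviation A where "A \<equiv> B - {b}"
abbreviation J where "J \<equiv> swap_reflection \<eta> b"
abbreviation \<Gamma> where "\<Gamma> \<equiv> graph_map b s \<gamma>"
definition weight :: "octonion \<Rightarrow> real" where "weight x = sqrt (1 + (norm (grad x))\<^sup>2)"

lemma b: "b \<in> B" and s: "s \<in> {1, -1}" and r: "0 < r" and C1\<gamma>: "C1_field A \<gamma> grad"
  and M_iff: "\<And>x. x \<in> span B \<Longrightarrow> x \<in> ball y r \<Longrightarrow> x \<in> M \<longleftrightarrow> \<gamma> (x - (x \<bullet> b) *\<^sub>R b) = s * (x \<bullet> b)"
  using gc by (auto simp: graph_chart_def)

lemma s2: "s * s = 1" "s * (s * t) = t" "\<bar>s\<bar> = 1" using s by auto

lemma oA: "orthonormal A" by (rule orthonormal_subset[OF oB]) auto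
lemma finA: "finite A" using finB by simp
lemma nb: "b \<bullet> b = 1" "norm b = 1" using orthonormal_inner[OF oB b b] orthonormal_norm[OF oB b] by auto
lemma spA: "span A \<subseteq> span B" by (intro span_mono) auto
lemma perp: "x \<in> span A \<Longrightarrow> x \<bullet> b = 0" by (rule orthonormal_perp[OF oB _ b]) auto

lemma c\<gamma>: "continuous_on UNIV \<gamma>" and cgr: "continuous_on UNIV grad" and gsp: "grad x \<in> span A"
    and dg: "x \<in> span A \<Longrightarrow> (\<gamma> has_derivative (\<lambda>v. grad x \<bullet> v)) (at x within span A)"
    using C1\<gamma> by (auto simp: C1_field_def)

lemmas c\<gamma>' = continuous_on_compose2[OF c\<gamma> _ subset_UNIV]
lemmas cgr' = continuous_on_compose2[OF cgr _ subset_UNIV]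

lemma meas[measurable]: "\<gamma> \<in> borel_measurable borel" "grad \<in> borel_measurable borel"
  by (auto intro!: borel_measurable_continuous_onI c\<gamma> cgr)
lemma meas\<Gamma>[measurable]: "\<Gamma> \<in> borel_measurable borel"
  unfolding graph_map_def[abs_def] by measurable
lemma meas_weight[measurable]: "weight \<in> borel_measurable borel"
  unfolding weight_def[abs_def] by measurable

lemma cont\<Gamma>: "continuous_on X \<Gamma>"
  unfolding graph_map_def[abs_def] by (intro continuous_intros c\<gamma>')

lemma measJ[measurable]: "J \<in> borel_measurable borel"
  by (intro borel_measurable_continuous_onI continuous_intros)

lemma Jhyps: "\<eta> \<bullet> \<eta> = 1" "b \<bullet> b = 1" "\<eta> \<bullet> b = 0 \<or> b = \<eta>"
proof -
  have "\<eta> \<in> B" by (simp add: B_def slice_basis_def)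
  then show "\<eta> \<bullet> \<eta> = 1" "b \<bullet> b = 1" "\<eta> \<bullet> b = 0 \<or> b = \<eta>" using orthonormal_inner[OF oB] b by auto
qed

lemmas J_inner = swap_reflection_inner[OF Jhyps]
lemmas J_invol = swap_reflection_invol[OF Jhyps]

lemma J_norm: "norm (J x) = norm x" by (simp add: norm_eq_sqrt_inner J_inner)
lemma J_img: "J ` pbasis p = A" unfolding B_def by (rule swap_reflection_image[OF \<eta>S p6]) (use b B_def in simp)

lemma J_span: "u \<in> span (pbasis p) \<Longrightarrow> J u \<in> span A"
  by (metis J_img imageI linear_span_image linear_swap_reflection)
lemma J_span': "x \<in> span A \<Longrightarrow> J x \<in> span (pbasis p)"
  by (metis J_img J_invol imageE linear_span_image linear_swap_reflection)

lemma vol_A: "vol A = distr (vol (pbasis p)) borel J"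
proof -
  have "inj_on J (pbasis p)" by (metis J_invol inj_on_inverseI)
  then show ?thesis using vol_image[OF orthonormal_finite[OF oP] linear_swap_reflection, of \<eta> b] by (simp add: J_img)
qed

lemma oproj_A: "x \<in> span B \<Longrightarrow> oproj A x = x - (x \<bullet> b) *\<^sub>R b"
  using oproj_remove[OF finB b, of x] oproj_span[OF oB, of x] by simp

lemma \<Gamma>_props:
  assumes "x \<in> span A"
  shows "\<Gamma> x \<in> span B" "\<Gamma> x \<bullet> b = s * \<gamma> x" "oproj A (\<Gamma> x) = x" "\<Gamma> x - (\<Gamma> x \<bullet> b) *\<^sub>R b = x"
proof -
  show 1: "\<Gamma> x \<in> span B" unfolding graph_map_def using assms spA b by (intro span_add span_scale) (auto intro: span_base)
  show 2: "\<Gamma> x \<bullet> b = s * \<gamma> x" using perp[OF assms] nb by (simp add: graph_map_def inner_add_left)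
  show "\<Gamma> x - (\<Gamma> x \<bullet> b) *\<^sub>R b = x" unfolding 2 by (simp add: graph_map_def)
  then show "oproj A (\<Gamma> x) = x" using oproj_A[OF 1] by simp
qed

lemma \<Gamma>_in_M: "x \<in> span A \<Longrightarrow> \<Gamma> x \<in> ball y r \<Longrightarrow> \<Gamma> x \<in> M"
  using M_iff[of "\<Gamma> x"] \<Gamma>_props[of x] s2 by simp

lemma M_is_\<Gamma>:
  assumes "x \<in> M" "x \<in> ball y r" shows "\<Gamma> (oproj A x) = x"
proof -
  have xB: "x \<in> span B" using assms M_span by auto
  have "\<gamma> (oproj A x) = s * (x \<bullet> b)" using M_iff[OF xB assms(2)] assms(1) oproj_A[OF xB] by simp
  then show ?thesis using oproj_A[OF xB] s2 by (simp add: graph_map_def)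
qed

text \<open>
  Every parametrisation \<open>\<phi>\<close> factors through the graph: \<open>\<phi> = \<Gamma> \<circ> J \<circ> h\<close>, where \<open>h\<close> projects \<open>\<phi>\<close> to the plane \<open>span A\<close>
  and carries the result to the parameter space.  By \<open>gram_graph\<close> the square root of the Gram determinant of \<open>\<phi>\<close> is the Jacobian of
  \<open>h\<close> times the weight of the graph, so the claim is the change of variables \<open>v = h u\<close>.
\<close>

lemma graph_area:
  assumes lp: "local_param p M V \<phi>" and X[measurable]: "X \<in> sets borel" and XV: "X \<subseteq> V" and Xb: "\<phi> ` X \<subseteq> ball y r"
  shows "(\<integral>\<^sup>+u. ennreal (sqrt (gram_det p \<phi> u)) * indicator X u \<partial>vol (pbasis p)) =
         (\<integral>\<^sup>+x. ennreal (weight x) * indicator (\<phi> ` X) (\<Gamma> x) \<partial>vol A)"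
proof -
  let ?P = "pbasis p"
  note lpb = local_param_borel[OF lp M_borel]
  have opV: "openin (top_of_set (span ?P)) V" using lp by (simp add: local_param_def)
  have Vsp: "V \<subseteq> span ?P" using opV by (rule openin_imp_subset)
  define h where "h u = J (oproj A (\<phi> u))" for u
  define h' where "h' u v = J (oproj A (\<Sum>e\<in>?P. (v \<bullet> e) *\<^sub>R pderiv_along e \<phi> u))" for u v
  define k where "k u i = oproj A (pderiv_along (oe i) \<phi> u)" for u i
  define JJ where "JJ u = sqrt (gram_det p \<phi> u) / weight (J (h u))" for u
  have weight_pos: "0 < weight x" for x by (simp add: weight_def add_pos_nonneg)
  have cJlin: "linear (\<lambda>x. J (oproj A x))" using linear_compose[OF linear_oproj linear_swap_reflection] by (simp add: o_def)
  then have cJ: "bounded_linear (\<lambda>x. J (oproj A x))" by (simp add: linear_conv_bounded_linear)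
  have \<phi>M: "\<phi> u \<in> M" if "u \<in> V" for u using that lpb(4) by auto
  have \<phi>h: "\<phi> u = \<Gamma> (J (h u))" if "u \<in> X" for u
  proof -
    have "\<phi> u \<in> M" "\<phi> u \<in> ball y r" using that XV Xb \<phi>M by auto
    then show ?thesis using M_is_\<Gamma>[of "\<phi> u"] by (simp add: h_def J_invol)
  qed
  have der\<phi>: "(\<phi> has_derivative (\<lambda>v. \<Sum>e\<in>?P. (v \<bullet> e) *\<^sub>R pderiv_along e \<phi> u)) (at u within span ?P)" if "u \<in> V" for u
    by (rule C1_partials_imp_has_derivative[OF oP opV that]) (use local_param_partials[OF lp] in auto)
  have derh: "(h has_derivative h' u) (at u within span ?P)" if "u \<in> V" for u
    unfolding h_def h'_def by (rule bounded_linear.has_derivative[OF cJ der\<phi>[OF that]])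
  have injh: "inj_on h X"
  proof (rule inj_onI)
    fix u v assume "u \<in> X" "v \<in> X" "h u = h v"
    then have "\<phi> u = \<phi> v" using \<phi>h by metis
    then show "u = v" using lpb(3) \<open>u \<in> X\<close> \<open>v \<in> X\<close> XV by (auto dest: inj_onD)
  qed
  have hsp: "h u \<in> span ?P" for u unfolding h_def by (rule J_span'[OF oproj_in_span])
  have himg: "h ` X' = span ?P \<inter> (\<lambda>v. \<Gamma> (J v)) -` (\<phi> ` X')" if "X' \<subseteq> X" for X'
  proof (intro set_eqI iffI)
    fix v assume "v \<in> h ` X'"
    then obtain u where u: "u \<in> X'" "v = h u" by auto
    then have "\<Gamma> (J (h u)) = \<phi> u" using \<phi>h[of u] that by auto
    then show "v \<in> span ?P \<inter> (\<lambda>v. \<Gamma> (J v)) -` (\<phi> ` X')" using hsp u by auto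
  next
    fix v assume "v \<in> span ?P \<inter> (\<lambda>v. \<Gamma> (J v)) -` (\<phi> ` X')"
    then obtain u where v: "v \<in> span ?P" "u \<in> X'" "\<Gamma> (J v) = \<phi> u" by auto
    then have "J v = J (h u)" using \<Gamma>_props(3)[OF J_span] \<phi>h[of u] hsp that by (metis subsetD)
    then have "v = h u" by (metis J_invol)
    then show "v \<in> h ` X'" using v by auto
  qed
  \<comment> \<open>\<open>h\<close> inherits Borel images from \<open>\<phi>\<close>, because \<open>h ` X'\<close> is a preimage of \<open>\<phi> ` X'\<close>\<close>
  have him: "h ` X' \<in> sets borel" if "X' \<in> sets borel" "X' \<subseteq> X" for X'
  proof -
    have [measurable]: "\<phi> ` X' \<in> sets borel" using lpb(5)[of X'] that XV by auto
    have "(\<lambda>v. \<Gamma> (J v)) \<in> borel_measurable borel" by measurable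
    then have "(\<lambda>v. \<Gamma> (J v)) -` (\<phi> ` X') \<in> sets borel" using measurable_sets[of "\<lambda>v. \<Gamma> (J v)" borel borel "\<phi> ` X'"] by simp
    then show ?thesis unfolding himg[OF that(2)] by auto
  qed
  \<comment> \<open>the tangent vectors of \<open>\<phi>\<close> are determined by their projections to the parameter plane\<close>
  have tangent: "pderiv_along (oe i) \<phi> u = k u i + (s * (grad (J (h u)) \<bullet> k u i)) *\<^sub>R b" if u: "u \<in> X" and i: "i \<le> p" for u i
  proof -
    have uV: "u \<in> V" using u XV by auto
    have e: "oe i \<in> ?P" using i by (simp add: pbasis_def)
    note d = local_param_partials(1)[OF lp e uV]
    have dk: "((\<lambda>t. oproj A (\<phi> (u + t *\<^sub>R oe i))) has_vector_derivative k u i) (at 0)"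
      unfolding k_def by (rule bounded_linear.has_vector_derivative[OF bounded_linear_oproj d])
    have at0: "oproj A (\<phi> (u + 0 *\<^sub>R oe i)) = J (h u)" by (simp add: h_def J_invol)
    have "((\<lambda>t. \<gamma> (oproj A (\<phi> (u + t *\<^sub>R oe i)))) has_vector_derivative grad (J (h u)) \<bullet> k u i) (at 0)"
      by (rule has_vector_derivative_along_curve[OF _ dk oproj_in_span])
         (use dg[OF oproj_in_span] at0 in metis)
    then have d\<Gamma>: "((\<lambda>t. \<Gamma> (oproj A (\<phi> (u + t *\<^sub>R oe i)))) has_vector_derivative k u i + (s * (grad (J (h u)) \<bullet> k u i)) *\<^sub>R b) (at 0)"
      unfolding graph_map_def using dk
      by (auto intro!: derivative_eq_intros simp: has_real_derivative_iff_has_vector_derivative)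
    have "((\<lambda>t. u + t *\<^sub>R oe i) \<longlongrightarrow> u + 0 *\<^sub>R oe i) (at 0)" by (intro tendsto_intros)
    then have lim: "((\<lambda>t. u + t *\<^sub>R oe i) \<longlongrightarrow> u) (at 0)" by simp
    obtain \<delta> where \<delta>: "\<delta> > 0" "ball u \<delta> \<inter> span ?P \<subseteq> V"
      using opV uV unfolding openin_contains_ball by blast
    have inV: "u + t *\<^sub>R oe i \<in> V" if "\<bar>t\<bar> < \<delta>" for t
    proof -
      have "u + t *\<^sub>R oe i \<in> span ?P" using uV Vsp e by (intro span_add span_scale) (auto intro: span_base)
      moreover have "dist u (u + t *\<^sub>R oe i) < \<delta>" using that orthonormal_norm[OF oP e] by (simp add: dist_norm)
      ultimately show ?thesis using \<delta> by auto
    qed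
    have "((\<lambda>t. \<phi> (u + t *\<^sub>R oe i)) \<longlongrightarrow> \<phi> (u + 0 *\<^sub>R oe i)) (at 0)"
      using has_vector_derivative_continuous[OF d] by (simp add: continuous_within)
    moreover have "\<phi> (u + 0 *\<^sub>R oe i) \<in> ball y r" using u Xb by auto
    ultimately have "\<forall>\<^sub>F t in at 0. \<phi> (u + t *\<^sub>R oe i) \<in> ball y r" by (intro topological_tendstoD) auto
    moreover have "\<forall>\<^sub>F t in at 0. \<bar>t\<bar> < \<delta>" using \<delta>(1) by (auto simp: eventually_at dist_real_def)
    ultimately have "\<forall>\<^sub>F t in at 0. \<Gamma> (oproj A (\<phi> (u + t *\<^sub>R oe i))) = \<phi> (u + t *\<^sub>R oe i)"
      by eventually_elim (intro M_is_\<Gamma> \<phi>M inV)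
    then have "\<forall>\<^sub>F t in nhds 0. \<Gamma> (oproj A (\<phi> (u + t *\<^sub>R oe i))) = \<phi> (u + t *\<^sub>R oe i)"
      unfolding eventually_at_filter
      by eventually_elim (use \<phi>h[OF u] in \<open>auto simp: h_def J_invol\<close>)
    then have "((\<lambda>t. \<phi> (u + t *\<^sub>R oe i)) has_vector_derivative k u i + (s * (grad (J (h u)) \<bullet> k u i)) *\<^sub>R b) (at 0)"
      using d\<Gamma> by (subst (asm) has_vector_derivative_cong_ev[where g = "\<lambda>t. \<phi> (u + t *\<^sub>R oe i)"]) (auto dest: eventually_nhds_x_imp_x)
    then show ?thesis by (rule vector_derivative_unique_at[OF d])
  qed
  have JJ: "JJ u = \<bar>det (matrix (\<lambda>v. h' u (oproj ?P v) + oproj (Basis - ?P) v))\<bar>"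
    and gram_pos: "0 \<le> gram_det p \<phi> u" if u: "u \<in> X" for u
  proof -
    let ?f = "\<lambda>v. h' u (oproj ?P v) + oproj (Basis - ?P) v"
    have lin: "linear ?f"
    proof -
      have "linear (h' u)" using derh[of u] u XV has_derivative_linear by blast
      then have "linear (h' u \<circ> oproj ?P)" by (intro linear_compose linear_oproj)
      then show ?thesis using linear_compose_add[OF _ linear_oproj] by (simp add: o_def)
    qed
    have PB: "?P \<subseteq> Basis" using p6 by (auto simp: pbasis_def Basis_oct)
    have oCb: "orthonormal (Basis - ?P)" by (rule orthonormal_subset[OF orthonormal_Basis]) auto
    have f1: "?f (oe i) = J (k u i)" if "i \<le> p" for i
    proof -
      have e: "oe i \<in> ?P" using that by (simp add: pbasis_def)
      have "oproj ?P (oe i) = oe i" by (rule oproj_span[OF oP]) (rule span_base[OF e])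
      moreover have "oproj (Basis - ?P) (oe i) = 0"
        unfolding oproj_def using e PB by (intro sum.neutral) (auto simp: orthonormal_inner[OF orthonormal_Basis])
      moreover have "(\<Sum>e\<in>?P. (oe i \<bullet> e) *\<^sub>R pderiv_along e \<phi> u) = (\<Sum>e\<in>?P. if e = oe i then pderiv_along (oe i) \<phi> u else 0)"
        using e by (intro sum.cong) (auto simp: orthonormal_inner[OF oP])
      ultimately show ?thesis using e orthonormal_finite[OF oP] by (simp add: h'_def k_def)
    qed
    have f2: "?f (oe i) = oe i" if "p < i" "i \<le> 7" for i
    proof -
      have nP: "oe i \<notin> ?P" using inj_on_image_mem_iff[OF inj_oe, of i "{..p}"] that p6 by (auto simp: pbasis_def)
      have e: "oe i \<in> Basis" using that by (simp add: Basis_oct)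
      have "oproj ?P (oe i) = 0"
        unfolding oproj_def using e nP PB by (intro sum.neutral) (auto simp: orthonormal_inner[OF orthonormal_Basis])
      moreover have "oproj (Basis - ?P) (oe i) = oe i" by (rule oproj_span[OF oCb]) (use e nP in \<open>auto intro: span_base\<close>)
      moreover have "h' u 0 = 0" by (simp add: h'_def linear_0[OF cJlin])
      ultimately show ?thesis by simp
    qed
    have g: "gram_det p \<phi> u = (det (matrix ?f))\<^sup>2 * (1 + (norm (J (grad (J (h u)))))\<^sup>2)"
      unfolding gram_det_def
    proof (rule gram_graph[OF _ lin f1 f2])
      fix i j assume ij: "i \<le> p" "j \<le> p"
      have kb: "k u i \<bullet> b = 0" "b \<bullet> k u j = 0" using perp[OF oproj_in_span] by (simp_all add: k_def inner_commute)
      show "pderiv_along (oe i) \<phi> u \<bullet> pderiv_along (oe j) \<phi> u =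
        J (k u i) \<bullet> J (k u j) + J (grad (J (h u))) \<bullet> J (k u i) * (J (grad (J (h u))) \<bullet> J (k u j))"
        using kb nb s2 by (simp add: tangent[OF u] ij J_inner inner_add_left inner_add_right)
    qed (use p6 J_span'[OF gsp] J_span'[OF oproj_in_span] in \<open>auto simp: k_def\<close>)
    then show "0 \<le> gram_det p \<phi> u" by simp
    show "JJ u = \<bar>det (matrix ?f)\<bar>"
      using weight_pos[of "J (h u)"] by (simp add: JJ_def g J_norm real_sqrt_mult weight_def)
  qed
  have conth: "continuous_on V h" unfolding h_def by (intro continuous_intros lpb(2))
  have cJJ: "continuous_on X JJ"
    unfolding JJ_def weight_def
  proof (intro continuous_intros)
    show "continuous_on X (gram_det p \<phi>)" by (rule continuous_on_subset[OF continuous_gram_det[OF lp] XV])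
    show "continuous_on X (\<lambda>u. grad (J (h u)))"
      by (intro cgr' continuous_intros continuous_on_subset[OF conth XV])
    show "\<forall>x\<in>X. sqrt (1 + (norm (grad (J (h x))))\<^sup>2) \<noteq> 0"
      using weight_pos unfolding weight_def by (metis less_irrefl)
  qed
  have cov: "(\<integral>\<^sup>+v. ennreal (weight (J v)) * indicator (h ` X) v \<partial>vol ?P) =
      (\<integral>\<^sup>+u. ennreal (weight (J (h u))) * ennreal (JJ u) * indicator X u \<partial>vol ?P)"
  proof (rule change_of_variables_subspace[where h' = h'])
    show "?P \<subseteq> Basis" using p6 by (auto simp: pbasis_def Basis_oct)
    show "X \<subseteq> span ?P" using XV Vsp by auto
    show "h ` X \<subseteq> span ?P" using hsp by auto
    show "(h has_derivative h' u) (at u within span ?P)" if "u \<in> X" for u using derh that XV by auto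
  qed (use injh him cJJ JJ in auto)
  have "(\<integral>\<^sup>+u. ennreal (sqrt (gram_det p \<phi> u)) * indicator X u \<partial>vol ?P) =
      (\<integral>\<^sup>+u. ennreal (weight (J (h u))) * ennreal (JJ u) * indicator X u \<partial>vol ?P)"
  proof (intro nn_integral_cong)
    fix u
    have "ennreal (weight (J (h u))) * ennreal (JJ u) = ennreal (sqrt (gram_det p \<phi> u))" if "u \<in> X"
      using weight_pos[of "J (h u)"] gram_pos[OF that] by (simp add: JJ_def flip: ennreal_mult)
    then show "ennreal (sqrt (gram_det p \<phi> u)) * indicator X u = ennreal (weight (J (h u))) * ennreal (JJ u) * indicator X u"
      by (auto simp: indicator_def)
  qed
  also note cov[symmetric]
  also have "(\<integral>\<^sup>+v. ennreal (weight (J v)) * indicator (h ` X) v \<partial>vol ?P) =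
     (\<integral>\<^sup>+v. ennreal (weight (J v)) * indicator (\<phi> ` X) (\<Gamma> (J v)) \<partial>vol ?P)"
    by (rule nn_integral_cong_AE, use AE_vol_span[OF orthonormal_finite[OF oP]] in eventually_elim)
       (auto simp: himg indicator_def)
  also have "\<dots> = (\<integral>\<^sup>+x. ennreal (weight x) * indicator (\<phi> ` X) (\<Gamma> x) \<partial>vol A)"
  proof -
    have [measurable]: "\<phi> ` X \<in> sets borel" using lpb(5) XV X by auto
    have m: "(\<lambda>x. ennreal (weight x) * indicator (\<phi> ` X) (\<Gamma> x)) \<in> borel_measurable borel" by measurable
    have "J \<in> vol ?P \<rightarrow>\<^sub>M borel" by measurable
    from nn_integral_distr[OF this, of "\<lambda>x. ennreal (weight x) * indicator (\<phi> ` X) (\<Gamma> x)"] m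
    show ?thesis by (simp add: vol_A)
  qed
  finally show ?thesis .
qed

end

section \<open>The surface measure\<close>

lemma glue_measures:
  fixes \<mu> \<nu> :: "'a::topological_space measure"
  assumes \<mu>: "sets \<mu> = sets borel" and \<nu>: "sets \<nu> = sets borel" and U: "U \<in> sets borel"
  shows "\<exists>\<rho>. sets \<rho> = sets borel \<and> (\<forall>C\<in>sets borel. emeasure \<rho> C = emeasure \<mu> (C \<inter> U) + emeasure \<nu> (C - U))"
proof -
  define f where "f C = emeasure \<mu> (C \<inter> U) + emeasure \<nu> (C - U)" for C
  define \<rho> where "\<rho> = measure_of UNIV (sets (borel :: 'a measure)) f"
  have sa: "sigma_algebra UNIV (sets (borel :: 'a measure))"
    using sets.sigma_algebra_axioms[of "borel :: 'a measure"] by simp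
  have "countably_additive (sets borel) f"
  proof (rule countably_additiveI)
    fix X :: "nat \<Rightarrow> 'a set" assume X: "range X \<subseteq> sets borel" "disjoint_family X"
    have 1: "(\<Sum>i. emeasure \<mu> (X i \<inter> U)) = emeasure \<mu> (\<Union>i. X i \<inter> U)"
      using X U \<mu> by (intro suminf_emeasure) (auto simp: disjoint_family_on_def)
    have 2: "(\<Sum>i. emeasure \<nu> (X i - U)) = emeasure \<nu> (\<Union>i. X i - U)"
      using X U \<nu> by (intro suminf_emeasure) (auto simp: disjoint_family_on_def)
    have 3: "(\<Union>i. X i \<inter> U) = (\<Union>i. X i) \<inter> U" "(\<Union>i. X i - U) = (\<Union>i. X i) - U" by auto
    have "(\<Sum>i. f (X i)) = emeasure \<mu> (\<Union>i. X i \<inter> U) + emeasure \<nu> (\<Union>i. X i - U)"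
      unfolding f_def by (simp add: suminf_add[symmetric] 1 2)
    then show "(\<Sum>i. f (X i)) = f (\<Union>i. X i)" by (simp only: f_def 3)
  qed
  moreover have "positive (sets borel) f" by (simp add: positive_def f_def)
  ultimately have "emeasure \<rho> C = f C" if "C \<in> sets borel" for C
    unfolding \<rho>_def using that sa by (intro emeasure_measure_of_sigma) auto
  moreover have "sets \<rho> = sets borel" unfolding \<rho>_def by (rule sigma_algebra.sets_measure_of_eq[OF sa])
  ultimately show ?thesis unfolding f_def by blast
qed

context slice_setting
begin

definition is_surface_measure :: "octonion measure \<Rightarrow> bool" where
  "is_surface_measure \<sigma> \<longleftrightarrow> space \<sigma> = M \<and> sets \<sigma> = sets (restrict_space borel M) \<and>
     (\<forall>V \<phi> X. local_param p M V \<phi> \<and> X \<in> sets borel \<and> X \<subseteq> V \<longrightarrow>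
        emeasure \<sigma> (\<phi> ` X) = (\<integral>\<^sup>+u\<in>X. ennreal (sqrt (gram_det p \<phi> u)) \<partial>vol (pbasis p)))"

lemma surface_sets:
  assumes "is_surface_measure \<sigma>" shows "C \<in> sets \<sigma> \<longleftrightarrow> C \<in> sets borel \<and> C \<subseteq> M"
  using assms by (simp add: is_surface_measure_def sets_restrict_space_iff conj_commute)

end

context chart
begin

text \<open>
  The graph chart is itself a regular parametrisation, so the surface measure is prescribed on it.
\<close>

lemma graph_local_param: "local_param p M {u \<in> span (pbasis p). \<Gamma> (J u) \<in> ball y r} (\<lambda>u. \<Gamma> (J u))"
proof -
  let ?P = "pbasis p" and ?\<Phi> = "\<lambda>u. \<Gamma> (J u)"
  let ?V = "{u \<in> span ?P. ?\<Phi> u \<in> ball y r}"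
  have c\<Phi>: "continuous_on X ?\<Phi>" for X
    by (rule continuous_on_compose2[OF cont\<Gamma>[of UNIV] _ subset_UNIV]) (intro continuous_intros)
  have op: "openin (top_of_set (span ?P)) ?V"
  proof -
    have "open (?\<Phi> -` ball y r)" using c\<Phi>[of UNIV] by (intro open_vimage) auto
    moreover have "?V = span ?P \<inter> ?\<Phi> -` ball y r" by auto
    ultimately show ?thesis by (simp add: openin_open_Int)
  qed
  have der: "((\<lambda>t. ?\<Phi> (u + t *\<^sub>R e)) has_vector_derivative J e + (s * (grad (J u) \<bullet> J e)) *\<^sub>R b) (at 0)"
    if u: "u \<in> span ?P" and e: "e \<in> ?P" for u e
  proof -
    have lin: "J (u + t *\<^sub>R e) = J u + t *\<^sub>R J e" for t
      by (simp add: linear_add[OF linear_swap_reflection] linear_scale[OF linear_swap_reflection])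
    have sp: "J u + t *\<^sub>R J e \<in> span A" for t
      using J_span[OF u] J_span[OF span_base[OF e]] by (intro span_add span_scale)
    have d: "((\<lambda>t. J u + t *\<^sub>R J e) has_vector_derivative J e) (at 0)" by (auto intro!: derivative_eq_intros)
    have "((\<lambda>t. \<gamma> (J u + t *\<^sub>R J e)) has_vector_derivative grad (J u) \<bullet> J e) (at 0)"
      by (rule has_vector_derivative_along_curve[OF _ d sp]) (use dg[OF J_span[OF u]] in simp)
    then show ?thesis unfolding lin graph_map_def using d
      by (auto intro!: derivative_eq_intros simp: has_real_derivative_iff_has_vector_derivative)
  qed
  have pd: "pderiv_along e ?\<Phi> u = J e + (s * (grad (J u) \<bullet> J e)) *\<^sub>R b" if "u \<in> span ?P" "e \<in> ?P" for u e
    unfolding pderiv_along_def by (rule vector_derivative_at[OF der[OF that]])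
  have "Ck_on ?P ?V 1 ?\<Phi>"
    unfolding One_nat_def Ck_on.simps
  proof (intro conjI ballI c\<Phi>)
    fix e u assume "e \<in> ?P" "u \<in> ?V"
    then show "(\<lambda>t. ?\<Phi> (u + t *\<^sub>R e)) differentiable at 0"
      using der[of u e] by (auto intro: differentiableI_vector)
  next
    fix e assume e: "e \<in> ?P"
    have "continuous_on ?V (\<lambda>u. J e + (s * (grad (J u) \<bullet> J e)) *\<^sub>R b)"
      by (intro continuous_intros cgr')
    then show "continuous_on ?V (pderiv_along e ?\<Phi>)"
      by (rule continuous_on_eq) (use pd e in auto)
  qed
  moreover have img: "?\<Phi> ` ?V = M \<inter> ball y r"
  proof (intro equalityI subsetI)
    fix x assume "x \<in> ?\<Phi> ` ?V" then show "x \<in> M \<inter> ball y r" using \<Gamma>_in_M J_span by auto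
  next
    fix x assume x: "x \<in> M \<inter> ball y r"
    have "x = ?\<Phi> (J (oproj A x))" using M_is_\<Gamma>[of x] x by (simp add: J_invol)
    moreover have "J (oproj A x) \<in> span ?P" by (rule J_span'[OF oproj_in_span])
    ultimately show "x \<in> ?\<Phi> ` ?V" using x by (intro image_eqI[of _ _ "J (oproj A x)"]) auto
  qed
  moreover have "openin (top_of_set M) (?\<Phi> ` ?V)" unfolding img by (simp add: openin_open_Int)
  moreover have "homeomorphism ?V (?\<Phi> ` ?V) ?\<Phi> (\<lambda>x. J (oproj A x))"
  proof (rule homeomorphismI)
    show "continuous_on ?V ?\<Phi>" by (rule c\<Phi>)
    show "continuous_on (?\<Phi> ` ?V) (\<lambda>x. J (oproj A x))" by (intro continuous_intros)
    show "(\<lambda>x. J (oproj A x)) ` ?\<Phi> ` ?V \<subseteq> ?V"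
      using \<Gamma>_props(3)[OF J_span] by (auto simp: J_invol)
    show "J (oproj A (?\<Phi> x)) = x" if "x \<in> ?V" for x using \<Gamma>_props(3)[OF J_span] that by (simp add: J_invol)
    show "?\<Phi> (J (oproj A x)) = x" if "x \<in> ?\<Phi> ` ?V" for x
      using that M_is_\<Gamma>[of x] unfolding img by (simp add: J_invol)
  qed auto
  moreover have "gram_det p ?\<Phi> u \<noteq> 0" if u: "u \<in> ?V" for u
  proof -
    have "gram_det p ?\<Phi> u = (det (matrix (\<lambda>x::octonion. x)))\<^sup>2 * (1 + (norm (J (grad (J u))))\<^sup>2)"
      unfolding gram_det_def
    proof (rule gram_graph[where d = oe])
      fix i j assume ij: "i \<le> p" "j \<le> p"
      have e: "oe i \<in> ?P" "oe j \<in> ?P" using ij by (auto simp: pbasis_def)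
      have kb: "J (oe i) \<bullet> b = 0" "b \<bullet> J (oe j) = 0"
        using perp[OF J_span[OF span_base]] e by (simp_all add: inner_commute)
      have gJ: "J (grad (J u)) \<bullet> x = grad (J u) \<bullet> J x" for x
        using J_inner[of "grad (J u)" "J x"] by (simp add: J_invol)
      show "pderiv_along (oe i) ?\<Phi> u \<bullet> pderiv_along (oe j) ?\<Phi> u =
          oe i \<bullet> oe j + J (grad (J u)) \<bullet> oe i * (J (grad (J u)) \<bullet> oe j)"
        using u e kb nb s2 by (simp add: pd J_inner gJ inner_add_left inner_add_right)
    qed (use p6 J_span'[OF gsp] in \<open>auto simp: pbasis_def linear_iff intro: span_base\<close>)
    then have "gram_det p ?\<Phi> u = 1 + (norm (J (grad (J u))))\<^sup>2" by (simp add: matrix_id_mat_1[unfolded id_def])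
    also have "\<dots> > 0" by (simp add: add_pos_nonneg)
    finally show ?thesis by simp
  qed
  ultimately show ?thesis using op unfolding local_param_def by blast
qed

lemma surface_measure_chart:
  assumes \<sigma>: "is_surface_measure \<sigma>" and C: "C \<in> sets borel" "C \<subseteq> M" "C \<subseteq> ball y r"
  shows "emeasure \<sigma> C = (\<integral>\<^sup>+x. ennreal (weight x) * indicator C (\<Gamma> x) \<partial>vol A)"
proof -
  let ?V = "{u \<in> span (pbasis p). \<Gamma> (J u) \<in> ball y r}" and ?\<Phi> = "\<lambda>u. \<Gamma> (J u)"
  note lp = graph_local_param
  define X where "X = {u \<in> ?V. ?\<Phi> u \<in> C}"
  have XC: "?\<Phi> ` X = C"
  proof (intro equalityI subsetI)
    fix x assume x: "x \<in> C"
    have "x \<in> M" "x \<in> ball y r" using x C by auto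
    then have "x = ?\<Phi> (J (oproj A x))" using M_is_\<Gamma>[of x] by (simp add: J_invol)
    moreover have "J (oproj A x) \<in> span (pbasis p)" by (rule J_span'[OF oproj_in_span])
    ultimately show "x \<in> ?\<Phi> ` X" using x C by (intro image_eqI[of _ _ "J (oproj A x)"]) (auto simp: X_def)
  qed (auto simp: X_def)
  have X: "X \<in> sets borel" "X \<subseteq> ?V"
  proof -
    have m: "?\<Phi> \<in> borel_measurable borel" by measurable
    have "X = span (pbasis p) \<inter> ?\<Phi> -` C" using C by (auto simp: X_def)
    then show "X \<in> sets borel" using measurable_sets[OF m C(1)] by auto
  qed (auto simp: X_def)
  have "emeasure \<sigma> C = (\<integral>\<^sup>+u\<in>X. ennreal (sqrt (gram_det p ?\<Phi> u)) \<partial>vol (pbasis p))"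
    using \<sigma> lp X unfolding is_surface_measure_def XC[symmetric] by blast
  also have "\<dots> = (\<integral>\<^sup>+x. ennreal (weight x) * indicator C (\<Gamma> x) \<partial>vol A)"
    using graph_area[OF lp X(1,2)] C XC by simp
  finally show ?thesis .
qed

text \<open>
  Points of the graph that lie in the ball project into a compact set, on which the weight is bounded.
\<close>

lemma surface_measure_chart_finite:
  assumes \<sigma>: "is_surface_measure \<sigma>"
  shows "emeasure \<sigma> (M \<inter> ball y r) < \<infinity>"
proof -
  define K where "K = norm y + r"
  have bd: "norm x \<le> K" if "x \<in> span A" "\<Gamma> x \<in> ball y r" for x
  proof -
    have "norm x = norm (oproj A (\<Gamma> x))" using \<Gamma>_props(3)[OF that(1)] by simp
    also have "\<dots> \<le> norm (\<Gamma> x)" by (rule norm_oproj_le[OF oA])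
    also have "\<dots> \<le> K" using that(2) norm_triangle_ineq[of y "\<Gamma> x - y"] by (simp add: K_def dist_norm norm_minus_commute)
    finally show ?thesis .
  qed
  have "continuous_on (cball 0 K) weight"
    unfolding weight_def[abs_def] by (intro continuous_intros continuous_on_subset[OF cgr]) auto
  then have "compact (weight ` cball 0 K)" by (intro compact_continuous_image) auto
  then obtain C where C: "\<And>x. x \<in> cball 0 K \<Longrightarrow> norm (weight x) \<le> C" by (meson bounded_iff compact_imp_bounded imageI)
  have "emeasure \<sigma> (M \<inter> ball y r) = (\<integral>\<^sup>+x. ennreal (weight x) * indicator (M \<inter> ball y r) (\<Gamma> x) \<partial>vol A)"
    by (rule surface_measure_chart[OF \<sigma>]) auto
  also have "\<dots> \<le> (\<integral>\<^sup>+x. ennreal C * indicator (cball 0 K) x \<partial>vol A)"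
  proof (rule nn_integral_mono_AE, use AE_vol_span[OF finA] in eventually_elim)
    fix x assume x: "x \<in> span A"
    show "ennreal (weight x) * indicator (M \<inter> ball y r) (\<Gamma> x) \<le> ennreal C * indicator (cball 0 K) x"
      using bd[OF x] C[of x] by (auto simp: indicator_def intro: ennreal_leI)
  qed
  also have "\<dots> = ennreal C * emeasure (vol A) (cball 0 K)" by (rule nn_integral_cmult_indicator) simp
  also have "\<dots> < \<infinity>" using emeasure_vol_cball[OF oA, of K] by (simp add: ennreal_mult_less_top)
  finally show ?thesis .
qed

lemma surface_integral_chart:
  fixes F :: "octonion \<Rightarrow> 'c::{banach, second_countable_topology}"
  assumes \<sigma>: "is_surface_measure \<sigma>" and F[measurable]: "F \<in> borel_measurable borel"
  shows "(\<integral>x. indicator (ball y r) x *\<^sub>R F x \<partial>\<sigma>) = (\<integral>x. (weight x * indicator (M \<inter> ball y r) (\<Gamma> x)) *\<^sub>R F (\<Gamma> x) \<partial>vol A)"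
proof -
  have ss[measurable_cong]: "sets \<sigma> = sets (restrict_space borel M)" using \<sigma> by (simp add: is_surface_measure_def)
  have sp: "space \<sigma> = M" using \<sigma> by (simp add: is_surface_measure_def)
  have idm: "(\<lambda>x. x) \<in> \<sigma> \<rightarrow>\<^sub>M borel" by (subst measurable_cong_sets[OF ss refl]) (auto intro: measurable_restrict_space1)
  have "(\<lambda>x. indicator (ball y r) x :: real) \<in> borel_measurable borel" by (rule borel_measurable_indicator) simp
  from measurable_compose[OF idm this]
  have indm[measurable]: "(\<lambda>x. indicator (ball y r) x :: real) \<in> borel_measurable \<sigma>" .
  have wpos: "0 \<le> weight x" for x by (simp add: weight_def)
  define w where "w x = weight x * indicator (M \<inter> ball y r) (\<Gamma> x)" for x
  have mi: "(\<lambda>x. indicator (M \<inter> ball y r) (\<Gamma> x) :: real) \<in> borel_measurable borel"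
    by (rule measurable_compose[OF meas\<Gamma>], rule borel_measurable_indicator) auto
  have w[measurable]: "w \<in> borel_measurable (vol A)"
    unfolding w_def[abs_def] using borel_measurable_times[OF meas_weight mi] by simp
  have w0: "0 \<le> w x" for x unfolding w_def by (rule mult_nonneg_nonneg[OF wpos]) simp
  have iem: "(\<lambda>x. ennreal (indicator (ball y r) x)) \<in> borel_measurable \<sigma>" using indm by simp
  have wem: "(\<lambda>x. ennreal (w x)) \<in> borel_measurable (vol A)" using w by simp
  have \<Gamma>m: "\<Gamma> \<in> density (vol A) (\<lambda>x. ennreal (w x)) \<rightarrow>\<^sub>M borel" by simp
  have eq: "distr (density \<sigma> (\<lambda>x. ennreal (indicator (ball y r) x))) borel (\<lambda>x. x) = distr (density (vol A) (\<lambda>x. ennreal (w x))) borel \<Gamma>"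
  proof (rule measure_eqI)
    fix X assume "X \<in> sets (distr (density \<sigma> (\<lambda>x. ennreal (indicator (ball y r) x))) borel (\<lambda>x. x))"
    then have X[measurable]: "X \<in> sets borel" by simp
    have XM: "X \<inter> M \<in> sets \<sigma>" using surface_sets[OF \<sigma>] by auto
    have "emeasure (distr (density \<sigma> (\<lambda>x. ennreal (indicator (ball y r) x))) borel (\<lambda>x. x)) X =
        emeasure (density \<sigma> (\<lambda>x. ennreal (indicator (ball y r) x))) (X \<inter> M)"
      using idm by (subst emeasure_distr) (auto simp: sp)
    also have "\<dots> = (\<integral>\<^sup>+x. indicator (X \<inter> M \<inter> ball y r) x \<partial>\<sigma>)"
      unfolding emeasure_density[OF iem XM] by (intro nn_integral_cong) (auto simp: indicator_def)
    also have "\<dots> = emeasure \<sigma> (X \<inter> M \<inter> ball y r)"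
      by (rule nn_integral_indicator) (use surface_sets[OF \<sigma>] in auto)
    also have "\<dots> = (\<integral>\<^sup>+x. ennreal (weight x) * indicator (X \<inter> M \<inter> ball y r) (\<Gamma> x) \<partial>vol A)"
      by (rule surface_measure_chart[OF \<sigma>]) auto
    also have "\<dots> = (\<integral>\<^sup>+x. ennreal (w x) * indicator (\<Gamma> -` X) x \<partial>vol A)"
      by (intro nn_integral_cong) (auto simp: w_def indicator_def)
    also have "\<dots> = emeasure (distr (density (vol A) (\<lambda>x. ennreal (w x))) borel \<Gamma>) X"
      using measurable_sets[OF meas\<Gamma> X] by (subst emeasure_distr[OF \<Gamma>m X], subst emeasure_density[OF wem]) auto
    finally show "emeasure (distr (density \<sigma> (\<lambda>x. ennreal (indicator (ball y r) x))) borel (\<lambda>x. x)) X =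
      emeasure (distr (density (vol A) (\<lambda>x. ennreal (w x))) borel \<Gamma>) X" .
  qed simp
  have Fm: "F \<in> borel_measurable \<sigma>" using measurable_compose[OF idm F] by simp
  have "(\<integral>x. indicator (ball y r) x *\<^sub>R F x \<partial>\<sigma>) = (\<integral>x. F x \<partial>density \<sigma> (\<lambda>x. ennreal (indicator (ball y r) x)))"
    by (rule integral_density[symmetric]) (use Fm in auto)
  also have "\<dots> = (\<integral>x. F x \<partial>distr (density \<sigma> (\<lambda>x. ennreal (indicator (ball y r) x))) borel (\<lambda>x. x))"
    by (rule integral_distr[symmetric]) (use idm F in auto)
  also have "\<dots> = (\<integral>x. F (\<Gamma> x) \<partial>density (vol A) (\<lambda>x. ennreal (w x)))"
    unfolding eq by (rule integral_distr[OF \<Gamma>m F])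
  also have "\<dots> = (\<integral>x. w x *\<^sub>R F (\<Gamma> x) \<partial>vol A)"
    by (rule integral_density) (use w0 in auto)
  finally show ?thesis by (simp add: w_def)
qed

end

text \<open>
  The data of a chart as a tuple \<open>(b, s, y, r, \<gamma>, grad)\<close>, so that a finite atlas is a set.
\<close>

type_synonym chart_data = "octonion \<times> real \<times> octonion \<times> real \<times> (octonion \<Rightarrow> real) \<times> (octonion \<Rightarrow> octonion)"

definition chart_dom :: "chart_data \<Rightarrow> octonion set" where
  "chart_dom = (\<lambda>(b, s, y, r, \<gamma>, grad). ball y r)"

context slice_setting
begin

definition is_chart :: "chart_data \<Rightarrow> bool" where
  "is_chart = (\<lambda>(b, s, y, r, \<gamma>, grad). graph_chart B M b s y r \<gamma> grad)"

text \<open>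
  By induction on the number of charts: split \<open>C\<close> into the part in the ball of one chart, where both measures are the
  weighted measure of the graph, and the part that the remaining charts cover.
\<close>

lemma surface_measure_unique_on:
  assumes "is_surface_measure \<sigma>" "is_surface_measure \<sigma>'" "finite I" "\<And>i. i \<in> I \<Longrightarrow> is_chart i"
    and "C \<in> sets borel" "C \<subseteq> M" "C \<subseteq> (\<Union>i\<in>I. chart_dom i)"
  shows "emeasure \<sigma> C = emeasure \<sigma>' C"
  using assms(3-)
proof (induction I arbitrary: C rule: finite_induct)
  case empty then show ?case by simp
next
  case (insert i I)
  obtain b s y r \<gamma> grad where i: "i = (b, s, y, r, \<gamma>, grad)" by (cases i)
  interpret chart p \<eta> B M b s y r \<gamma> grad
    using insert.prems(1)[of i] by unfold_locales (simp add: is_chart_def i)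
  have C: "C \<in> sets borel" "C \<subseteq> M" by fact+
  have sub: "C - ball y r \<subseteq> (\<Union>i\<in>I. chart_dom i)" using insert.prems(4) by (auto simp: chart_dom_def i)
  have "emeasure \<rho> C = emeasure \<rho> (C \<inter> ball y r) + emeasure \<rho> (C - ball y r)" if "is_surface_measure \<rho>" for \<rho>
    using C surface_sets[OF that] by (subst plus_emeasure) (auto intro: arg_cong[where f = "emeasure \<rho>"])
  moreover have "emeasure \<sigma> (C \<inter> ball y r) = emeasure \<sigma>' (C \<inter> ball y r)"
    using C le_infI1[OF C(2), of "ball y r"] surface_measure_chart[OF assms(1), of "C \<inter> ball y r"] surface_measure_chart[OF assms(2), of "C \<inter> ball y r"] by auto
  moreover have "emeasure \<sigma> (C - ball y r) = emeasure \<sigma>' (C - ball y r)"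
    by (rule insert.IH) (use insert.prems C sub in auto)
  ultimately show ?case using assms(1,2) by simp
qed

text \<open>
  By induction on the number of charts: where the earlier charts reach, their measure is kept, and elsewhere the
  weighted measure of the new graph is taken.  The defining formula survives because by \<open>graph_area\<close> every
  parametrisation sees the weighted measure of the graph as its own.
\<close>

lemma surface_measure_exists_on:
  assumes "finite I" "\<And>i. i \<in> I \<Longrightarrow> is_chart i"
  shows "\<exists>\<mu>. sets \<mu> = sets borel \<and> (\<forall>V \<phi> X. local_param p M V \<phi> \<and> X \<in> sets borel \<and> X \<subseteq> V \<and> \<phi> ` X \<subseteq> (\<Union>i\<in>I. chart_dom i) \<longrightarrow>
        emeasure \<mu> (\<phi> ` X) = (\<integral>\<^sup>+u\<in>X. ennreal (sqrt (gram_det p \<phi> u)) \<partial>vol (pbasis p)))"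
  using assms
proof (induction I rule: finite_induct)
  case empty
  then show ?case by (intro exI[of _ "null_measure borel"]) auto
next
  case (insert i I)
  obtain b s y r \<gamma> grad where i: "i = (b, s, y, r, \<gamma>, grad)" by (cases i)
  interpret chart p \<eta> B M b s y r \<gamma> grad
    using insert.prems(1)[of i] by unfold_locales (simp add: is_chart_def i)
  define U where "U = (\<Union>i\<in>I. chart_dom i)"
  have U[measurable]: "U \<in> sets borel" unfolding U_def
    by (intro borel_open open_UN) (auto simp: chart_dom_def)
  obtain \<mu> where \<mu>: "sets \<mu> = sets borel" "\<And>V \<phi> X. local_param p M V \<phi> \<Longrightarrow> X \<in> sets borel \<Longrightarrow> X \<subseteq> V \<Longrightarrow> \<phi> ` X \<subseteq> U \<Longrightarrow>
        emeasure \<mu> (\<phi> ` X) = (\<integral>\<^sup>+u\<in>X. ennreal (sqrt (gram_det p \<phi> u)) \<partial>vol (pbasis p))"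
    using insert.IH insert.prems by (auto simp: U_def)
  define \<nu> where "\<nu> = distr (density (vol A) (\<lambda>x. ennreal (weight x))) borel \<Gamma>"
  have \<nu>: "sets \<nu> = sets borel" by (simp add: \<nu>_def)
  have \<Gamma>m: "\<Gamma> \<in> density (vol A) (\<lambda>x. ennreal (weight x)) \<rightarrow>\<^sub>M borel" by simp
  have em\<nu>: "emeasure \<nu> C = (\<integral>\<^sup>+x. ennreal (weight x) * indicator C (\<Gamma> x) \<partial>vol A)" if [measurable]: "C \<in> sets borel" for C
    unfolding \<nu>_def using measurable_sets[OF meas\<Gamma> that]
    by (subst emeasure_distr[OF \<Gamma>m that], subst emeasure_density) (auto simp: indicator_def intro!: nn_integral_cong)
  obtain \<rho> where \<rho>: "sets \<rho> = sets borel" "\<And>C. C \<in> sets borel \<Longrightarrow> emeasure \<rho> C = emeasure \<mu> (C \<inter> U) + emeasure \<nu> (C - U)"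
    using glue_measures[OF \<mu>(1) \<nu> U] by blast
  show ?case
  proof (intro exI[of _ \<rho>] conjI allI impI \<rho>(1), elim conjE)
    fix V \<phi> X assume lp: "local_param p M V \<phi>" and X[measurable]: "X \<in> sets borel" and XV: "X \<subseteq> V"
      and dom: "\<phi> ` X \<subseteq> (\<Union>i\<in>insert i I. chart_dom i)"
    note lpb = local_param_borel[OF lp M_borel]
    define X1 where "X1 = X \<inter> \<phi> -` U"
    have "\<phi> \<in> borel_measurable (restrict_space borel V)" by (rule borel_measurable_continuous_on_restrict[OF lpb(2)])
    from measurable_sets[OF this U] have "\<phi> -` U \<inter> V \<in> sets (restrict_space borel V)"
      by (simp add: space_restrict_space)
    then have "\<phi> -` U \<inter> V \<in> sets borel" using lpb(1) by (simp add: sets_restrict_space_iff)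
    moreover have "X1 = X \<inter> (\<phi> -` U \<inter> V)" using XV by (auto simp: X1_def)
    ultimately have X1[measurable]: "X1 \<in> sets borel" by auto
    have X2[measurable]: "X - X1 \<in> sets borel" by auto
    have im1: "\<phi> ` X \<inter> U = \<phi> ` X1" and im2: "\<phi> ` X - U = \<phi> ` (X - X1)" by (auto simp: X1_def)
    have m: "(\<lambda>u. ennreal (sqrt (gram_det p \<phi> u)) * indicator Y u) \<in> borel_measurable (vol (pbasis p))"
      if Y: "Y \<in> sets borel" "Y \<subseteq> V" for Y
    proof -
      have "continuous_on Y (\<lambda>u. sqrt (gram_det p \<phi> u))"
        by (intro continuous_intros continuous_on_subset[OF continuous_gram_det[OF lp] Y(2)])
      from borel_measurable_continuous_on_indicator[OF Y(1) this]
      have "(\<lambda>u. ennreal (indicator Y u * sqrt (gram_det p \<phi> u))) \<in> borel_measurable borel" by simp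
      moreover have "(\<lambda>u. ennreal (indicator Y u * sqrt (gram_det p \<phi> u))) = (\<lambda>u. ennreal (sqrt (gram_det p \<phi> u)) * indicator Y u)"
        by (auto simp: indicator_def)
      ultimately show ?thesis by simp
    qed
    have "emeasure \<rho> (\<phi> ` X) = emeasure \<mu> (\<phi> ` X1) + emeasure \<nu> (\<phi> ` (X - X1))"
      using \<rho>(2)[OF lpb(5)[OF X XV]] by (simp add: im1 im2)
    also have "emeasure \<mu> (\<phi> ` X1) = (\<integral>\<^sup>+u\<in>X1. ennreal (sqrt (gram_det p \<phi> u)) \<partial>vol (pbasis p))"
      by (rule \<mu>(2)[OF lp X1]) (use XV in \<open>auto simp: X1_def\<close>)
    also have "emeasure \<nu> (\<phi> ` (X - X1)) = (\<integral>\<^sup>+x. ennreal (weight x) * indicator (\<phi> ` (X - X1)) (\<Gamma> x) \<partial>vol A)"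
      by (rule em\<nu>, rule lpb(5)) (use XV in auto)
    also have "\<dots> = (\<integral>\<^sup>+u\<in>X - X1. ennreal (sqrt (gram_det p \<phi> u)) \<partial>vol (pbasis p))"
    proof (rule graph_area[OF lp X2, symmetric])
      have "\<phi> ` X \<subseteq> ball y r \<union> U" using dom by (simp add: U_def i chart_dom_def)
      then show "\<phi> ` (X - X1) \<subseteq> ball y r" by (auto simp: X1_def)
    qed (use XV in auto)
    also have "(\<integral>\<^sup>+u\<in>X1. ennreal (sqrt (gram_det p \<phi> u)) \<partial>vol (pbasis p)) + \<dots> =
       (\<integral>\<^sup>+u. ennreal (sqrt (gram_det p \<phi> u)) * indicator X1 u + ennreal (sqrt (gram_det p \<phi> u)) * indicator (X - X1) u \<partial>vol (pbasis p))"
      by (rule nn_integral_add[symmetric]) (intro m; use XV X1_def X1 X2 in auto)+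
    also have "\<dots> = (\<integral>\<^sup>+u\<in>X. ennreal (sqrt (gram_det p \<phi> u)) \<partial>vol (pbasis p))"
      by (intro nn_integral_cong) (auto simp: indicator_def X1_def)
    finally show "emeasure \<rho> (\<phi> ` X) = (\<integral>\<^sup>+u\<in>X. ennreal (sqrt (gram_det p \<phi> u)) \<partial>vol (pbasis p))" .
  qed
qed

end

text \<open>
  A finite atlas makes the definite description of the surface measure meaningful.
\<close>

locale slice_atlas = slice_setting +
  fixes I :: "chart_data set"
  assumes fin_I: "finite I" and charts: "\<And>i. i \<in> I \<Longrightarrow> is_chart i" and cover: "M \<subseteq> (\<Union>i\<in>I. chart_dom i)"
begin

lemma surface_measure_is: "is_surface_measure (surface_measure p M)"
proof -
  obtain \<mu> where \<mu>1: "sets \<mu> = sets borel \<and> (\<forall>V \<phi> X. local_param p M V \<phi> \<and> X \<in> sets borel \<and> X \<subseteq> V \<and>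
      \<phi> ` X \<subseteq> (\<Union>i\<in>I. chart_dom i) \<longrightarrow>
      emeasure \<mu> (\<phi> ` X) = (\<integral>\<^sup>+u\<in>X. ennreal (sqrt (gram_det p \<phi> u)) \<partial>vol (pbasis p)))"
    using surface_measure_exists_on[OF fin_I charts] ..
  then have \<mu>: "sets \<mu> = sets borel" "\<And>V \<phi> X. local_param p M V \<phi> \<Longrightarrow> X \<in> sets borel \<Longrightarrow> X \<subseteq> V \<Longrightarrow>
      \<phi> ` X \<subseteq> (\<Union>i\<in>I. chart_dom i) \<Longrightarrow>
      emeasure \<mu> (\<phi> ` X) = (\<integral>\<^sup>+u\<in>X. ennreal (sqrt (gram_det p \<phi> u)) \<partial>vol (pbasis p))"
    by simp_all
  have spU: "space \<mu> = UNIV" using sets_eq_imp_space_eq[OF \<mu>(1)] by simp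
  have ex: "is_surface_measure (restrict_space \<mu> M)"
    unfolding is_surface_measure_def
  proof (intro conjI allI impI, goal_cases)
    case 1 show ?case by (simp add: space_restrict_space spU)
  next
    case 2 show ?case by (rule sets_restrict_space_cong[OF \<mu>(1)])
  next
    case (3 V \<phi> X)
    note lpb = local_param_borel[OF _ M_borel, of p V \<phi>]
    from 3 have 4: "local_param p M V \<phi>" "X \<in> sets borel" "X \<subseteq> V" by auto
    have XM: "\<phi> ` X \<subseteq> M" using lpb(4)[OF 4(1)] 4(3) by (meson image_mono subset_trans)
    have "emeasure (restrict_space \<mu> M) (\<phi> ` X) = emeasure \<mu> (\<phi> ` X)"
      using XM M_borel by (intro emeasure_restrict_space) (auto simp: \<mu>(1) spU)
    also have "\<dots> = (\<integral>\<^sup>+u\<in>X. ennreal (sqrt (gram_det p \<phi> u)) \<partial>vol (pbasis p))"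
      by (rule \<mu>(2)[OF 4]) (rule subset_trans[OF XM cover])
    finally show ?case .
  qed
  show ?thesis
    unfolding surface_measure_def is_surface_measure_def[symmetric]
  proof (rule theI[where P = is_surface_measure, OF ex])
    fix \<sigma> assume \<sigma>: "is_surface_measure \<sigma>"
    show "\<sigma> = restrict_space \<mu> M"
    proof (rule measure_eqI)
      show "sets \<sigma> = sets (restrict_space \<mu> M)" using \<sigma> ex by (simp add: is_surface_measure_def)
      fix C assume "C \<in> sets \<sigma>"
      then show "emeasure \<sigma> C = emeasure (restrict_space \<mu> M) C"
        using surface_sets[OF \<sigma>] cover by (intro surface_measure_unique_on[OF \<sigma> ex fin_I charts]) auto
    qed
  qed
qed

lemma finite_surface_measure: "finite_measure (surface_measure p M)"
proof -
  note \<sigma> = surface_measure_is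
  have fin: "emeasure (surface_measure p M) (M \<inter> chart_dom i) < \<infinity>" if "i \<in> I" for i
  proof -
    obtain b s y r \<gamma> grad where i: "i = (b, s, y, r, \<gamma>, grad)" by (cases i)
    interpret chart p \<eta> B M b s y r \<gamma> grad
      using charts[OF that] by unfold_locales (simp add: is_chart_def i)
    show ?thesis using surface_measure_chart_finite[OF \<sigma>] by (simp add: i chart_dom_def)
  qed
  have "M = (\<Union>i\<in>I. M \<inter> chart_dom i)" using cover by auto
  then have "emeasure (surface_measure p M) M = emeasure (surface_measure p M) (\<Union>i\<in>I. M \<inter> chart_dom i)" by simp
  also have "\<dots> \<le> (\<Sum>i\<in>I. emeasure (surface_measure p M) (M \<inter> chart_dom i))"
    using surface_sets[OF \<sigma>] by (intro emeasure_subadditive_finite fin_I) (auto simp: chart_dom_def split: prod.splits)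
  also have "\<dots> < \<infinity>" using fin fin_I by (simp add: ennreal_sum_less_top)
  finally show ?thesis using \<sigma> by (intro finite_measureI) (simp add: is_surface_measure_def)
qed

end

section \<open>The domain and its exterior normal\<close>

definition region_chart ::
    "octonion set \<Rightarrow> octonion set \<Rightarrow> octonion \<Rightarrow> real \<Rightarrow> octonion \<Rightarrow> real \<Rightarrow> (octonion \<Rightarrow> real) \<Rightarrow> (octonion \<Rightarrow> octonion) \<Rightarrow> bool" where
  "region_chart B S b s y r \<gamma> grad \<longleftrightarrow> b \<in> B \<and> s \<in> {1, -1} \<and> 0 < r \<and> C1_field (B - {b}) \<gamma> grad \<and>
     (\<forall>x\<in>span B \<inter> ball y r. x \<in> S \<longleftrightarrow> \<gamma> (x - (x \<bullet> b) *\<^sub>R b) < s * (x \<bullet> b))"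

text \<open>
  Composition with the projection to \<open>span A\<close> extends \<open>\<gamma>\<close> and its gradient continuously to the whole space.
\<close>

lemma C1_field_extend:
  assumes A: "orthonormal A" and \<gamma>: "Ck_on A (span A) 1 \<gamma>"
  shows "\<exists>grad. C1_field A (\<lambda>x. \<gamma> (oproj A x)) grad"
proof -
  have c\<gamma>: "continuous_on (span A) \<gamma>"
    and der: "\<And>a x. a \<in> A \<Longrightarrow> x \<in> span A \<Longrightarrow> ((\<lambda>t. \<gamma> (x + t *\<^sub>R a)) has_vector_derivative pderiv_along a \<gamma> x) (at 0)"
    and cd: "\<And>a. a \<in> A \<Longrightarrow> continuous_on (span A) (pderiv_along a \<gamma>)"
    using \<gamma> by (auto simp: pderiv_along_def vector_derivative_works)
  define grad where "grad x = (\<Sum>a\<in>A. pderiv_along a \<gamma> (oproj A x) *\<^sub>R a)" for x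
  have pr: "continuous_on UNIV (oproj A)" by (intro continuous_intros)
  have "continuous_on UNIV (\<lambda>x. \<gamma> (oproj A x))"
    by (rule continuous_on_compose2[OF c\<gamma> pr]) (auto simp: oproj_in_span)
  moreover have "continuous_on UNIV grad"
    unfolding grad_def by (intro continuous_intros continuous_on_compose2[OF cd pr]) (auto simp: oproj_in_span)
  moreover have "grad x \<in> span A" for x unfolding grad_def by (intro span_sum span_scale span_base)
  moreover have "((\<lambda>x. \<gamma> (oproj A x)) has_derivative (\<lambda>v. grad x \<bullet> v)) (at x within span A)" if x: "x \<in> span A" for x
  proof -
    have "(\<gamma> has_derivative (\<lambda>v. \<Sum>a\<in>A. (v \<bullet> a) *\<^sub>R pderiv_along a \<gamma> x)) (at x within span A)"
      by (rule C1_partials_imp_has_derivative[OF A openin_subtopology_self x]) (use der cd in auto)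
    then have "((\<lambda>x. \<gamma> (oproj A x)) has_derivative (\<lambda>v. \<Sum>a\<in>A. (v \<bullet> a) *\<^sub>R pderiv_along a \<gamma> x)) (at x within span A)"
      by (rule has_derivative_transform[rotated 2]) (use x in \<open>auto simp: oproj_span[OF A]\<close>)
    moreover have "(\<lambda>v. \<Sum>a\<in>A. (v \<bullet> a) *\<^sub>R pderiv_along a \<gamma> x) = (\<lambda>v. grad x \<bullet> v)"
      by (simp add: fun_eq_iff grad_def oproj_span[OF A x] inner_sum_left inner_sum_right inner_commute mult.commute)
    ultimately show ?thesis by simp
  qed
  ultimately show ?thesis unfolding C1_field_def by blast
qed

text \<open>
  \<open>S\<close> stands for the slice of \<open>U\<close> and \<open>bd\<close> for its boundary in the slice space.  The latter is written with the closure
  in \<open>real^8\<close>, which is the same since the slice space is closed.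
\<close>

locale slice_domain =
  fixes p :: nat and \<eta> :: octonion and B :: "octonion set" and S :: "octonion set"
  assumes p6: "p \<le> 6" and \<eta>S: "\<eta> \<in> unit_sphere p" and B_def: "B = slice_basis p \<eta>"
    and opS: "openin (top_of_set (span B)) S" and bdS: "bounded S" and smooth: "has_smooth_boundary B S"
begin

definition bd :: "octonion set" where "bd = closure S - S"

lemma oB: "orthonormal B"
  unfolding B_def by (rule orthonormal_slice_basis[OF \<eta>S p6])

lemma S_span: "S \<subseteq> span B" using opS by (rule openin_imp_subset)

lemma clS_span: "closure S \<subseteq> span B" using S_span by (simp add: closure_minimal closed_span)

lemma closure_in_eq: "closure_in B S = closure S"
  using S_span clS_span unfolding closure_in_def closure_of_subtopology euclidean_closure_of
  by (auto simp: Int_absorb1)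

lemma boundary_in_eq: "boundary_in B S = bd"
  using closure_in_eq opS by (simp add: boundary_in_def bd_def frontier_of_def closure_in_def interior_of_openin)

lemma closed_bd: "closed bd"
proof -
  obtain T where "open T" "S = span B \<inter> T" using opS by (auto simp: openin_open)
  then have "bd = closure S - T" using clS_span unfolding bd_def by blast
  then show ?thesis using \<open>open T\<close> by (simp add: closed_Diff)
qed

lemma bd_span: "bd \<subseteq> span B" using clS_span by (auto simp: bd_def)

lemma setting: "slice_setting p \<eta> B bd"
  using p6 \<eta>S B_def closed_bd bd_span by (simp add: slice_setting_def)

text \<open>
  Moving a point of the graph in the direction \<open>s b\<close> leads into \<open>S\<close>, and points strictly below the graph have a
  neighbourhood disjoint from \<open>S\<close>.
\<close>

lemma region_closure:
  assumes rc: "region_chart B S b s y r \<gamma> grad" and x: "x \<in> span B" "x \<in> ball y r"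
  shows "x \<in> closure S \<longleftrightarrow> \<gamma> (x - (x \<bullet> b) *\<^sub>R b) \<le> s * (x \<bullet> b)"
proof
  have b: "b \<in> B" and s: "s \<in> {1, -1}" and c\<gamma>: "continuous_on UNIV \<gamma>"
    and iff: "\<And>x. x \<in> span B \<Longrightarrow> x \<in> ball y r \<Longrightarrow> x \<in> S \<longleftrightarrow> \<gamma> (x - (x \<bullet> b) *\<^sub>R b) < s * (x \<bullet> b)"
    using rc by (auto simp: region_chart_def C1_field_def)
  have nb: "b \<bullet> b = 1" "norm b = 1" using orthonormal_inner[OF oB b b] orthonormal_norm[OF oB b] by auto
  show "\<gamma> (x - (x \<bullet> b) *\<^sub>R b) \<le> s * (x \<bullet> b)" if cl: "x \<in> closure S"
  proof (rule ccontr)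
    assume neg: "\<not> \<gamma> (x - (x \<bullet> b) *\<^sub>R b) \<le> s * (x \<bullet> b)"
    define O' where "O' = {z. s * (z \<bullet> b) < \<gamma> (z - (z \<bullet> b) *\<^sub>R b)} \<inter> ball y r"
    have "continuous_on UNIV (\<lambda>z. \<gamma> (z - (z \<bullet> b) *\<^sub>R b))"
      by (rule continuous_on_compose2[OF c\<gamma> _ subset_UNIV]) (intro continuous_intros)
    then have "open {z. s * (z \<bullet> b) < \<gamma> (z - (z \<bullet> b) *\<^sub>R b)}"
      by (intro open_Collect_less) (intro continuous_intros)+
    then have "open O'" by (auto simp: O'_def)
    moreover have "x \<in> O'" using neg x by (auto simp: O'_def)
    ultimately obtain z where "z \<in> S" "z \<in> O'" using cl by (auto simp: closure_iff_nhds_not_empty)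
    then show False using iff[of z] S_span by (auto simp: O'_def)
  qed
  show "x \<in> closure S" if le: "\<gamma> (x - (x \<bullet> b) *\<^sub>R b) \<le> s * (x \<bullet> b)"
    unfolding closure_approachable
  proof (intro allI impI)
    fix e :: real assume "e > 0"
    obtain d where d: "d > 0" "ball x d \<subseteq> ball y r" using x openE[OF open_ball] by metis
    define t where "t = min e d / 2"
    have t: "0 < t" "t < e" "t < d" using \<open>e > 0\<close> d by (auto simp: t_def)
    define z where "z = x + (s * t) *\<^sub>R b"
    have dz: "dist z x = t" using t s nb by (auto simp: z_def dist_norm)
    have zb: "z \<bullet> b = x \<bullet> b + s * t" using nb by (simp add: z_def inner_add_left)
    have "z - (z \<bullet> b) *\<^sub>R b = x - (x \<bullet> b) *\<^sub>R b" unfolding zb by (simp add: z_def scaleR_add_left)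
    moreover have "s * (z \<bullet> b) = s * (x \<bullet> b) + t" using s zb by (auto simp: distrib_left)
    moreover have "z \<in> span B" unfolding z_def using x b by (intro span_add span_scale) (auto intro: span_base)
    moreover have "z \<in> ball y r" using d(2) dz t by (auto simp: dist_commute)
    ultimately have "z \<in> S" using iff[of z] le t by simp
    then show "\<exists>z\<in>S. dist z x < e" using dz t by auto
  qed
qed

lemma region_chart_graph:
  assumes "region_chart B S b s y r \<gamma> grad"
  shows "graph_chart B bd b s y r \<gamma> grad"
  using assms region_closure[OF assms] unfolding graph_chart_def region_chart_def bd_def
  by (auto simp: order_less_le)

text \<open>
  Around an interior point a horizontal plane below a whole ball serves as the graph.  Interior and boundary points
  can thus be treated alike when the divergence theorem is localised.
\<close>

lemma region_chart_exists:
  assumes y: "y \<in> closure S"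
  shows "\<exists>b s r \<gamma> grad. region_chart B S b s y r \<gamma> grad"
proof (cases "y \<in> S")
  case True
  \<comment> \<open>\<open>ball y r\<close> lies strictly above the plane of height \<open>y \<bullet> \<eta> - r\<close>\<close>
  obtain r where r: "0 < r" "ball y r \<inter> span B \<subseteq> S" using opS True unfolding openin_contains_ball by blast
  have b: "\<eta> \<in> B" by (simp add: B_def slice_basis_def)
  have n\<eta>: "norm \<eta> = 1" by (rule orthonormal_norm[OF oB b])
  have "C1_field (B - {\<eta>}) (\<lambda>_. y \<bullet> \<eta> - r) (\<lambda>_. 0)" by (auto simp: C1_field_def span_zero)
  moreover have "x \<in> S \<longleftrightarrow> y \<bullet> \<eta> - r < 1 * (x \<bullet> \<eta>)" if "x \<in> span B \<inter> ball y r" for x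
  proof -
    have "\<bar>(y - x) \<bullet> \<eta>\<bar> \<le> norm (y - x) * norm \<eta>" by (rule Cauchy_Schwarz_ineq2)
    then have "y \<bullet> \<eta> - x \<bullet> \<eta> < r" using that by (auto simp: inner_diff_left n\<eta> dist_norm)
    then show ?thesis using that r by auto
  qed
  ultimately have "region_chart B S \<eta> 1 y r (\<lambda>_. y \<bullet> \<eta> - r) (\<lambda>_. 0)" using b r by (simp add: region_chart_def)
  then show ?thesis by blast
next
  case False
  then have "y \<in> boundary_in B S" using y by (simp add: boundary_in_eq bd_def)
  then obtain b s r \<gamma> where b: "b \<in> B" and s: "s \<in> {1,-1::real}" and r: "r > 0"
    and sm: "smooth_on (B - {b}) (span (B - {b})) \<gamma>"
    and iff: "\<forall>x\<in>span B \<inter> ball y r. x \<in> S \<longleftrightarrow> s * (x \<bullet> b) > \<gamma> (x - (x \<bullet> b) *\<^sub>R b)"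
    using smooth unfolding has_smooth_boundary_def by blast
  have oA: "orthonormal (B - {b})" by (rule orthonormal_subset[OF oB]) auto
  have "Ck_on (B - {b}) (span (B - {b})) 1 \<gamma>" using sm by (simp only: smooth_on_def)
  then obtain grad where g: "C1_field (B - {b}) (\<lambda>x. \<gamma> (oproj (B - {b}) x)) grad" using C1_field_extend[OF oA] by blast
  have "oproj (B - {b}) (x - (x \<bullet> b) *\<^sub>R b) = x - (x \<bullet> b) *\<^sub>R b" if "x \<in> span B" for x
  proof -
    have "x - (x \<bullet> b) *\<^sub>R b = oproj (B - {b}) x"
      using oproj_remove[OF orthonormal_finite[OF oB] b, of x] oproj_span[OF oB that] by simp
    then show ?thesis using oproj_span[OF oA oproj_in_span] by simp
  qed
  then have "region_chart B S b s y r (\<lambda>x. \<gamma> (oproj (B - {b}) x)) grad"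
    using b s r g iff by (simp add: region_chart_def)
  then show ?thesis by blast
qed

end

text \<open>
  A chart in which \<open>S\<close> is the region above a graph; inside the ball \<open>bd\<close> is the graph itself.  The vector \<open>nrm\<close> points
  out of \<open>S\<close> and its length is the area density of the graph.
\<close>

locale domain_chart = slice_domain +
  fixes b :: octonion and s :: real and y :: octonion and r :: real
    and \<gamma> :: "octonion \<Rightarrow> real" and grad :: "octonion \<Rightarrow> octonion"
  assumes rc: "region_chart B S b s y r \<gamma> grad"

sublocale domain_chart \<subseteq> chart p \<eta> B bd b s y r \<gamma> grad
  using setting region_chart_graph[OF rc] by (simp add: chart_def chart_axioms_def)

context domain_chart
begin

lemma S_iff: "x \<in> span B \<Longrightarrow> x \<in> ball y r \<Longrightarrow> x \<in> S \<longleftrightarrow> \<gamma> (x - (x \<bullet> b) *\<^sub>R b) < s * (x \<bullet> b)"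
  using rc by (auto simp: region_chart_def)

lemmas clS_iff = region_closure[OF rc]

definition nrm :: "octonion \<Rightarrow> octonion" where "nrm x = grad x - s *\<^sub>R b"

lemma nrm_span: "nrm x \<in> span B"
  unfolding nrm_def using gsp spA b by (intro span_diff span_scale) (auto intro: span_base)

lemma norm_nrm: "norm (nrm x) = weight x" and nrm_b: "nrm x \<bullet> b = - s"
proof -
  have g: "grad x \<bullet> b = 0" by (rule perp[OF gsp])
  then show "nrm x \<bullet> b = - s" using nb by (simp add: nrm_def inner_diff_left)
  have "(norm (nrm x))\<^sup>2 = 1 + (norm (grad x))\<^sup>2"
    using g nb s2 by (simp add: nrm_def power2_norm_eq_inner inner_diff_left inner_diff_right inner_commute)
  then show "norm (nrm x) = weight x" by (simp add: weight_def real_sqrt_unique)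
qed

lemma weight_pos: "0 < weight x" by (simp add: weight_def add_pos_nonneg)

lemma grad_oproj: "grad x \<bullet> oproj A v = grad x \<bullet> v"
  using inner_span[OF oA gsp, of x "oproj A v"] inner_span[OF oA gsp, of x v] by (simp add: oproj_inner[OF oA])

lemma normal_side_derivative:
  assumes y0: "y0 \<in> bd" "y0 \<in> ball y r" and v: "v \<in> span B"
  shows "((\<lambda>t. \<gamma> (oproj A (y0 + t *\<^sub>R v)) - s * ((y0 + t *\<^sub>R v) \<bullet> b)) has_real_derivative nrm (oproj A y0) \<bullet> v) (at 0)"
proof -
  have d: "((\<lambda>t. oproj A (y0 + t *\<^sub>R v)) has_vector_derivative oproj A v) (at 0)"
    by (rule bounded_linear.has_vector_derivative[OF bounded_linear_oproj]) (auto intro!: derivative_eq_intros)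
  have "((\<lambda>t. \<gamma> (oproj A (y0 + t *\<^sub>R v))) has_vector_derivative grad (oproj A y0) \<bullet> oproj A v) (at 0)"
    by (rule has_vector_derivative_along_curve[OF _ d oproj_in_span]) (use dg[OF oproj_in_span, of y0] in simp)
  then have "((\<lambda>t. \<gamma> (oproj A (y0 + t *\<^sub>R v))) has_real_derivative grad (oproj A y0) \<bullet> v) (at 0)"
    by (simp add: has_real_derivative_iff_has_vector_derivative grad_oproj)
  then show ?thesis
    unfolding nrm_def inner_add_left inner_diff_left
    by (auto intro!: derivative_eq_intros simp: inner_commute)
qed

text \<open>
  Let \<open>F z = \<gamma> (oproj A z) - s (z \<bullet> b)\<close>; its gradient at \<open>y0\<close> is \<open>nrm\<close>.  Since \<open>F\<close> vanishes along curves in the boundary,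
  \<open>nrm\<close> is orthogonal to all tangent vectors, and since \<open>F\<close> grows in the direction of \<open>nrm\<close>, this direction leads out of \<open>S\<close>.
  Conversely the coordinate curves of the graph provide enough tangent vectors to determine a normal up to a factor,
  and its sign is fixed by the exterior side.
\<close>

lemma exterior_normal_eq:
  assumes y0: "y0 \<in> bd" "y0 \<in> ball y r"
  shows "exterior_normal B S y0 = (1 / weight (oproj A y0)) *\<^sub>R nrm (oproj A y0)"
proof -
  define x0 where "x0 = oproj A y0"
  have x0A: "x0 \<in> span A" unfolding x0_def by (rule oproj_in_span)
  have y0B: "y0 \<in> span B" using y0 bd_span by auto
  have y0\<Gamma>: "\<Gamma> x0 = y0" unfolding x0_def by (rule M_is_\<Gamma>[OF y0])
  define \<nu> where "\<nu> = (1 / weight x0) *\<^sub>R nrm x0"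
  have \<nu>B: "\<nu> \<in> span B" unfolding \<nu>_def by (intro span_scale nrm_span)
  have \<nu>1: "norm \<nu> = 1" using weight_pos[of x0] by (simp add: \<nu>_def norm_nrm)
  have N\<nu>: "nrm x0 \<bullet> \<nu> = weight x0"
    using weight_pos[of x0] by (simp add: \<nu>_def power2_norm_eq_inner[symmetric] norm_nrm power2_eq_square)
  have tang0: "\<nu> \<bullet> v = 0" if tv: "tangent_vector bd y0 v" for v
  proof -
    obtain c where c: "\<And>t. c t \<in> bd" "c 0 = y0" "(c has_vector_derivative v) (at 0)"
      using tv unfolding tangent_vector_def by blast
    have d: "((\<lambda>t. oproj A (c t)) has_vector_derivative oproj A v) (at 0)"
      by (rule bounded_linear.has_vector_derivative[OF bounded_linear_oproj c(3)])
    have "((\<lambda>t. \<gamma> (oproj A (c t))) has_vector_derivative grad x0 \<bullet> oproj A v) (at 0)"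
      by (rule has_vector_derivative_along_curve[OF _ d oproj_in_span]) (use dg[OF oproj_in_span, of y0] c(2) in \<open>simp add: x0_def\<close>)
    moreover have d2: "((\<lambda>t. s * (c t \<bullet> b)) has_vector_derivative s * (v \<bullet> b)) (at 0)"
      using bounded_linear.has_vector_derivative[OF bounded_linear_compose[OF bounded_linear_mult_right bounded_linear_inner_left] c(3), of s b] .
    moreover have "\<forall>\<^sub>F t in nhds 0. s * (c t \<bullet> b) = \<gamma> (oproj A (c t))"
    proof -
      have "(c \<longlongrightarrow> c 0) (at 0)" using has_vector_derivative_continuous[OF c(3)] by (simp add: continuous_within)
      then have "\<forall>\<^sub>F t in at 0. c t \<in> ball y r" using y0(2) c(2) by (intro topological_tendstoD) auto
      then have "\<forall>\<^sub>F t in nhds 0. c t \<in> ball y r" unfolding eventually_at_filter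
        by eventually_elim (use y0(2) c(2) in auto)
      then show ?thesis
      proof eventually_elim
        fix t assume t: "c t \<in> ball y r"
        have cB: "c t \<in> span B" using c(1) bd_span by blast
        show "s * (c t \<bullet> b) = \<gamma> (oproj A (c t))" using M_iff[OF cB t] c(1) oproj_A[OF cB] by simp
      qed
    qed
    ultimately have "((\<lambda>t. \<gamma> (oproj A (c t))) has_vector_derivative s * (v \<bullet> b)) (at 0)"
      by (subst (asm) has_vector_derivative_cong_ev[where g = "\<lambda>t. \<gamma> (oproj A (c t))"])
         (auto dest: eventually_nhds_x_imp_x elim: eventually_mono)
    then have "grad x0 \<bullet> oproj A v = s * (v \<bullet> b)"
      using \<open>((\<lambda>t. \<gamma> (oproj A (c t))) has_vector_derivative grad x0 \<bullet> oproj A v) (at 0)\<close>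
      by (metis vector_derivative_unique_at)
    then show ?thesis by (simp add: \<nu>_def nrm_def inner_diff_left inner_diff_right grad_oproj inner_commute)
  qed
  have near: "\<exists>\<delta>>0. \<forall>t. \<bar>t\<bar> < \<delta> \<longrightarrow> y0 + t *\<^sub>R \<nu> \<in> ball y r"
  proof -
    obtain d where d: "d > 0" "ball y0 d \<subseteq> ball y r" using y0(2) openE[OF open_ball] by metis
    have "y0 + t *\<^sub>R \<nu> \<in> ball y0 d" if "\<bar>t\<bar> < d" for t using that \<nu>1 by (simp add: dist_norm)
    then show ?thesis using d by blast
  qed
  then obtain \<delta> where \<delta>: "\<delta> > 0" "\<And>t. \<bar>t\<bar> < \<delta> \<Longrightarrow> y0 + t *\<^sub>R \<nu> \<in> ball y r" by blast
  have sides: "\<exists>\<epsilon>>0. \<forall>t. 0 < t \<and> t < \<epsilon> \<longrightarrow> y0 + t *\<^sub>R \<nu> \<notin> closure S \<and> y0 - t *\<^sub>R \<nu> \<in> S"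
  proof -
    let ?F = "\<lambda>t. \<gamma> (oproj A (y0 + t *\<^sub>R \<nu>)) - s * ((y0 + t *\<^sub>R \<nu>) \<bullet> b)"
    have F0: "?F 0 = 0" using y0 M_iff[OF y0B y0(2)] oproj_A[OF y0B] by simp
    have dF: "(?F has_real_derivative weight x0) (at 0)"
      using normal_side_derivative[OF y0 \<nu>B] N\<nu> by (simp add: x0_def)
    obtain d1 where d1: "d1 > 0" "\<And>h. 0 < h \<Longrightarrow> h < d1 \<Longrightarrow> ?F 0 < ?F (0 + h)"
      using has_real_derivative_pos_inc_right[OF dF weight_pos] by auto
    obtain d2 where d2: "d2 > 0" "\<And>h. 0 < h \<Longrightarrow> h < d2 \<Longrightarrow> ?F (0 - h) < ?F 0"
      using has_real_derivative_pos_inc_left[OF dF weight_pos] by auto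
    have sp: "y0 + t *\<^sub>R \<nu> \<in> span B" for t using y0B \<nu>B by (intro span_add span_scale)
    show ?thesis
    proof (intro exI[of _ "min \<delta> (min d1 d2)"] conjI allI impI)
      fix t assume t: "0 < t \<and> t < min \<delta> (min d1 d2)"
      have "0 < ?F t" using d1(2)[of t] t F0 by simp
      then show "y0 + t *\<^sub>R \<nu> \<notin> closure S"
        using clS_iff[OF sp \<delta>(2), of t] t oproj_A[OF sp[of t]] by simp
      have "?F (- t) < 0" using d2(2)[of t] t F0 by simp
      then have "y0 + (- t) *\<^sub>R \<nu> \<in> S"
        using S_iff[OF sp \<delta>(2), of "- t"] t oproj_A[OF sp[of "- t"]] by simp
      then show "y0 - t *\<^sub>R \<nu> \<in> S" by simp
    qed (use \<delta> d1 d2 in auto)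
  qed
  show ?thesis
    unfolding exterior_normal_def boundary_in_eq closure_in_eq x0_def[symmetric] \<nu>_def[symmetric]
  proof (rule the_equality)
    show "\<nu> \<in> span B \<and> norm \<nu> = 1 \<and> (\<forall>v. tangent_vector bd y0 v \<longrightarrow> \<nu> \<bullet> v = 0) \<and>
      (\<exists>\<epsilon>>0. \<forall>t. 0 < t \<and> t < \<epsilon> \<longrightarrow> y0 + t *\<^sub>R \<nu> \<notin> closure S \<and> y0 - t *\<^sub>R \<nu> \<in> S)"
      using \<nu>B \<nu>1 tang0 sides by blast
  next
    fix \<nu>' assume "\<nu>' \<in> span B \<and> norm \<nu>' = 1 \<and> (\<forall>v. tangent_vector bd y0 v \<longrightarrow> \<nu>' \<bullet> v = 0) \<and>
      (\<exists>\<epsilon>>0. \<forall>t. 0 < t \<and> t < \<epsilon> \<longrightarrow> y0 + t *\<^sub>R \<nu>' \<notin> closure S \<and> y0 - t *\<^sub>R \<nu>' \<in> S)"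
    then obtain \<epsilon>' where n: "\<nu>' \<in> span B" "norm \<nu>' = 1" "\<And>v. tangent_vector bd y0 v \<Longrightarrow> \<nu>' \<bullet> v = 0"
      and \<epsilon>': "\<epsilon>' > 0" "\<And>t. 0 < t \<Longrightarrow> t < \<epsilon>' \<Longrightarrow> y0 + t *\<^sub>R \<nu>' \<notin> closure S \<and> y0 - t *\<^sub>R \<nu>' \<in> S" by blast
    define \<beta> where "\<beta> = \<nu>' \<bullet> b"
    \<comment> \<open>a coordinate curve of the graph may leave the chart, hence the cut-off to the constant \<open>y0\<close>\<close>
    have tang: "tangent_vector bd y0 (a + (s * (grad x0 \<bullet> a)) *\<^sub>R b)" if a: "a \<in> A" for a
    proof -
      define c0 where "c0 t = \<Gamma> (x0 + t *\<^sub>R a)" for t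
      have c00: "c0 0 = y0" by (simp add: c0_def y0\<Gamma>)
      have sp: "x0 + t *\<^sub>R a \<in> span A" for t using x0A a by (intro span_add span_scale) (auto intro: span_base)
      have d: "((\<lambda>t. x0 + t *\<^sub>R a) has_vector_derivative a) (at 0)" by (auto intro!: derivative_eq_intros)
      have "((\<lambda>t. \<gamma> (x0 + t *\<^sub>R a)) has_vector_derivative grad x0 \<bullet> a) (at 0)"
        by (rule has_vector_derivative_along_curve[OF _ d sp]) (use dg[OF x0A] in simp)
      then have dc0: "(c0 has_vector_derivative a + (s * (grad x0 \<bullet> a)) *\<^sub>R b) (at 0)"
        unfolding c0_def graph_map_def using d
        by (auto intro!: derivative_eq_intros simp: has_real_derivative_iff_has_vector_derivative)
      have "(c0 \<longlongrightarrow> c0 0) (at 0)" using has_vector_derivative_continuous[OF dc0] by (simp add: continuous_within)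
      then have "\<forall>\<^sub>F t in at 0. c0 t \<in> ball y r" using y0(2) c00 by (intro topological_tendstoD) auto
      then have ev: "\<forall>\<^sub>F t in nhds 0. c0 t \<in> ball y r" unfolding eventually_at_filter
        by eventually_elim (use y0(2) c00 in auto)
      define c where "c t = (if c0 t \<in> ball y r then c0 t else y0)" for t
      have "\<forall>\<^sub>F t in nhds 0. c0 t = c t" using ev by eventually_elim (simp add: c_def)
      then have "(c has_vector_derivative a + (s * (grad x0 \<bullet> a)) *\<^sub>R b) (at 0)"
        using dc0 by (subst (asm) has_vector_derivative_cong_ev[where g = c])
          (auto dest: eventually_nhds_x_imp_x elim: eventually_mono)
      moreover have "c 0 = y0" by (simp add: c_def c0_def y0\<Gamma>)
      moreover have "c t \<in> bd" for t
        using \<Gamma>_in_M[OF sp[of t]] y0(1) by (simp add: c_def c0_def del: mem_ball)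
      ultimately show ?thesis unfolding tangent_vector_def by blast
    qed
    have "\<nu>' \<bullet> a = ((- s * \<beta>) *\<^sub>R nrm x0) \<bullet> a" if "a \<in> B" for a
    proof (cases "a = b")
      case True
      have "((- s * \<beta>) *\<^sub>R nrm x0) \<bullet> a = (s * s) * \<beta>" unfolding True inner_scaleR_left nrm_b by simp
      then show ?thesis using True s2(1) by (simp add: \<beta>_def)
    next
      case False
      then have aA: "a \<in> A" using that by auto
      have "b \<bullet> a = 0" using orthonormal_inner[OF oB b that] False by simp
      moreover have "\<nu>' \<bullet> a + s * (grad x0 \<bullet> a) * \<beta> = 0" using n(3)[OF tang[OF aA]] by (simp add: inner_add_right \<beta>_def)
      ultimately show ?thesis by (simp add: nrm_def inner_diff_left algebra_simps)
    qed
    then have "oproj B \<nu>' = oproj B ((- s * \<beta>) *\<^sub>R nrm x0)" by (simp add: oproj_def)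
    then have \<nu>'eq: "\<nu>' = (- s * \<beta>) *\<^sub>R nrm x0"
      using oproj_span[OF oB n(1)] oproj_span[OF oB span_scale[OF nrm_span]] by metis
    then have "\<bar>- s * \<beta>\<bar> * weight x0 = 1" using n(2) norm_nrm by simp
    then have "\<bar>- s * \<beta>\<bar> = 1 / weight x0" using weight_pos[of x0] by (simp add: field_simps)
    then have "- s * \<beta> = 1 / weight x0 \<or> - s * \<beta> = - (1 / weight x0)" by linarith
    then have "\<nu>' = \<nu> \<or> \<nu>' = - \<nu>"
    proof
      assume k: "- s * \<beta> = 1 / weight x0"
      show ?thesis unfolding \<nu>'eq k \<nu>_def by simp
    next
      assume k: "- s * \<beta> = - (1 / weight x0)"
      show ?thesis unfolding \<nu>'eq k \<nu>_def by simp
    qed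
    moreover have "\<nu>' \<noteq> - \<nu>"
    proof
      assume eq: "\<nu>' = - \<nu>"
      obtain \<epsilon> where \<epsilon>: "\<epsilon> > 0" "\<And>t. 0 < t \<Longrightarrow> t < \<epsilon> \<Longrightarrow> y0 + t *\<^sub>R \<nu> \<notin> closure S \<and> y0 - t *\<^sub>R \<nu> \<in> S" using sides by blast
      define t where "t = min \<epsilon> \<epsilon>' / 2"
      have t: "0 < t" "t < \<epsilon>" "t < \<epsilon>'" using \<epsilon>(1) \<epsilon>'(1) by (auto simp: t_def)
      have "y0 + t *\<^sub>R \<nu>' = y0 - t *\<^sub>R \<nu>" by (simp add: eq)
      then show False using \<epsilon>(2)[OF t(1,2)] \<epsilon>'(2)[OF t(1,3)] closure_subset by auto
    qed
    ultimately show "\<nu>' = \<nu>" by blast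
  qed
qed

end

context slice_domain
begin

lemma normal_at:
  assumes "y0 \<in> bd"
  shows "continuous (at y0 within bd) (exterior_normal B S)" "norm (exterior_normal B S y0) = 1"
    "exterior_normal B S y0 \<in> span B"
proof -
  have "y0 \<in> closure S" using assms by (simp add: bd_def)
  then obtain b s r \<gamma> grad where rc: "region_chart B S b s y0 r \<gamma> grad" using region_chart_exists by blast
  interpret domain_chart p \<eta> B S b s y0 r \<gamma> grad by unfold_locales (rule rc)
  have y0b: "y0 \<in> ball y0 r" using r by simp
  have "continuous_on (bd \<inter> ball y0 r) (\<lambda>x. (1 / weight (oproj A x)) *\<^sub>R nrm (oproj A x))"
    unfolding weight_def nrm_def
    by (intro continuous_intros cgr') (metis add_pos_nonneg less_irrefl real_sqrt_eq_zero_cancel_iff zero_le_power2 zero_less_one)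
  then have "continuous_on (bd \<inter> ball y0 r) (exterior_normal B S)"
    by (rule continuous_on_eq) (auto simp: exterior_normal_eq)
  then have "continuous (at y0 within bd \<inter> ball y0 r) (exterior_normal B S)"
    using assms y0b by (simp add: continuous_on_eq_continuous_within)
  moreover have "at y0 within bd \<inter> ball y0 r = at y0 within bd"
    by (rule at_within_nhd[of _ "ball y0 r"]) (use y0b in auto)
  ultimately show "continuous (at y0 within bd) (exterior_normal B S)" by simp
  show "norm (exterior_normal B S y0) = 1" "exterior_normal B S y0 \<in> span B"
    using weight_pos[of "oproj A y0"] by (simp_all add: exterior_normal_eq[OF assms y0b] norm_nrm span_scale nrm_span)
qed

lemma continuous_normal: "continuous_on bd (exterior_normal B S)"
  using normal_at(1) by (simp add: continuous_on_eq_continuous_within)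

lemma atlas_exists: "\<exists>I. slice_atlas p \<eta> B bd I"
proof -
  have "compact bd" using closed_bd bdS 
    by (auto simp: compact_eq_bounded_closed bd_def intro: bounded_subset[OF bounded_closure])
  define C where "C = {i. slice_setting.is_chart B bd i}"
  have "bd \<subseteq> (\<Union>i\<in>C. chart_dom i)"
  proof
    fix y assume "y \<in> bd"
    then have "y \<in> closure S" by (simp add: bd_def)
    then obtain b s r \<gamma> grad where rc: "region_chart B S b s y r \<gamma> grad" using region_chart_exists by blast
    then have "0 < r" by (simp add: region_chart_def)
    moreover have "(b, s, y, r, \<gamma>, grad) \<in> C"
      using region_chart_graph[OF rc] slice_setting.is_chart_def[OF setting] by (simp add: C_def)
    ultimately show "y \<in> (\<Union>i\<in>C. chart_dom i)" by (intro UN_I) (auto simp: chart_dom_def)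
  qed
  then obtain I where "I \<subseteq> C" "finite I" "bd \<subseteq> (\<Union>i\<in>I. chart_dom i)"
    using compactE_image[OF \<open>compact bd\<close>, of C chart_dom] by (auto simp: chart_dom_def)
  then have "slice_atlas p \<eta> B bd I"
    using setting by (auto simp: slice_atlas_def slice_atlas_axioms_def C_def)
  then show ?thesis by blast
qed

lemma surface_facts: "slice_setting.is_surface_measure p bd (surface_measure p bd)" "finite_measure (surface_measure p bd)"
proof -
  obtain I where "slice_atlas p \<eta> B bd I" using atlas_exists by blast
  then interpret slice_atlas p \<eta> B bd I .
  show "slice_setting.is_surface_measure p bd (surface_measure p bd)" by (rule surface_measure_is)
  show "finite_measure (surface_measure p bd)" by (rule finite_surface_measure)
qed

end

section \<open>The divergence theorem in the slice\<close>

context domain_chart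
begin

text \<open>
  \<open>retr\<close> retracts the whole space onto the closed region \<open>Wc\<close> above the graph, by projecting to the slice space and
  lifting what lies below the graph up to it.
\<close>

definition "Wc = {x \<in> span B. \<gamma> (x - (x \<bullet> b) *\<^sub>R b) \<le> s * (x \<bullet> b)}"
definition "retr x = oproj A x + (s * max (s * (x \<bullet> b)) (\<gamma> (oproj A x))) *\<^sub>R b"

lemma retr_Wc: "retr x \<in> Wc"
proof -
  have x': "oproj A x \<in> span A" by (rule oproj_in_span)
  have 1: "retr x \<bullet> b = s * max (s * (x \<bullet> b)) (\<gamma> (oproj A x))"
    using perp[OF x'] nb by (simp add: retr_def inner_add_left)
  then have "retr x - (retr x \<bullet> b) *\<^sub>R b = oproj A x" by (simp add: retr_def)
  moreover have "retr x \<in> span B" unfolding retr_def using x' spA b by (intro span_add span_scale) (auto intro: span_base)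
  ultimately show ?thesis using 1 by (simp add: Wc_def s2(2))
qed

lemma retr_id: "x \<in> Wc \<Longrightarrow> retr x = x"
  using oproj_A[of x] s2 by (simp add: Wc_def retr_def max_absorb1)

lemma continuous_retr: "continuous_on UNIV retr"
  unfolding retr_def[abs_def] by (intro continuous_intros c\<gamma>')

lemma Wc_closure: "x \<in> ball y r \<Longrightarrow> x \<in> Wc \<longleftrightarrow> x \<in> closure S"
  using clS_iff[of x] clS_span by (auto simp: Wc_def)

text \<open>
  A function on the closure of \<open>S\<close> that vanishes off a smaller ball extends by zero to \<open>Wc\<close>, and then through the
  retraction to the whole space; this yields the globally continuous data that \<open>divergence_epigraph_extended\<close> asks for.
\<close>

lemma continuous_cutoff:
  fixes k :: "octonion \<Rightarrow> 'c::real_normed_vector"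
  assumes k: "continuous_on (closure S) k" and \<rho>: "\<rho> < r"
    and supp: "\<And>x. x \<in> closure S \<Longrightarrow> x \<notin> cball y \<rho> \<Longrightarrow> k x = 0"
  shows "continuous_on UNIV (\<lambda>x. if retr x \<in> ball y r then k (retr x) else 0)"
proof -
  have U: "Wc = (Wc \<inter> ball y r) \<union> (Wc - cball y \<rho>)" using \<rho> by auto
  have "continuous_on ((Wc \<inter> ball y r) \<union> (Wc - cball y \<rho>)) (\<lambda>x. if x \<in> ball y r then k x else 0)"
  proof (rule continuous_on_cases_local_open)
    show "openin (top_of_set (Wc \<inter> ball y r \<union> (Wc - cball y \<rho>))) (Wc \<inter> ball y r)"
      unfolding U[symmetric] by (simp add: openin_open_Int)
    show "openin (top_of_set (Wc \<inter> ball y r \<union> (Wc - cball y \<rho>))) (Wc - cball y \<rho>)"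
    proof -
      have "openin (top_of_set Wc) (Wc \<inter> - cball y \<rho>)" by (intro openin_open_Int) auto
      then show ?thesis unfolding U[symmetric] by (simp add: Diff_eq)
    qed
    show "continuous_on (Wc \<inter> ball y r) k" by (rule continuous_on_subset[OF k]) (use Wc_closure in auto)
    fix x assume "x \<in> Wc \<inter> ball y r \<and> x \<notin> ball y r \<or> x \<in> Wc - cball y \<rho> \<and> x \<in> ball y r"
    then show "k x = 0" using supp[of x] Wc_closure[of x] by auto
  qed simp
  then have "continuous_on Wc (\<lambda>x. if x \<in> ball y r then k x else 0)" using U by simp
  from continuous_on_compose2[OF this continuous_retr] show ?thesis using retr_Wc by auto
qed

text \<open>
  Inside the ball the region above the graph and \<open>S\<close> agree, and outside both integrands vanish.  The weighted normal
  \<open>grad \<gamma> - s b\<close> over the plane becomes the unit normal over the surface, since its length is the area density.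
\<close>

lemma divergence_local:
  fixes g :: "octonion \<Rightarrow> 'c::euclidean_space" and D :: "octonion \<Rightarrow> octonion \<Rightarrow> 'c"
  assumes cg: "continuous_on (closure S) g" and cD: "\<And>c. c \<in> B \<Longrightarrow> continuous_on (closure S) (D c)"
    and der: "\<And>x c. x \<in> S \<Longrightarrow> c \<in> B \<Longrightarrow> ((\<lambda>t. g (x + t *\<^sub>R c)) has_vector_derivative D c x) (at 0)"
    and \<rho>: "\<rho> < r" and suppg: "\<And>x. x \<in> closure S \<Longrightarrow> x \<notin> cball y \<rho> \<Longrightarrow> g x = 0"
    and suppD: "\<And>x c. c \<in> B \<Longrightarrow> x \<in> closure S \<Longrightarrow> x \<notin> cball y \<rho> \<Longrightarrow> D c x = 0"
    and c: "c \<in> B"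
  shows "(\<integral>x. indicator S x *\<^sub>R D c x \<partial>vol B) = (\<integral>x. (exterior_normal B S x \<bullet> c) *\<^sub>R g x \<partial>surface_measure p bd)"
proof -
  define G where "G x = (if retr x \<in> ball y r then g (retr x) else 0)" for x
  define DG where "DG a x = (if retr x \<in> ball y r then D a (retr x) else 0)" for a x
  define W where "W = {x \<in> span B. \<gamma> (x - (x \<bullet> b) *\<^sub>R b) < s * (x \<bullet> b)}"
  have WWc: "W \<subseteq> Wc" by (auto simp: W_def Wc_def)
  have WS: "x \<in> W \<longleftrightarrow> x \<in> S" if "x \<in> ball y r" for x using S_iff[OF _ that] S_span by (auto simp: W_def)
  have Gc: "G x = (if x \<in> ball y r then g x else 0)" "DG a x = (if x \<in> ball y r then D a x else 0)" if "x \<in> Wc" for x a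
    using retr_id[OF that] by (simp_all add: G_def DG_def)
  have contG: "continuous_on UNIV G" unfolding G_def by (rule continuous_cutoff[OF cg \<rho> suppg])
  have opW: "openin (top_of_set (span B)) W"
  proof -
    have 1: "continuous_on UNIV (\<lambda>z. \<gamma> (z - (z \<bullet> b) *\<^sub>R b))" by (intro c\<gamma>' continuous_intros)
    have 2: "continuous_on UNIV (\<lambda>z. s * (z \<bullet> b))" by (intro continuous_intros)
    have "open {z. \<gamma> (z - (z \<bullet> b) *\<^sub>R b) < s * (z \<bullet> b)}" by (rule open_Collect_less[OF 1 2])
    moreover have "W = span B \<inter> {z. \<gamma> (z - (z \<bullet> b) *\<^sub>R b) < s * (z \<bullet> b)}" by (auto simp: W_def)
    ultimately show ?thesis by (simp add: openin_open_Int)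
  qed
  have derG: "((\<lambda>t. G (x + t *\<^sub>R a)) has_vector_derivative DG a x) (at 0)" if x: "x \<in> W" and a: "a \<in> B" for x a
  proof -
    have lim: "((\<lambda>t. x + t *\<^sub>R a) \<longlongrightarrow> x) (nhds 0)"
    proof -
      have "continuous_on UNIV (\<lambda>t. x + t *\<^sub>R a)" by (intro continuous_intros)
      then have "isCont (\<lambda>t. x + t *\<^sub>R a) 0" by (simp add: continuous_on_eq_continuous_at)
      then show ?thesis by (simp add: isCont_def tendsto_nhds_iff)
    qed
    obtain T where T: "open T" "W = span B \<inter> T" using opW by (auto simp: openin_open)
    have "\<forall>\<^sub>F t in nhds 0. x + t *\<^sub>R a \<in> T" using lim by (rule topological_tendstoD) (use T x in auto)
    moreover have sp: "x + t *\<^sub>R a \<in> span B" for t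
      using x a by (intro span_add span_scale) (auto simp: W_def intro: span_base)
    ultimately have inW: "\<forall>\<^sub>F t in nhds 0. x + t *\<^sub>R a \<in> W" by (auto simp: T(2))
    show ?thesis
    proof (cases "x \<in> ball y r")
      case True
      have "\<forall>\<^sub>F t in nhds 0. x + t *\<^sub>R a \<in> ball y r" using lim by (rule topological_tendstoD) (use True in auto)
      with inW have ev: "\<forall>\<^sub>F t in nhds 0. g (x + t *\<^sub>R a) = G (x + t *\<^sub>R a)"
      proof eventually_elim
        fix t assume "x + t *\<^sub>R a \<in> W" "x + t *\<^sub>R a \<in> ball y r"
        then show "g (x + t *\<^sub>R a) = G (x + t *\<^sub>R a)" using Gc(1)[of "x + t *\<^sub>R a"] WWc by auto
      qed
      have "((\<lambda>t. g (x + t *\<^sub>R a)) has_vector_derivative D a x) (at 0)" using der WS[OF True] x a by auto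
      moreover have "DG a x = D a x" using Gc(2)[of x a] True x WWc by auto
      ultimately show ?thesis
        by (subst (asm) has_vector_derivative_cong_ev[where g = "\<lambda>t. G (x + t *\<^sub>R a)"])
           (use ev in \<open>auto dest: eventually_nhds_x_imp_x elim: eventually_mono\<close>)
    next
      case False
      then have "x \<in> - cball y \<rho>" using \<rho> by auto
      with lim have "\<forall>\<^sub>F t in nhds 0. x + t *\<^sub>R a \<in> - cball y \<rho>" by (intro topological_tendstoD) auto
      with inW have ev: "\<forall>\<^sub>F t in nhds 0. 0 = G (x + t *\<^sub>R a)"
      proof eventually_elim
        fix t assume t: "x + t *\<^sub>R a \<in> W" "x + t *\<^sub>R a \<in> - cball y \<rho>"
        show "0 = G (x + t *\<^sub>R a)"
        proof (cases "x + t *\<^sub>R a \<in> ball y r")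
          case True
          then have "x + t *\<^sub>R a \<in> closure S" using t WWc Wc_closure by auto
          then show ?thesis using t WWc Gc(1)[of "x + t *\<^sub>R a"] suppg[of "x + t *\<^sub>R a"] by auto
        next
          case False
          then show ?thesis using t WWc Gc(1)[of "x + t *\<^sub>R a"] by auto
        qed
      qed
      have "((\<lambda>t::real. 0) has_vector_derivative 0) (at 0)" by simp
      moreover have "DG a x = 0" using Gc(2)[of x a] False x WWc by auto
      ultimately show ?thesis
        by (subst (asm) has_vector_derivative_cong_ev[where g = "\<lambda>t. G (x + t *\<^sub>R a)"])
           (use ev in \<open>auto dest: eventually_nhds_x_imp_x elim: eventually_mono\<close>)
    qed
  qed
  have far: "x \<notin> ball y r" if "norm y + r \<le> norm x" for x
    using that norm_triangle_ineq[of y "x - y"] by (auto simp: dist_norm norm_minus_commute)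
  have "(\<integral>x. indicator W x *\<^sub>R DG c x \<partial>vol B) =
         (\<integral>x. ((grad x - s *\<^sub>R b) \<bullet> c) *\<^sub>R G (x + (s * \<gamma> x) *\<^sub>R b) \<partial>vol A)"
    unfolding W_def
  proof (rule divergence_epigraph_extended[OF oB b s C1\<gamma> contG _ _ _ _ c, where R = "norm y + r"], goal_cases)
    case (1 a)
    show ?case unfolding DG_def[abs_def] by (rule continuous_cutoff[OF cD[OF 1] \<rho> suppD[OF 1]])
  next
    case (2 x a) then show ?case by (intro derG) (auto simp: W_def)
  next
    case (3 x) then show ?case using Gc(1)[of x] far[of x] by (auto simp: Wc_def)
  next
    case (4 x a) then show ?case using Gc(2)[of x a] far[of x] by (auto simp: Wc_def)
  qed
  also have "\<dots> = (\<integral>x. (weight x * indicator (bd \<inter> ball y r) (\<Gamma> x)) *\<^sub>R (indicator bd (\<Gamma> x) *\<^sub>R ((exterior_normal B S (\<Gamma> x) \<bullet> c) *\<^sub>R g (\<Gamma> x))) \<partial>vol A)"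
  proof (rule integral_cong_AE)
    have "continuous_on UNIV (\<lambda>x. ((grad x - s *\<^sub>R b) \<bullet> c) *\<^sub>R G (x + (s * \<gamma> x) *\<^sub>R b))"
      by (intro continuous_intros cgr continuous_on_compose2[OF contG _ subset_UNIV] c\<gamma>)
    from borel_measurable_continuous_onI[OF this]
    show "(\<lambda>x. ((grad x - s *\<^sub>R b) \<bullet> c) *\<^sub>R G (x + (s * \<gamma> x) *\<^sub>R b)) \<in> borel_measurable (vol A)" by simp
    have mi: "(\<lambda>x. indicator (bd \<inter> ball y r) (\<Gamma> x) :: real) \<in> borel_measurable borel"
      by (rule measurable_compose[OF meas\<Gamma>], rule borel_measurable_indicator) (use M_borel in auto)
    have "continuous_on bd (\<lambda>x. (exterior_normal B S x \<bullet> c) *\<^sub>R g x)"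
      by (intro continuous_intros continuous_normal continuous_on_subset[OF cg]) (auto simp: bd_def)
    then have "(\<lambda>x. indicator bd x *\<^sub>R ((exterior_normal B S x \<bullet> c) *\<^sub>R g x)) \<in> borel_measurable borel"
      by (rule borel_measurable_continuous_on_indicator[OF M_borel])
    from borel_measurable_scaleR[OF borel_measurable_times[OF meas_weight mi] measurable_compose[OF meas\<Gamma> this]]
    show "(\<lambda>x. (weight x * indicator (bd \<inter> ball y r) (\<Gamma> x)) *\<^sub>R (indicator bd (\<Gamma> x) *\<^sub>R ((exterior_normal B S (\<Gamma> x) \<bullet> c) *\<^sub>R g (\<Gamma> x)))) \<in> borel_measurable (vol A)"
      by (simp del: scaleR_scaleR)
    show "AE x in vol A. ((grad x - s *\<^sub>R b) \<bullet> c) *\<^sub>R G (x + (s * \<gamma> x) *\<^sub>R b) =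
      (weight x * indicator (bd \<inter> ball y r) (\<Gamma> x)) *\<^sub>R (indicator bd (\<Gamma> x) *\<^sub>R ((exterior_normal B S (\<Gamma> x) \<bullet> c) *\<^sub>R g (\<Gamma> x)))"
      using AE_vol_span[OF finA]
    proof eventually_elim
      fix x assume x: "x \<in> span A"
      have \<Gamma>W: "\<Gamma> x \<in> Wc" using \<Gamma>_props[OF x] by (simp add: Wc_def s2(2))
      show "((grad x - s *\<^sub>R b) \<bullet> c) *\<^sub>R G (x + (s * \<gamma> x) *\<^sub>R b) =
        (weight x * indicator (bd \<inter> ball y r) (\<Gamma> x)) *\<^sub>R (indicator bd (\<Gamma> x) *\<^sub>R ((exterior_normal B S (\<Gamma> x) \<bullet> c) *\<^sub>R g (\<Gamma> x)))"
      proof (cases "\<Gamma> x \<in> ball y r")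
        case True
        have \<Gamma>b: "\<Gamma> x \<in> bd" by (rule \<Gamma>_in_M[OF x True])
        have "exterior_normal B S (\<Gamma> x) = (1 / weight x) *\<^sub>R nrm x"
          using exterior_normal_eq[OF \<Gamma>b True] \<Gamma>_props(3)[OF x] by simp
        moreover have "G (\<Gamma> x) = g (\<Gamma> x)" using Gc(1)[OF \<Gamma>W] True by simp
        ultimately show ?thesis using \<Gamma>b True weight_pos[of x]
          by (simp add: nrm_def graph_map_def[symmetric] del: mem_ball)
      next
        case False
        then have "G (\<Gamma> x) = 0" using Gc(1)[OF \<Gamma>W] by simp
        then show ?thesis using False by (simp add: graph_map_def[symmetric])
      qed
    qed
  qed
  also have "\<dots> = (\<integral>x. indicator (ball y r) x *\<^sub>R (indicator bd x *\<^sub>R ((exterior_normal B S x \<bullet> c) *\<^sub>R g x)) \<partial>surface_measure p bd)"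
  proof (rule surface_integral_chart[symmetric, OF surface_facts(1)])
    have "continuous_on bd (\<lambda>x. (exterior_normal B S x \<bullet> c) *\<^sub>R g x)"
      by (intro continuous_intros continuous_normal continuous_on_subset[OF cg]) (auto simp: bd_def)
    then show "(\<lambda>x. indicator bd x *\<^sub>R ((exterior_normal B S x \<bullet> c) *\<^sub>R g x)) \<in> borel_measurable borel"
      by (rule borel_measurable_continuous_on_indicator[OF M_borel])
  qed
  also have "\<dots> = (\<integral>x. (exterior_normal B S x \<bullet> c) *\<^sub>R g x \<partial>surface_measure p bd)"
  proof (rule Bochner_Integration.integral_cong[OF refl])
    fix x assume "x \<in> space (surface_measure p bd)"
    then have x: "x \<in> bd" using surface_facts(1) by (simp add: is_surface_measure_def)
    show "indicator (ball y r) x *\<^sub>R (indicator bd x *\<^sub>R ((exterior_normal B S x \<bullet> c) *\<^sub>R g x)) = (exterior_normal B S x \<bullet> c) *\<^sub>R g x"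
      using x suppg[of x] \<rho> by (cases "x \<in> ball y r") (auto simp: bd_def)
  qed
  also have "(\<integral>x. indicator W x *\<^sub>R DG c x \<partial>vol B) = (\<integral>x. indicator S x *\<^sub>R D c x \<partial>vol B)"
  proof (rule Bochner_Integration.integral_cong[OF refl])
    fix x
    show "indicator W x *\<^sub>R DG c x = indicator S x *\<^sub>R D c x"
    proof (cases "x \<in> ball y r")
      case True
      then show ?thesis using WS[OF True] Gc(2)[of x c] WWc by (auto simp: indicator_def)
    next
      case False
      have "D c x = 0" if "x \<in> S" using suppD[OF c, of x] that False \<rho> closure_subset by auto
      then show ?thesis using False Gc(2)[of x c] WWc by (auto simp: indicator_def)
    qed
  qed
  finally show ?thesis by simp
qed

end

text \<open>
  The square of the positive part is of class \<open>C\<^sup>1\<close>, the smoothness that the partition of unity must have.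
\<close>

definition bump :: "real \<Rightarrow> octonion \<Rightarrow> octonion \<Rightarrow> real" where
  "bump \<rho> y x = (max 0 (\<rho>\<^sup>2 - (norm (x - y))\<^sup>2))\<^sup>2"

definition bump_deriv :: "real \<Rightarrow> octonion \<Rightarrow> octonion \<Rightarrow> octonion \<Rightarrow> real" where
  "bump_deriv \<rho> y c x = - 4 * max 0 (\<rho>\<^sup>2 - (norm (x - y))\<^sup>2) * ((x - y) \<bullet> c)"

lemma max_square_deriv: "((\<lambda>u::real. (max 0 u)\<^sup>2) has_real_derivative 2 * max 0 u) (at u)"
proof -
  consider "u > 0" | "u < 0" | "u = 0" by linarith
  then show ?thesis
  proof cases
    case 1
    have "((\<lambda>u::real. u\<^sup>2) has_real_derivative 2 * u) (at u)" by (auto intro!: derivative_eq_intros)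
    moreover have "\<forall>\<^sub>F v in nhds u. v\<^sup>2 = (max 0 v)\<^sup>2"
      using eventually_nhds_in_open[of "{0<..}" u] 1 by (auto elim: eventually_mono)
    ultimately show ?thesis using 1 by (subst (asm) DERIV_cong_ev[OF refl _ refl]) auto
  next
    case 2
    have "((\<lambda>u::real. 0) has_real_derivative 0) (at u)" by simp
    moreover have "\<forall>\<^sub>F v in nhds u. 0 = (max 0 v)\<^sup>2"
      using eventually_nhds_in_open[of "{..<0}" u] 2 by (auto elim: eventually_mono)
    ultimately show ?thesis using 2 by (subst (asm) DERIV_cong_ev[OF refl _ refl]) auto
  next
    case 3
    have "((\<lambda>h. ((max 0 (0 + h))\<^sup>2 - (max 0 0)\<^sup>2) / h) \<longlongrightarrow> (0::real)) (at 0)"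
    proof (rule tendsto_sandwich[of "\<lambda>h. - \<bar>h\<bar>" _ _ "\<lambda>h. \<bar>h\<bar>"])
      have bnd: "- \<bar>h\<bar> \<le> ((max 0 (0 + h))\<^sup>2 - (max 0 0)\<^sup>2) / h" "((max 0 (0 + h))\<^sup>2 - (max 0 0)\<^sup>2) / h \<le> \<bar>h\<bar>" for h :: real
        by (cases "h > 0"; auto simp: max_def power2_eq_square)+
      show "\<forall>\<^sub>F h in at (0::real). - \<bar>h\<bar> \<le> ((max 0 (0 + h))\<^sup>2 - (max 0 0)\<^sup>2) / h"
        "\<forall>\<^sub>F h in at (0::real). ((max 0 (0 + h))\<^sup>2 - (max 0 0)\<^sup>2) / h \<le> \<bar>h\<bar>"
        by (intro always_eventually allI bnd)+
    qed (auto intro!: tendsto_eq_intros)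
    then show ?thesis using 3 by (simp add: DERIV_def)
  qed
qed

lemma bump_has_derivative:
  "((\<lambda>t. bump \<rho> y (x + t *\<^sub>R c)) has_real_derivative bump_deriv \<rho> y c x) (at 0)"
proof -
  have n: "(norm (x + t *\<^sub>R c - y))\<^sup>2 = (norm (x - y))\<^sup>2 + 2 * t * ((x - y) \<bullet> c) + t\<^sup>2 * (c \<bullet> c)" for t
    unfolding power2_norm_eq_inner
    by (simp add: inner_add_left inner_add_right inner_diff_left inner_diff_right inner_commute power2_eq_square algebra_simps)
  have 1: "((\<lambda>t. \<rho>\<^sup>2 - (norm (x + t *\<^sub>R c - y))\<^sup>2) has_real_derivative - 2 * ((x - y) \<bullet> c)) (at 0)"
    unfolding n by (auto intro!: derivative_eq_intros)
  show ?thesis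
    unfolding bump_def using DERIV_chain2[OF max_square_deriv 1] by (simp add: bump_deriv_def mult.assoc)
qed

lemma continuous_bump: "continuous_on X (bump \<rho> y)" "continuous_on X (bump_deriv \<rho> y c)"
  unfolding bump_def[abs_def] bump_deriv_def[abs_def] by (intro continuous_intros)+

lemma bump_nonneg: "0 \<le> bump \<rho> y x" by (simp add: bump_def)

lemma bump_pos: "x \<in> ball y \<rho> \<Longrightarrow> 0 < bump \<rho> y x"
proof -
  assume "x \<in> ball y \<rho>"
  then have "norm (x - y) < \<rho>" by (simp add: dist_norm norm_minus_commute)
  then have "(norm (x - y))\<^sup>2 < \<rho>\<^sup>2" by (intro power_strict_mono) auto
  then show ?thesis by (simp add: bump_def)
qed

lemma bump_zero: "0 < \<rho> \<Longrightarrow> x \<notin> cball y \<rho> \<Longrightarrow> bump \<rho> y x = 0" "0 < \<rho> \<Longrightarrow> x \<notin> cball y \<rho> \<Longrightarrow> bump_deriv \<rho> y c x = 0"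
proof -
  assume "0 < \<rho>" "x \<notin> cball y \<rho>"
  then have "\<rho>\<^sup>2 \<le> (norm (x - y))\<^sup>2" by (intro power_mono) (auto simp: dist_norm norm_minus_commute)
  then show "bump \<rho> y x = 0" "bump_deriv \<rho> y c x = 0" by (simp_all add: bump_def bump_deriv_def)
qed

context slice_domain
begin

lemma compact_closure_S: "compact (closure S)" using bdS by (simp add: compact_closure)

lemma bounded_on_closure:
  fixes k :: "octonion \<Rightarrow> 'c::real_normed_vector"
  assumes "continuous_on (closure S) k"
  shows "\<exists>C. \<forall>x\<in>closure S. norm (k x) \<le> C"
proof -
  have "compact (k ` closure S)" by (rule compact_continuous_image[OF assms compact_closure_S])
  then have "bounded (k ` closure S)" by (rule compact_imp_bounded)
  then show ?thesis by (auto simp: bounded_iff)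
qed

lemma S_borel[measurable]: "S \<in> sets borel"
proof -
  obtain T where "open T" "S = span B \<inter> T" using opS by (auto simp: openin_open)
  then show ?thesis by auto
qed

lemma integrable_on_S:
  fixes k :: "octonion \<Rightarrow> 'c::{banach, second_countable_topology}"
  assumes "continuous_on (closure S) k"
  shows "integrable (vol B) (\<lambda>x. indicator S x *\<^sub>R k x)"
proof -
  obtain C where C: "\<And>x. x \<in> closure S \<Longrightarrow> norm (k x) \<le> C" using bounded_on_closure[OF assms] by blast
  obtain R where R: "\<And>x. x \<in> S \<Longrightarrow> norm x \<le> R" using bdS by (auto simp: bounded_iff)
  show ?thesis
  proof (rule integrable_vol_bounded_support[OF oB, where R = R and C = "\<bar>C\<bar>"])
    show "(\<lambda>x. indicator S x *\<^sub>R k x) \<in> borel_measurable borel"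
      by (rule borel_measurable_continuous_on_indicator[OF S_borel continuous_on_subset[OF assms closure_subset]])
    show "norm (indicator S x *\<^sub>R k x) \<le> \<bar>C\<bar>" for x
      using C[of x] closure_subset[of S] by (auto simp: indicator_def)
    show "indicator S x *\<^sub>R k x = 0" if "R < norm x" for x
      using R[of x] that by (auto simp: indicator_def)
  qed
qed

lemma bd_borel[measurable]: "bd \<in> sets borel" using closed_bd by (rule borel_closed)

lemma space_surface: "space (surface_measure p bd) = bd"
  and sets_surface: "sets (surface_measure p bd) = sets (restrict_space borel bd)"
  using surface_facts(1) slice_setting.is_surface_measure_def[OF setting] by auto

lemma integrable_on_bd:
  fixes k :: "octonion \<Rightarrow> 'c::{banach, second_countable_topology}"
  assumes "continuous_on bd k"
  shows "integrable (surface_measure p bd) k"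
proof -
  interpret finite_measure "surface_measure p bd" by (rule surface_facts(2))
  have "compact bd"
    using closed_bd bounded_subset[OF bounded_closure[OF bdS], of bd] by (auto simp: compact_eq_bounded_closed bd_def)
  then have "bounded (k ` bd)" by (intro compact_imp_bounded compact_continuous_image assms)
  then obtain C where C: "\<And>x. x \<in> bd \<Longrightarrow> norm (k x) \<le> C" by (auto simp: bounded_iff)
  show ?thesis
  proof (rule integrable_const_bound[of _ C])
    show "AE x in surface_measure p bd. norm (k x) \<le> C" using C by (intro AE_I2) (simp add: space_surface)
    show "k \<in> borel_measurable (surface_measure p bd)"
      using borel_measurable_continuous_on_restrict[OF assms] measurable_cong_sets[OF sets_surface refl] by blast
  qed
qed

text \<open>
  Finitely many balls of half the chart radius cover the closure of \<open>S\<close>.  Normalised bumps \<open>\<theta> y\<close> on these balls sum to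
  \<open>1\<close> there and their derivatives \<open>\<theta>' y\<close> sum to \<open>0\<close>, so the local formulas for \<open>\<theta> y *\<^sub>R g\<close> add up to the one for \<open>g\<close>.
\<close>

theorem divergence_theorem:
  fixes g :: "octonion \<Rightarrow> 'c::euclidean_space" and D :: "octonion \<Rightarrow> octonion \<Rightarrow> 'c"
  assumes cg: "continuous_on (closure S) g" and cD: "\<And>c. c \<in> B \<Longrightarrow> continuous_on (closure S) (D c)"
    and der: "\<And>x c. x \<in> S \<Longrightarrow> c \<in> B \<Longrightarrow> ((\<lambda>t. g (x + t *\<^sub>R c)) has_vector_derivative D c x) (at 0)"
    and c: "c \<in> B"
  shows "(\<integral>x. indicator S x *\<^sub>R D c x \<partial>vol B) = (\<integral>x. (exterior_normal B S x \<bullet> c) *\<^sub>R g x \<partial>surface_measure p bd)"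
proof -
  have "\<exists>r. 0 < r \<and> (\<exists>b s \<gamma> grad. region_chart B S b s y r \<gamma> grad)" if yc: "y \<in> closure S" for y
  proof -
    obtain b s r \<gamma> grad where rc: "region_chart B S b s y r \<gamma> grad" using region_chart_exists[OF yc] by blast
    then have "0 < r" by (simp add: region_chart_def)
    then show ?thesis using rc by blast
  qed
  then obtain r where r: "\<And>y. y \<in> closure S \<Longrightarrow> 0 < r y"
    and rc: "\<And>y. y \<in> closure S \<Longrightarrow> \<exists>b s \<gamma> grad. region_chart B S b s y (r y) \<gamma> grad" by metis
  define \<rho> where "\<rho> y = r y / 2" for y
  have "closure S \<subseteq> (\<Union>y\<in>closure S. ball y (\<rho> y))" using r by (force simp: \<rho>_def)
  then obtain Y where Y: "Y \<subseteq> closure S" "finite Y" "closure S \<subseteq> (\<Union>y\<in>Y. ball y (\<rho> y))"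
    using compactE_image[OF compact_closure_S, of "closure S" "\<lambda>y. ball y (\<rho> y)"] by auto
  define \<Psi> where "\<Psi> x = (\<Sum>y\<in>Y. bump (\<rho> y) y x)" for x
  define \<Psi>' where "\<Psi>' a x = (\<Sum>y\<in>Y. bump_deriv (\<rho> y) y a x)" for a x
  have \<Psi>pos: "0 < \<Psi> x" if x: "x \<in> closure S" for x
  proof -
    obtain y where "y \<in> Y" "x \<in> ball y (\<rho> y)" using Y x by blast
    then show ?thesis unfolding \<Psi>_def using Y(2)
      by (intro sum_pos2[of _ y]) (auto simp: bump_nonneg bump_pos simp del: mem_ball)
  qed
  define \<theta> where "\<theta> y x = bump (\<rho> y) y x / \<Psi> x" for y x
  define \<theta>' where "\<theta>' y a x = (bump_deriv (\<rho> y) y a x * \<Psi> x - bump (\<rho> y) y x * \<Psi>' a x) / (\<Psi> x * \<Psi> x)" for y a x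
  have c\<Psi>: "continuous_on X \<Psi>" "continuous_on X (\<Psi>' a)" for X a
    unfolding \<Psi>_def[abs_def] \<Psi>'_def[abs_def] by (intro continuous_on_sum continuous_bump)+
  have c\<theta>: "continuous_on (closure S) (\<theta> y)" "continuous_on (closure S) (\<theta>' y a)" for y a
    unfolding \<theta>_def[abs_def] \<theta>'_def[abs_def]
    by (intro continuous_intros continuous_bump c\<Psi>; use \<Psi>pos in force)+
  define gy where "gy y x = \<theta> y x *\<^sub>R g x" for y x
  define Dy where "Dy y a x = \<theta> y x *\<^sub>R D a x + \<theta>' y a x *\<^sub>R g x" for y a x
  have cgy: "continuous_on (closure S) (gy y)" for y
    unfolding gy_def[abs_def] by (intro continuous_intros c\<theta> cg)
  have cDy: "continuous_on (closure S) (Dy y a)" if "a \<in> B" for y a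
    unfolding Dy_def[abs_def] by (intro continuous_intros c\<theta> cg cD that)
  have localised: "(\<integral>x. indicator S x *\<^sub>R Dy y c x \<partial>vol B) = (\<integral>x. (exterior_normal B S x \<bullet> c) *\<^sub>R gy y x \<partial>surface_measure p bd)"
    if y: "y \<in> Y" for y
  proof -
    have y': "y \<in> closure S" using y Y by auto
    have \<rho>: "0 < \<rho> y" "\<rho> y < r y" using r[OF y'] by (auto simp: \<rho>_def)
    obtain b s \<gamma> grad where "region_chart B S b s y (r y) \<gamma> grad" using rc[OF y'] by blast
    then interpret domain_chart p \<eta> B S b s y "r y" \<gamma> grad by unfold_locales
    show ?thesis
    proof (rule divergence_local[OF cgy cDy _ \<rho>(2) _ _ c])
      fix x a assume x: "x \<in> S" and a: "a \<in> B"
      have x': "x \<in> closure S" using x closure_subset by auto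
      have "((\<lambda>t. \<Psi> (x + t *\<^sub>R a)) has_real_derivative \<Psi>' a x) (at 0)"
        unfolding \<Psi>_def \<Psi>'_def by (intro DERIV_sum bump_has_derivative)
      then have "((\<lambda>t. \<theta> y (x + t *\<^sub>R a)) has_real_derivative \<theta>' y a x) (at 0)"
        unfolding \<theta>_def \<theta>'_def using DERIV_divide[OF bump_has_derivative, of "\<lambda>t. \<Psi> (x + t *\<^sub>R a)" "\<Psi>' a x" "\<rho> y" y x a] \<Psi>pos[OF x']
        by simp
      from has_vector_derivative_scaleR[OF this der[OF x a]]
      show "((\<lambda>t. gy y (x + t *\<^sub>R a)) has_vector_derivative Dy y a x) (at 0)"
        by (simp add: gy_def Dy_def add.commute)
    next
      fix x assume "x \<notin> cball y (\<rho> y)"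
      then show "gy y x = 0" using bump_zero(1)[OF \<rho>(1)] by (simp add: gy_def \<theta>_def)
    next
      fix x a assume "x \<notin> cball y (\<rho> y)"
      then show "Dy y a x = 0" using bump_zero[OF \<rho>(1)] by (simp add: Dy_def \<theta>_def \<theta>'_def)
    qed
  qed
  have sum\<theta>: "(\<Sum>y\<in>Y. \<theta> y x) = 1" and sum\<theta>': "(\<Sum>y\<in>Y. \<theta>' y c x) = 0" if "x \<in> closure S" for x
    using \<Psi>pos[OF that]
    by (simp_all add: \<theta>_def \<theta>'_def sum_divide_distrib[symmetric] sum_subtractf sum_distrib_right[symmetric] \<Psi>_def[symmetric] \<Psi>'_def[symmetric])
  have "(\<integral>x. indicator S x *\<^sub>R D c x \<partial>vol B) = (\<integral>x. (\<Sum>y\<in>Y. indicator S x *\<^sub>R Dy y c x) \<partial>vol B)"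
  proof (rule Bochner_Integration.integral_cong[OF refl])
    fix x
    have "(\<Sum>y\<in>Y. Dy y c x) = D c x" if "x \<in> S"
      using sum\<theta>[of x] sum\<theta>'[of x] that closure_subset[of S]
      by (auto simp: Dy_def sum.distrib scaleR_sum_left[symmetric])
    then show "indicator S x *\<^sub>R D c x = (\<Sum>y\<in>Y. indicator S x *\<^sub>R Dy y c x)" by (auto simp: indicator_def)
  qed
  also have "\<dots> = (\<Sum>y\<in>Y. (\<integral>x. indicator S x *\<^sub>R Dy y c x \<partial>vol B))"
    by (intro Bochner_Integration.integral_sum integrable_on_S cDy c)
  also have "\<dots> = (\<Sum>y\<in>Y. (\<integral>x. (exterior_normal B S x \<bullet> c) *\<^sub>R gy y x \<partial>surface_measure p bd))"
    by (intro sum.cong refl localised)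
  also have "\<dots> = (\<integral>x. (\<Sum>y\<in>Y. (exterior_normal B S x \<bullet> c) *\<^sub>R gy y x) \<partial>surface_measure p bd)"
  proof (rule Bochner_Integration.integral_sum[symmetric])
    fix y
    show "integrable (surface_measure p bd) (\<lambda>x. (exterior_normal B S x \<bullet> c) *\<^sub>R gy y x)"
      by (intro integrable_on_bd continuous_intros continuous_normal continuous_on_subset[OF cgy]) (auto simp: bd_def)
  qed
  also have "\<dots> = (\<integral>x. (exterior_normal B S x \<bullet> c) *\<^sub>R g x \<partial>surface_measure p bd)"
  proof (rule Bochner_Integration.integral_cong[OF refl])
    fix x assume "x \<in> space (surface_measure p bd)"
    then have "x \<in> bd" by (simp only: space_surface)
    then have "x \<in> closure S" by (simp add: bd_def)
    then have "(\<Sum>y\<in>Y. gy y x) = g x" using sum\<theta>[of x] by (simp add: gy_def scaleR_sum_left[symmetric])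
    then show "(\<Sum>y\<in>Y. (exterior_normal B S x \<bullet> c) *\<^sub>R gy y x) = (exterior_normal B S x \<bullet> c) *\<^sub>R g x"
      by (simp add: scaleR_sum_right[symmetric])
  qed
  finally show ?thesis .
qed

end

section \<open>Gaussian integrals and the mass of the kernels\<close>

lemma nn_integral_even:
  fixes f :: "real \<Rightarrow> ennreal"
  assumes [measurable]: "f \<in> borel_measurable borel" and even: "\<And>x. f (- x) = f x"
  shows "(\<integral>\<^sup>+x. f x \<partial>lborel) = 2 * (\<integral>\<^sup>+x. f x * indicator {0<..} x \<partial>lborel)"
proof -
  have "(\<integral>\<^sup>+x. f x \<partial>lborel) = (\<integral>\<^sup>+x. f x * indicator {0<..} x + f x * indicator {..<0} x \<partial>lborel)"
    by (rule nn_integral_cong_AE, use AE_lborel_singleton[of "0::real"] in eventually_elim) (auto simp: indicator_def)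
  also have "\<dots> = (\<integral>\<^sup>+x. f x * indicator {0<..} x \<partial>lborel) + (\<integral>\<^sup>+x. f x * indicator {..<0} x \<partial>lborel)"
    by (intro nn_integral_add) measurable
  also have "(\<integral>\<^sup>+x. f x * indicator {..<0} x \<partial>lborel) = (\<integral>\<^sup>+x. f x * indicator {0<..} x \<partial>lborel)"
    by (subst nn_integral_real_affine[where c = "-1" and t = 0]) (auto simp: even indicator_def intro!: nn_integral_cong)
  finally show ?thesis by (simp add: mult_2)
qed

lemma nn_integral_Gamma:
  assumes a: "0 < (a::real)"
  shows "(\<integral>\<^sup>+u. ennreal (u powr (a - 1) * exp (- u)) * indicator {0<..} u \<partial>lborel) = ennreal (Gamma a)"
proof -
  have "(\<integral>\<^sup>+u. ennreal (u powr (a - 1) * exp (- u)) * indicator {0<..} u \<partial>lborel) =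
     (\<integral>\<^sup>+u. ennreal (indicator {0..} u * u powr (a - 1) / exp u) \<partial>lborel)"
    by (intro nn_integral_cong) (auto simp: indicator_def exp_minus field_simps)
  then show ?thesis using Gamma_conv_nn_integral_real[OF a] by simp
qed

lemma nn_integral_Gamma_scaled:
  assumes a: "0 < (a::real)" and c: "0 < c"
  shows "(\<integral>\<^sup>+u. ennreal (u powr (a - 1) * exp (- c * u)) * indicator {0<..} u \<partial>lborel) = ennreal (Gamma a / c powr a)"
proof -
  have "ennreal (Gamma a) = ennreal c * (\<integral>\<^sup>+u. ennreal ((0 + c * u) powr (a - 1) * exp (- (0 + c * u))) * indicator {0<..} (0 + c * u) \<partial>lborel)"
    unfolding nn_integral_Gamma[OF a, symmetric] using c by (subst nn_integral_real_affine[where c = c and t = 0]) auto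
  also have "(\<integral>\<^sup>+u. ennreal ((0 + c * u) powr (a - 1) * exp (- (0 + c * u))) * indicator {0<..} (0 + c * u) \<partial>lborel) =
      (\<integral>\<^sup>+u. ennreal (c powr (a - 1)) * (ennreal (u powr (a - 1) * exp (- c * u)) * indicator {0<..} u) \<partial>lborel)"
    using c by (intro nn_integral_cong) (auto simp: indicator_def powr_mult zero_less_mult_iff mult.assoc simp flip: ennreal_mult)
  also have "\<dots> = ennreal (c powr (a - 1)) * (\<integral>\<^sup>+u. ennreal (u powr (a - 1) * exp (- c * u)) * indicator {0<..} u \<partial>lborel)"
    by (intro nn_integral_cmult) measurable
  finally have "ennreal (Gamma a) = ennreal (c powr a) * (\<integral>\<^sup>+u. ennreal (u powr (a - 1) * exp (- c * u)) * indicator {0<..} u \<partial>lborel)"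
    using c by (simp add: mult.assoc[symmetric] powr_diff flip: ennreal_mult)
  then have "ennreal (1 / c powr a) * ennreal (Gamma a) = ennreal (1 / c powr a) * ennreal (c powr a) * (\<integral>\<^sup>+u. ennreal (u powr (a - 1) * exp (- c * u)) * indicator {0<..} u \<partial>lborel)"
    by (simp add: mult.assoc)
  then show ?thesis using c Gamma_real_pos[OF a] by (simp add: ennreal_mult[symmetric])
qed

text \<open>
  The substitution \<open>t = x\<^sup>2\<close> in the integral for \<open>Gamma (1/2)\<close>.  The value is left in terms of \<open>Gamma (1/2)\<close> because
  the area of the sphere is expressed in this form.
\<close>

lemma nn_integral_gauss:
  assumes c: "0 < (c::real)"
  shows "(\<integral>\<^sup>+x. ennreal (exp (- c * x\<^sup>2)) \<partial>lborel) = ennreal (Gamma (1/2) / sqrt c)"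
proof -
  let ?f = "\<lambda>t::real. t powr (1/2 - 1) / exp t"
  have img: "(\<lambda>x::real. x\<^sup>2) ` {0..} = {0..}"
  proof (intro equalityI subsetI)
    fix x :: real assume "x \<in> {0..}"
    then show "x \<in> (\<lambda>x. x\<^sup>2) ` {0..}" by (intro image_eqI[of _ _ "sqrt x"]) auto
  qed auto
  have inj: "inj_on (\<lambda>x::real. x\<^sup>2) {0..}" by (rule inj_onI) (simp add: power2_eq_iff_nonneg)
  have G: "(?f has_integral Gamma (1/2)) {0..}" by (rule Gamma_integral_real) simp
  then have "?f absolutely_integrable_on {0..} \<and> integral {0..} ?f = Gamma (1/2)"
    by (auto simp: has_integral_iff intro!: nonnegative_absolutely_integrable_1)
  then have "(\<lambda>x. \<bar>2 * x\<bar> *\<^sub>R ?f (x\<^sup>2)) absolutely_integrable_on {0..} \<and> integral {0..} (\<lambda>x. \<bar>2 * x\<bar> *\<^sub>R ?f (x\<^sup>2)) = Gamma (1/2)"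
    by (subst has_absolute_integral_change_of_variables_real) (auto simp: img inj intro!: derivative_eq_intros)
  then have "((\<lambda>x. \<bar>2 * x\<bar> *\<^sub>R ?f (x\<^sup>2)) has_integral Gamma (1/2)) {0..}"
    by (auto simp: has_integral_iff absolutely_integrable_on_def)
  then have "((\<lambda>x. if x \<in> {0..} then \<bar>2 * x\<bar> *\<^sub>R ?f (x\<^sup>2) else 0) has_integral Gamma (1/2)) UNIV"
    by (simp only: has_integral_restrict_UNIV)
  moreover have eq: "(if x \<in> {0..} then \<bar>2 * x\<bar> *\<^sub>R ?f (x\<^sup>2) else 0) = 2 * exp (- x\<^sup>2) * indicator {0<..} x" for x :: real
  proof (cases "x > 0")
    case True
    then have "(x\<^sup>2) powr (1/2 - 1) = x powr (- 1)" by (simp add: powr_powr flip: powr_numeral)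
    also have "\<dots> = 1 / x" using True by (simp add: powr_minus_divide)
    finally show ?thesis using True by (simp add: exp_minus field_simps)
  qed (auto simp: indicator_def)
  ultimately have half: "((\<lambda>x. 2 * exp (- x\<^sup>2) * indicator {0<..} x) has_integral Gamma (1/2)) (UNIV :: real set)" by simp
  have "(\<integral>\<^sup>+x. ennreal (2 * exp (- x\<^sup>2) * indicator {0<..} x) \<partial>lborel) = ennreal (Gamma (1/2))"
    by (rule nn_integral_has_integral_lborel[OF _ _ half]) auto
  moreover have "(\<integral>\<^sup>+x. ennreal (exp (- x\<^sup>2)) \<partial>lborel) = 2 * (\<integral>\<^sup>+x. ennreal (exp (- x\<^sup>2)) * indicator {0<..} x \<partial>lborel)"
    by (rule nn_integral_even) auto
  moreover have "2 * (\<integral>\<^sup>+x. ennreal (exp (- x\<^sup>2)) * indicator {0<..} x \<partial>lborel) = (\<integral>\<^sup>+x. ennreal (2 * exp (- x\<^sup>2) * indicator {0<..} x) \<partial>lborel)"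
    by (subst nn_integral_cmult[symmetric]) (auto simp: ennreal_mult indicator_def mult.commute intro!: nn_integral_cong)
  ultimately have base: "(\<integral>\<^sup>+x. ennreal (exp (- x\<^sup>2)) \<partial>lborel) = ennreal (Gamma (1/2))" by (simp only:)
  have sc: "0 < sqrt c" using c by simp
  have "ennreal (Gamma (1/2)) = ennreal (sqrt c) * (\<integral>\<^sup>+x. ennreal (exp (- (0 + sqrt c * x)\<^sup>2)) \<partial>lborel)"
    unfolding base[symmetric] using sc by (subst nn_integral_real_affine[where c = "sqrt c" and t = 0]) auto
  also have "(\<integral>\<^sup>+x. ennreal (exp (- (0 + sqrt c * x)\<^sup>2)) \<partial>lborel) = (\<integral>\<^sup>+x. ennreal (exp (- c * x\<^sup>2)) \<partial>lborel)"
    using c by (simp add: power_mult_distrib)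
  finally have "ennreal (1 / sqrt c) * ennreal (Gamma (1/2)) = ennreal (1 / sqrt c) * ennreal (sqrt c) * (\<integral>\<^sup>+x. ennreal (exp (- c * x\<^sup>2)) \<partial>lborel)"
    by (simp add: mult.assoc)
  moreover have "ennreal (1 / sqrt c) * ennreal (sqrt c) = 1" using sc by (simp add: ennreal_mult[symmetric])
  moreover have "ennreal (1 / sqrt c) * ennreal (Gamma (1/2)) = ennreal (Gamma (1/2) / sqrt c)"
    using sc Gamma_real_pos[of "1/2"] by (simp add: ennreal_mult[symmetric])
  ultimately show ?thesis by simp
qed

lemma vol_nn_integral_prod:
  fixes k :: "real \<Rightarrow> ennreal"
  assumes "orthonormal B" and [measurable]: "k \<in> borel_measurable borel"
  shows "(\<integral>\<^sup>+x. (\<Prod>b\<in>B. k (x \<bullet> b)) \<partial>vol B) = (\<integral>\<^sup>+t. k t \<partial>lborel) ^ card B"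
  using orthonormal_finite[OF assms(1)] assms(1)
proof (induction B rule: finite_induct)
  case empty then show ?case using vol_nn_integral_empty[of "\<lambda>_. 1"] by simp
next
  case (insert b B)
  have oB: "orthonormal B" by (rule orthonormal_subset[OF insert.prems]) auto
  have bb: "b \<bullet> b = 1" using orthonormal_inner[OF insert.prems, of b b] by simp
  have "(\<integral>\<^sup>+x. (\<Prod>a\<in>insert b B. k (x \<bullet> a)) \<partial>vol (insert b B)) = (\<integral>\<^sup>+x. (\<integral>\<^sup>+t. (\<Prod>a\<in>insert b B. k ((x + t *\<^sub>R b) \<bullet> a)) \<partial>lborel) \<partial>vol B)"
    by (rule vol_nn_integral_insert[OF insert.hyps]) measurable
  also have "\<dots> = (\<integral>\<^sup>+x. (\<Prod>a\<in>B. k (x \<bullet> a)) * (\<integral>\<^sup>+t. k t \<partial>lborel) \<partial>vol B)"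
  proof (rule nn_integral_cong_AE, use AE_vol_span[OF insert.hyps(1)] in eventually_elim)
    fix x assume "x \<in> span B"
    have xb: "x \<bullet> b = 0" by (rule orthonormal_perp[OF insert.prems _ _ insert.hyps(2) \<open>x \<in> span B\<close>]) auto
    have ba: "b \<bullet> a = 0" if "a \<in> B" for a using orthonormal_inner[OF insert.prems, of b a] that insert.hyps by auto
    have "(\<Prod>a\<in>insert b B. k ((x + t *\<^sub>R b) \<bullet> a)) = (\<Prod>a\<in>B. k (x \<bullet> a)) * k t" for t
      using insert.hyps by (simp add: inner_add_left xb bb ba mult.commute)
    then show "(\<integral>\<^sup>+t. (\<Prod>a\<in>insert b B. k ((x + t *\<^sub>R b) \<bullet> a)) \<partial>lborel) = (\<Prod>a\<in>B. k (x \<bullet> a)) * (\<integral>\<^sup>+t. k t \<partial>lborel)"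
      by (simp add: nn_integral_cmult)
  qed
  also have "\<dots> = (\<integral>\<^sup>+t. k t \<partial>lborel) ^ card (insert b B)"
    by (subst nn_integral_multc) (use insert.hyps insert.IH[OF oB] in \<open>simp_all add: mult.commute\<close>)
  finally show ?case .
qed

lemma norm_span_sum: "orthonormal B \<Longrightarrow> x \<in> span B \<Longrightarrow> (norm x)\<^sup>2 = (\<Sum>b\<in>B. (x \<bullet> b)\<^sup>2)"
  using inner_span[of B x x] unfolding power2_norm_eq_inner by (simp add: power2_eq_square)

lemma vol_gauss:
  assumes B: "orthonormal B" and c: "0 < (c::real)"
  shows "(\<integral>\<^sup>+x. ennreal (exp (- c * (norm x)\<^sup>2)) \<partial>vol B) = ennreal ((Gamma (1/2) / sqrt c) ^ card B)"
proof -
  have "(\<integral>\<^sup>+x. ennreal (exp (- c * (norm x)\<^sup>2)) \<partial>vol B) = (\<integral>\<^sup>+x. (\<Prod>b\<in>B. ennreal (exp (- c * (x \<bullet> b)\<^sup>2))) \<partial>vol B)"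
  proof (rule nn_integral_cong_AE, use AE_vol_span[OF orthonormal_finite[OF B]] in eventually_elim)
    fix x assume x: "x \<in> span B"
    have "exp (- c * (norm x)\<^sup>2) = (\<Prod>b\<in>B. exp (- c * (x \<bullet> b)\<^sup>2))"
      unfolding norm_span_sum[OF B x] by (simp add: sum_distrib_left sum_negf[symmetric] exp_sum orthonormal_finite[OF B])
    then show "ennreal (exp (- c * (norm x)\<^sup>2)) = (\<Prod>b\<in>B. ennreal (exp (- c * (x \<bullet> b)\<^sup>2)))" by (simp add: prod_ennreal)
  qed
  also have "\<dots> = ennreal (Gamma (1/2) / sqrt c) ^ card B"
    using vol_nn_integral_prod[OF B, of "\<lambda>t. ennreal (exp (- c * t\<^sup>2))"] nn_integral_gauss[OF c] by simp
  finally show ?thesis using c Gamma_real_pos[of "1/2"] by (simp add: ennreal_power)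
qed

text \<open>
  The scalar factor in \<open>reg_kernel_divergence\<close> for \<open>\<epsilon> = 1\<close>; the factors for other \<open>\<epsilon>\<close> are its dilations.
\<close>

definition identity_profile :: "nat \<Rightarrow> octonion \<Rightarrow> real" where
  "identity_profile n x = n / sqrt (1 + (norm x)\<^sup>2) ^ (n + 2)"

lemma identity_profile_measurable[measurable]: "identity_profile n \<in> borel_measurable borel"
  unfolding identity_profile_def[abs_def] by measurable

text \<open>
  With \<open>a = n/2 + 1\<close> and \<open>q = 1 + |x|\<^sup>2\<close>, the power \<open>q\<close> to \<open>-a\<close> is \<open>1 / Gamma a\<close> times the integral of \<open>u\<close> to the power
  \<open>a - 1\<close> times \<open>exp (- q u)\<close>.  By Tonelli the integral over \<open>x\<close> is taken first; it is Gaussian and cancels the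
  power of \<open>u\<close>.
\<close>

lemma vol_identity_profile:
  assumes B: "orthonormal B" and n: "card B = n" "0 < n"
  shows "(\<integral>\<^sup>+x. ennreal (identity_profile n x) \<partial>vol B) = ennreal (2 * Gamma (1/2) ^ n / Gamma (real n / 2))"
proof -
  define a where "a = real n / 2 + 1"
  have a: "0 < a" using n by (simp add: a_def)
  have Ga: "0 < Gamma a" by (rule Gamma_real_pos[OF a])
  interpret V: sigma_finite_measure "vol B" by (rule sigma_finite_vol[OF B])
  interpret P: pair_sigma_finite "vol B" "lborel :: real measure" ..
  have pd: "ennreal (identity_profile n x) = ennreal (n / Gamma a) * (\<integral>\<^sup>+u. ennreal (u powr (a - 1) * exp (- (1 + (norm x)\<^sup>2) * u)) * indicator {0<..} u \<partial>lborel)" for x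
  proof -
    have p: "0 < 1 + (norm x)\<^sup>2" by (simp add: add_pos_nonneg)
    have "sqrt (1 + (norm x)\<^sup>2) ^ (n + 2) = (1 + (norm x)\<^sup>2) powr a"
      using p by (simp add: a_def powr_half_sqrt[symmetric] powr_realpow[symmetric] powr_powr add_divide_distrib add.commute del: power_Suc power_Suc2)
    then have "identity_profile n x = n / Gamma a * (Gamma a / (1 + (norm x)\<^sup>2) powr a)" using Ga by (simp add: identity_profile_def)
    then show ?thesis unfolding nn_integral_Gamma_scaled[OF a p] using Ga n p by (simp add: ennreal_mult[symmetric])
  qed
  have "(\<integral>\<^sup>+x. ennreal (identity_profile n x) \<partial>vol B) = ennreal (n / Gamma a) *
      (\<integral>\<^sup>+x. (\<integral>\<^sup>+u. ennreal (u powr (a - 1) * exp (- (1 + (norm x)\<^sup>2) * u)) * indicator {0<..} u \<partial>lborel) \<partial>vol B)"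
    unfolding pd by (intro nn_integral_cmult) measurable
  also have "(\<integral>\<^sup>+x. (\<integral>\<^sup>+u. ennreal (u powr (a - 1) * exp (- (1 + (norm x)\<^sup>2) * u)) * indicator {0<..} u \<partial>lborel) \<partial>vol B) =
     (\<integral>\<^sup>+u. (\<integral>\<^sup>+x. ennreal (u powr (a - 1) * exp (- (1 + (norm x)\<^sup>2) * u)) * indicator {0<..} u \<partial>vol B) \<partial>lborel)"
    by (rule P.Fubini'[symmetric]) measurable
  also have "\<dots> = (\<integral>\<^sup>+u. ennreal (Gamma (1/2) ^ n) * (ennreal (u powr (1 - 1) * exp (- u)) * indicator {0<..} u) \<partial>lborel)"
  proof (intro nn_integral_cong)
    fix u :: real
    show "(\<integral>\<^sup>+x. ennreal (u powr (a - 1) * exp (- (1 + (norm x)\<^sup>2) * u)) * indicator {0<..} u \<partial>vol B) =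
      ennreal (Gamma (1/2) ^ n) * (ennreal (u powr (1 - 1) * exp (- u)) * indicator {0<..} u)"
    proof (cases "0 < u")
      case u: True
      have "(\<integral>\<^sup>+x. ennreal (u powr (a - 1) * exp (- (1 + (norm x)\<^sup>2) * u)) \<partial>vol B) =
          (\<integral>\<^sup>+x. ennreal (u powr (a - 1) * exp (- u)) * ennreal (exp (- u * (norm x)\<^sup>2)) \<partial>vol B)"
        by (intro nn_integral_cong) (simp add: ennreal_mult[symmetric] mult.assoc exp_add[symmetric] algebra_simps)
      also have "\<dots> = ennreal (u powr (a - 1) * exp (- u)) * ennreal ((Gamma (1/2) / sqrt u) ^ n)"
        using vol_gauss[OF B u] n by (subst nn_integral_cmult) auto
      also have "\<dots> = ennreal (Gamma (1/2) ^ n * exp (- u))"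
      proof -
        have "sqrt u ^ n = u powr (a - 1)"
          using u by (simp add: a_def powr_half_sqrt[symmetric] powr_realpow[symmetric] powr_powr)
        then show ?thesis using u Gamma_real_pos[of "1/2"] by (simp add: ennreal_mult[symmetric] power_divide)
      qed
      finally show ?thesis using u Gamma_real_pos[of "1/2"] by (simp add: ennreal_mult)
    qed simp
  qed
  also have "\<dots> = ennreal (Gamma (1/2) ^ n) * ennreal (Gamma 1)"
    unfolding nn_integral_Gamma[OF zero_less_one, symmetric] by (rule nn_integral_cmult) measurable
  finally have "(\<integral>\<^sup>+x. ennreal (identity_profile n x) \<partial>vol B) = ennreal (n / Gamma a * Gamma (1/2) ^ n)"
    using Ga Gamma_real_pos[of "1/2"] by (simp add: ennreal_mult[symmetric])
  also have "n / Gamma a * Gamma (1/2) ^ n = 2 * Gamma (1/2) ^ n / Gamma (real n / 2)"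
  proof -
    have "real n / 2 \<notin> \<int>\<^sub>\<le>\<^sub>0"
    proof
      assume "real n / 2 \<in> \<int>\<^sub>\<le>\<^sub>0"
      then have "real n / 2 \<le> 0" by (rule nonpos_Ints_nonpos)
      then show False using n by simp
    qed
    then have Gn: "Gamma a = (real n / 2) * Gamma (real n / 2)" unfolding a_def by (rule Gamma_plus1)
    show ?thesis unfolding Gn using n by (simp add: field_simps)
  qed
  finally show ?thesis .
qed

text \<open>
  Since \<open>|x \<bullet> b| \<le> |x|\<close> for every \<open>b \<in> B\<close>, the function is at most the product over \<open>b\<close> of
  \<open>|x \<bullet> b|\<close> to the power \<open>-\<theta>\<close> with \<open>\<theta> = (n - 1)/n < 1\<close>, and each factor is integrable near \<open>0\<close>.
\<close>

lemma vol_riesz_finite: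
  assumes B: "orthonormal B" and n: "card B = n" "0 < n"
  shows "(\<integral>\<^sup>+x. ennreal (1 / norm x ^ (n - 1)) * indicator (cball 0 R) x \<partial>vol B) < \<infinity>"
proof -
  define \<theta> where "\<theta> = (real n - 1) / real n"
  have \<theta>: "0 \<le> \<theta>" "\<theta> < 1" "\<theta> * real n = real n - 1" using n by (auto simp: \<theta>_def)
  \<comment> \<open>the value \<open>\<infinity>\<close> at \<open>0\<close> makes the bound hold on the coordinate planes, where \<open>0 powr (- \<theta>) = 0\<close>\<close>
  define k where "k t = (if t = 0 then \<infinity> else ennreal (\<bar>t\<bar> powr (- \<theta>)) * indicator {- \<bar>R\<bar>..\<bar>R\<bar>} t)" for t :: real
  have [measurable]: "k \<in> borel_measurable borel" unfolding k_def by measurable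
  have k_fin: "(\<integral>\<^sup>+t. k t \<partial>lborel) < \<infinity>"
  proof -
    have "(\<integral>\<^sup>+t. k t \<partial>lborel) = 2 * (\<integral>\<^sup>+t. k t * indicator {0<..} t \<partial>lborel)"
      by (rule nn_integral_even) (auto simp: k_def indicator_def)
    also have "(\<integral>\<^sup>+t. k t * indicator {0<..} t \<partial>lborel) = (\<integral>\<^sup>+t. ennreal (if t \<in> {0..\<bar>R\<bar>} then t powr (- \<theta>) else 0) \<partial>lborel)"
      by (intro nn_integral_cong) (auto simp: k_def indicator_def)
    also have "\<dots> = ennreal (\<bar>R\<bar> powr (- \<theta> + 1) / (- \<theta> + 1))"
    proof (rule nn_integral_has_integral_lborel)
      have "((\<lambda>t. t powr (- \<theta>)) has_integral (\<bar>R\<bar> powr (- \<theta> + 1) / (- \<theta> + 1))) {0..\<bar>R\<bar>}"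
        by (rule has_integral_powr_from_0) (use \<theta> in auto)
      then show "((\<lambda>t. if t \<in> {0..\<bar>R\<bar>} then t powr (- \<theta>) else 0) has_integral (\<bar>R\<bar> powr (- \<theta> + 1) / (- \<theta> + 1))) UNIV"
        by (simp only: has_integral_restrict_UNIV)
    qed auto
    finally show ?thesis by (simp add: ennreal_mult_less_top)
  qed
  have "(\<integral>\<^sup>+x. ennreal (1 / norm x ^ (n - 1)) * indicator (cball 0 R) x \<partial>vol B) \<le> (\<integral>\<^sup>+x. (\<Prod>b\<in>B. k (x \<bullet> b)) \<partial>vol B)"
  proof (rule nn_integral_mono)
    fix x :: octonion
    show "ennreal (1 / norm x ^ (n - 1)) * indicator (cball 0 R) x \<le> (\<Prod>b\<in>B. k (x \<bullet> b))"
    proof (cases "norm x \<le> R")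
      case R: True
      have cs: "\<bar>x \<bullet> b\<bar> \<le> norm x" if "b \<in> B" for b
        using Cauchy_Schwarz_ineq2[of x b] orthonormal_norm[OF B that] by simp
      have kpos: "k (x \<bullet> b) \<noteq> 0" if "b \<in> B" for b
        using cs[OF that] R by (auto simp: k_def indicator_def)
      show ?thesis
      proof (cases "\<exists>b\<in>B. x \<bullet> b = 0")
        case True
        then obtain b where b: "b \<in> B" "x \<bullet> b = 0" by blast
        have "(\<Prod>b\<in>B. k (x \<bullet> b)) = k (x \<bullet> b) * (\<Prod>b\<in>B - {b}. k (x \<bullet> b))"
          using b orthonormal_finite[OF B] by (simp add: prod.remove)
        also have "\<dots> = \<infinity>" using b kpos orthonormal_finite[OF B] by (simp add: k_def ennreal_top_mult)
        finally show ?thesis by simp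
      next
        case False
        have "x \<noteq> 0" using False n by (metis card_gt_0_iff ex_in_conv inner_zero_left)
        have keq: "k (x \<bullet> b) = ennreal (\<bar>x \<bullet> b\<bar> powr (- \<theta>))" if "b \<in> B" for b
          using that False cs[OF that] R by (auto simp: k_def indicator_def)
        have "1 / norm x ^ (n - 1) = (\<Prod>b\<in>B. norm x powr (- \<theta>))"
        proof -
          have "(\<Prod>b\<in>B. norm x powr (- \<theta>)) = norm x powr (- (\<theta> * real n))"
            using \<open>x \<noteq> 0\<close> by (simp add: n powr_realpow[symmetric] powr_powr)
          also have "\<dots> = 1 / norm x ^ (n - 1)"
            using \<open>x \<noteq> 0\<close> n unfolding \<theta>(3) powr_minus_divide by (simp add: powr_realpow[symmetric] of_nat_diff)
          finally show ?thesis by simp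
        qed
        also have "\<dots> \<le> (\<Prod>b\<in>B. \<bar>x \<bullet> b\<bar> powr (- \<theta>))"
          using cs False \<theta> by (intro prod_mono) (auto intro!: powr_mono2')
        finally have "ennreal (1 / norm x ^ (n - 1)) \<le> ennreal (\<Prod>b\<in>B. \<bar>x \<bullet> b\<bar> powr (- \<theta>))" by (rule ennreal_leI)
        also have "\<dots> = (\<Prod>b\<in>B. k (x \<bullet> b))" using keq by (subst prod_ennreal[symmetric]) auto
        finally show ?thesis by (auto simp: indicator_def)
      qed
    qed simp
  qed
  also have "\<dots> = (\<integral>\<^sup>+t. k t \<partial>lborel) ^ card B" by (rule vol_nn_integral_prod[OF B]) measurable
  also have "\<dots> < \<infinity>" using k_fin by (simp add: power_less_top_ennreal)
  finally show ?thesis .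
qed

lemma sqrt_power_powr: "0 < q \<Longrightarrow> sqrt q ^ m = q powr (real m / 2)"
  by (simp add: powr_half_sqrt[symmetric] powr_realpow[symmetric] powr_powr)

lemma vol_affine:
  assumes B: "orthonormal B" and x: "x \<in> span B" and \<epsilon>: "0 < \<epsilon>"
  shows "vol B = density (distr (vol B) borel (\<lambda>w. x + \<epsilon> *\<^sub>R w)) (\<lambda>_. ennreal (\<epsilon> ^ card B))"
proof (rule measure_eqI)
  fix X assume "X \<in> sets (vol B)"
  then have [measurable]: "X \<in> sets borel" by simp
  have "emeasure (vol B) X = (\<integral>\<^sup>+w. indicator X w \<partial>vol B)" by simp
  also have "\<dots> = ennreal (\<epsilon> ^ card B) * (\<integral>\<^sup>+w. indicator X (x + \<epsilon> *\<^sub>R w) \<partial>vol B)"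
    by (rule vol_nn_integral_affine[OF orthonormal_finite[OF B] x \<epsilon>]) measurable
  also have "(\<integral>\<^sup>+w. indicator X (x + \<epsilon> *\<^sub>R w) \<partial>vol B) = (\<integral>\<^sup>+w. indicator X w \<partial>distr (vol B) borel (\<lambda>w. x + \<epsilon> *\<^sub>R w))"
    by (subst nn_integral_distr) auto
  also have "ennreal (\<epsilon> ^ card B) * \<dots> = emeasure (density (distr (vol B) borel (\<lambda>w. x + \<epsilon> *\<^sub>R w)) (\<lambda>_. ennreal (\<epsilon> ^ card B))) X"
    by (subst emeasure_density) (auto simp: nn_integral_cmult)
  finally show "emeasure (vol B) X = emeasure (density (distr (vol B) borel (\<lambda>w. x + \<epsilon> *\<^sub>R w)) (\<lambda>_. ennreal (\<epsilon> ^ card B))) X" .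
qed simp

lemma vol_integral_affine:
  fixes F :: "octonion \<Rightarrow> 'c::{banach, second_countable_topology}"
  assumes B: "orthonormal B" and x: "x \<in> span B" and \<epsilon>: "0 < \<epsilon>" and [measurable]: "F \<in> borel_measurable borel"
  shows "(\<integral>y. F y \<partial>vol B) = (\<integral>w. \<epsilon> ^ card B *\<^sub>R F (x + \<epsilon> *\<^sub>R w) \<partial>vol B)"
proof -
  have "(\<integral>y. F y \<partial>vol B) = (\<integral>y. F y \<partial>density (distr (vol B) borel (\<lambda>w. x + \<epsilon> *\<^sub>R w)) (\<lambda>_. ennreal (\<epsilon> ^ card B)))"
    using vol_affine[OF B x \<epsilon>] by simp
  also have "\<dots> = (\<integral>y. \<epsilon> ^ card B *\<^sub>R F y \<partial>distr (vol B) borel (\<lambda>w. x + \<epsilon> *\<^sub>R w))"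
    by (rule integral_density) (use \<epsilon> in auto)
  also have "\<dots> = (\<integral>w. \<epsilon> ^ card B *\<^sub>R F (x + \<epsilon> *\<^sub>R w) \<partial>vol B)"
    by (rule integral_distr) measurable
  finally show ?thesis .
qed

section \<open>The regularised kernel\<close>

text \<open>
  As \<open>\<epsilon>\<close> tends to \<open>0\<close>, \<open>reg_kernel (p + 2) \<epsilon>\<close> tends pointwise to \<open>sphere_area p\<close> times the Cauchy kernel.
\<close>

definition reg_kernel :: "nat \<Rightarrow> real \<Rightarrow> octonion \<Rightarrow> octonion" where
  "reg_kernel n \<epsilon> z = (\<epsilon>\<^sup>2 + (norm z)\<^sup>2) powr (- real n / 2) *\<^sub>R oconj z"

definition reg_kernel_deriv :: "nat \<Rightarrow> real \<Rightarrow> octonion \<Rightarrow> octonion \<Rightarrow> octonion" where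
  "reg_kernel_deriv n \<epsilon> c z = (\<epsilon>\<^sup>2 + (norm z)\<^sup>2) powr (- real n / 2) *\<^sub>R oconj c
     - (real n * (z \<bullet> c) * (\<epsilon>\<^sup>2 + (norm z)\<^sup>2) powr (- real n / 2 - 1)) *\<^sub>R oconj z"

lemma bounded_linear_oconj: "bounded_linear oconj"
  using linear_oconj by (simp add: linear_conv_bounded_linear)

lemma continuous_oconj[continuous_intros]: "continuous_on S f \<Longrightarrow> continuous_on S (\<lambda>x. oconj (f x))"
  by (rule bounded_linear.continuous_on[OF bounded_linear_oconj])

lemma reg_pos: "0 < \<epsilon> \<Longrightarrow> 0 < \<epsilon>\<^sup>2 + (norm z)\<^sup>2"
  by (simp add: add_pos_nonneg)

lemma continuous_reg_kernel:
  assumes "0 < \<epsilon>" "continuous_on X h"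
  shows "continuous_on X (\<lambda>y. reg_kernel n \<epsilon> (h y))" "continuous_on X (\<lambda>y. reg_kernel_deriv n \<epsilon> c (h y))"
proof -
  have nz: "\<forall>y\<in>X. \<epsilon>\<^sup>2 + (norm (h y))\<^sup>2 \<noteq> 0" using reg_pos[OF assms(1)] by (metis less_irrefl)
  show "continuous_on X (\<lambda>y. reg_kernel n \<epsilon> (h y))" "continuous_on X (\<lambda>y. reg_kernel_deriv n \<epsilon> c (h y))"
    unfolding reg_kernel_def reg_kernel_deriv_def by (intro continuous_intros assms(2) nz)+
qed

lemma reg_kernel_has_derivative:
  assumes \<epsilon>: "0 < \<epsilon>"
  shows "((\<lambda>t. reg_kernel n \<epsilon> (z + t *\<^sub>R c)) has_vector_derivative reg_kernel_deriv n \<epsilon> c z) (at 0)"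
proof -
  have q: "\<epsilon>\<^sup>2 + (norm (z + t *\<^sub>R c))\<^sup>2 = \<epsilon>\<^sup>2 + (norm z)\<^sup>2 + 2 * t * (z \<bullet> c) + t\<^sup>2 * (c \<bullet> c)" for t
    unfolding power2_norm_eq_inner
    by (simp add: inner_add_left inner_add_right inner_commute power2_eq_square algebra_simps)
  have dq: "((\<lambda>t. \<epsilon>\<^sup>2 + (norm (z + t *\<^sub>R c))\<^sup>2) has_real_derivative 2 * (z \<bullet> c)) (at 0)"
    unfolding q by (auto intro!: derivative_eq_intros)
  have pos: "0 < \<epsilon>\<^sup>2 + (norm (z + 0 *\<^sub>R c))\<^sup>2" using reg_pos[OF \<epsilon>] by simp
  have "((\<lambda>t. (\<epsilon>\<^sup>2 + (norm (z + t *\<^sub>R c))\<^sup>2) powr (- real n / 2)) has_real_derivative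
      - (real n * (z \<bullet> c) * (\<epsilon>\<^sup>2 + (norm z)\<^sup>2) powr (- real n / 2 - 1))) (at 0)"
    using DERIV_fun_powr[OF dq pos, of "- real n / 2"] by (simp add: mult_ac)
  moreover have "((\<lambda>t. oconj (z + t *\<^sub>R c)) has_vector_derivative oconj c) (at 0)"
    by (rule bounded_linear.has_vector_derivative[OF bounded_linear_oconj]) (auto intro!: derivative_eq_intros)
  ultimately have "((\<lambda>t. (\<epsilon>\<^sup>2 + (norm (z + t *\<^sub>R c))\<^sup>2) powr (- real n / 2) *\<^sub>R oconj (z + t *\<^sub>R c)) has_vector_derivative
      (\<epsilon>\<^sup>2 + (norm (z + 0 *\<^sub>R c))\<^sup>2) powr (- real n / 2) *\<^sub>R oconj c +
      (- (real n * (z \<bullet> c) * (\<epsilon>\<^sup>2 + (norm z)\<^sup>2) powr (- real n / 2 - 1))) *\<^sub>R oconj (z + 0 *\<^sub>R c)) (at 0)"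
    by (rule has_vector_derivative_scaleR)
  then show ?thesis by (simp add: reg_kernel_def reg_kernel_deriv_def)
qed

text \<open>
  The first part of the derivative contributes \<open>oconj c \<star> (c \<star> w) = w\<close> for each of the \<open>n\<close> basis vectors, and the second,
  after summation over \<open>c\<close>, a multiple of \<open>oconj z \<star> (z \<star> w) = |z|\<^sup>2 w\<close>.  At \<open>\<epsilon> = 0\<close> the two would cancel.
\<close>

lemma reg_kernel_divergence:
  assumes B: "orthonormal B" and n: "card B = n" and z: "z \<in> span B" and \<epsilon>: "0 < \<epsilon>"
  shows "(\<Sum>c\<in>B. reg_kernel_deriv n \<epsilon> c z \<star> (c \<star> w)) = (real n * \<epsilon>\<^sup>2 * (\<epsilon>\<^sup>2 + (norm z)\<^sup>2) powr (- real n / 2 - 1)) *\<^sub>R w"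
proof -
  define q where "q = \<epsilon>\<^sup>2 + (norm z)\<^sup>2"
  have q: "0 < q" unfolding q_def by (rule reg_pos[OF \<epsilon>])
  have "(\<Sum>c\<in>B. reg_kernel_deriv n \<epsilon> c z \<star> (c \<star> w)) =
     (\<Sum>c\<in>B. q powr (- real n / 2) *\<^sub>R (oconj c \<star> (c \<star> w)) - (real n * q powr (- real n / 2 - 1)) *\<^sub>R (oconj z \<star> (((z \<bullet> c) *\<^sub>R c) \<star> w)))"
    unfolding reg_kernel_deriv_def q_def[symmetric]
    by (intro sum.cong) (simp_all add: omult.diff_left omult.scaleR_left omult.scaleR_right mult_ac)
  also have "\<dots> = (\<Sum>c\<in>B. q powr (- real n / 2) *\<^sub>R w) - (real n * q powr (- real n / 2 - 1)) *\<^sub>R (oconj z \<star> ((\<Sum>c\<in>B. (z \<bullet> c) *\<^sub>R c) \<star> w))"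
    unfolding sum_subtractf omult.sum_left omult.sum_right scaleR_sum_right
    using orthonormal_norm[OF B] by (simp add: oconj_omult_omult)
  also have "(\<Sum>c\<in>B. (z \<bullet> c) *\<^sub>R c) = z" using oproj_span[OF B z] by (simp add: oproj_def)
  also have "(\<Sum>c\<in>B. q powr (- real n / 2) *\<^sub>R w) = (real n * q powr (- real n / 2)) *\<^sub>R w"
    unfolding sum_constant_scaleR n by simp
  also have "oconj z \<star> (z \<star> w) = (norm z)\<^sup>2 *\<^sub>R w" by (rule oconj_omult_omult)
  also have "q powr (- real n / 2) = q * q powr (- real n / 2 - 1)" using q by (simp add: powr_diff)
  finally show ?thesis unfolding q_def by (simp add: algebra_simps flip: scaleR_diff_left)
qed

text \<open>
  A bound that does not depend on \<open>\<epsilon>\<close>, for dominated convergence.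
\<close>

lemma reg_kernel_norm:
  assumes n: "0 < n"
  shows "norm (reg_kernel n \<epsilon> z) \<le> 1 / norm z ^ (n - 1)"
proof (cases "z = 0")
  case True
  then show ?thesis using linear_0[OF linear_oconj] by (simp add: reg_kernel_def)
next
  case False
  then have z: "0 < (norm z)\<^sup>2" by simp
  have "(\<epsilon>\<^sup>2 + (norm z)\<^sup>2) powr (- real n / 2) \<le> ((norm z)\<^sup>2) powr (- real n / 2)"
    using z by (intro powr_mono2') auto
  also have "\<dots> = 1 / norm z ^ n"
    using sqrt_power_powr[OF z, of n] z by (simp add: powr_minus_divide)
  finally have "(\<epsilon>\<^sup>2 + (norm z)\<^sup>2) powr (- real n / 2) * norm z \<le> 1 / norm z ^ n * norm z"
    by (rule mult_right_mono) simp
  then have "norm (reg_kernel n \<epsilon> z) \<le> 1 / norm z ^ n * norm z"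
    by (simp add: reg_kernel_def norm_oconj)
  also have "\<dots> = 1 / norm z ^ (n - 1)" using False n by (cases n) auto
  finally show ?thesis .
qed

lemma reg_kernel_tendsto:
  assumes "e \<longlonglongrightarrow> 0"
  shows "(\<lambda>k. reg_kernel n (e k) z) \<longlonglongrightarrow> (1 / norm z ^ n) *\<^sub>R oconj z"
proof (cases "z = 0")
  case True
  then show ?thesis using linear_0[OF linear_oconj] by (simp add: reg_kernel_def)
next
  case False
  then have z: "0 < (norm z)\<^sup>2" by simp
  have "(\<lambda>k. (e k)\<^sup>2 + (norm z)\<^sup>2) \<longlonglongrightarrow> 0\<^sup>2 + (norm z)\<^sup>2" by (intro tendsto_intros assms)
  from tendsto_scaleR[OF tendsto_powr[OF this tendsto_const] tendsto_const]
  have "(\<lambda>k. reg_kernel n (e k) z) \<longlonglongrightarrow> (0\<^sup>2 + (norm z)\<^sup>2) powr (- real n / 2) *\<^sub>R oconj z"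
    unfolding reg_kernel_def using False by auto
  moreover have "(0\<^sup>2 + (norm z)\<^sup>2) powr (- real n / 2) = 1 / norm z ^ n"
    using sqrt_power_powr[OF z, of n] z by (simp add: powr_minus_divide)
  ultimately show ?thesis by simp
qed

section \<open>The Cauchy--Pompeiu formula\<close>

context slice_domain
begin

text \<open>
  The divergence theorem for \<open>y \<mapsto> E\<^sub>\<epsilon>(y - x) \<star> (c \<star> f y)\<close> in the direction \<open>c\<close>, summed over the basis.
\<close>

lemma regularised_formula:
  fixes f :: "octonion \<Rightarrow> octonion" and D :: "octonion \<Rightarrow> octonion \<Rightarrow> octonion"
  assumes cf: "continuous_on (closure S) f" and cD: "\<And>c. c \<in> B \<Longrightarrow> continuous_on (closure S) (D c)"
    and der: "\<And>x c. x \<in> S \<Longrightarrow> c \<in> B \<Longrightarrow> ((\<lambda>t. f (x + t *\<^sub>R c)) has_vector_derivative D c x) (at 0)"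
    and \<epsilon>: "0 < \<epsilon>" and x: "x \<in> span B" and n: "card B = n"
  shows "(\<integral>y. indicator S y *\<^sub>R ((real n * \<epsilon>\<^sup>2 * (\<epsilon>\<^sup>2 + (norm (y - x))\<^sup>2) powr (- real n / 2 - 1)) *\<^sub>R f y) \<partial>vol B) +
         (\<integral>y. indicator S y *\<^sub>R (reg_kernel n \<epsilon> (y - x) \<star> (\<Sum>c\<in>B. c \<star> D c y)) \<partial>vol B) =
         (\<integral>y. reg_kernel n \<epsilon> (y - x) \<star> (exterior_normal B S y \<star> f y) \<partial>surface_measure p bd)"
proof -
  let ?K = "\<lambda>y. reg_kernel n \<epsilon> (y - x)" and ?K' = "\<lambda>c y. reg_kernel_deriv n \<epsilon> c (y - x)"
  have cK: "continuous_on X ?K" "continuous_on X (?K' c)" for X c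
    by (intro continuous_reg_kernel[OF \<epsilon>] continuous_intros)+
  have cfB: "continuous_on bd f" by (rule continuous_on_subset[OF cf]) (auto simp: bd_def)
  have c1: "continuous_on (closure S) (\<lambda>y. ?K' c y \<star> (c \<star> f y))"
    and c2: "a \<in> B \<Longrightarrow> continuous_on (closure S) (\<lambda>y. ?K y \<star> (c \<star> D a y))" for c a
    by (intro omult.continuous_on cK cf cD continuous_on_const; assumption)+
  have each: "(\<integral>y. indicator S y *\<^sub>R (?K y \<star> (c \<star> D c y) + ?K' c y \<star> (c \<star> f y)) \<partial>vol B) =
     (\<integral>y. (exterior_normal B S y \<bullet> c) *\<^sub>R (?K y \<star> (c \<star> f y)) \<partial>surface_measure p bd)" if c: "c \<in> B" for c
  proof (rule divergence_theorem[where D = "\<lambda>a y. ?K y \<star> (c \<star> D a y) + ?K' a y \<star> (c \<star> f y)", OF _ _ _ c])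
    show "continuous_on (closure S) (\<lambda>y. ?K y \<star> (c \<star> f y))"
      by (intro omult.continuous_on cK cf continuous_on_const)
    show "continuous_on (closure S) (\<lambda>y. ?K y \<star> (c \<star> D a y) + ?K' a y \<star> (c \<star> f y))" if "a \<in> B" for a
      by (intro continuous_on_add omult.continuous_on cK cf cD continuous_on_const that)
    fix y a assume y: "y \<in> S" "a \<in> B"
    have "((\<lambda>t. ?K (y + t *\<^sub>R a)) has_vector_derivative ?K' a y) (at 0)"
      using reg_kernel_has_derivative[OF \<epsilon>, of n "y - x" a] by (simp add: algebra_simps)
    moreover have "((\<lambda>t. c \<star> f (y + t *\<^sub>R a)) has_vector_derivative c \<star> D a y) (at 0)"
      by (rule bounded_linear.has_vector_derivative[OF omult.bounded_linear_right der[OF y]])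
    ultimately have "((\<lambda>t. ?K (y + t *\<^sub>R a) \<star> (c \<star> f (y + t *\<^sub>R a))) has_vector_derivative
        ?K (y + 0 *\<^sub>R a) \<star> (c \<star> D a y) + ?K' a y \<star> (c \<star> f (y + 0 *\<^sub>R a))) (at 0)"
      by (rule omult.has_vector_derivative)
    then show "((\<lambda>t. ?K (y + t *\<^sub>R a) \<star> (c \<star> f (y + t *\<^sub>R a))) has_vector_derivative ?K y \<star> (c \<star> D a y) + ?K' a y \<star> (c \<star> f y)) (at 0)"
      by simp
  qed
  have finB: "finite B" by (rule orthonormal_finite[OF oB])
  have i1: "integrable (vol B) (\<lambda>y. indicator S y *\<^sub>R (\<Sum>c\<in>B. ?K' c y \<star> (c \<star> f y)))"
    by (intro integrable_on_S continuous_on_sum c1)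
  have i2: "integrable (vol B) (\<lambda>y. indicator S y *\<^sub>R (\<Sum>c\<in>B. ?K y \<star> (c \<star> D c y)))"
    by (intro integrable_on_S continuous_on_sum c2)
  have i3: "integrable (surface_measure p bd) (\<lambda>y. (exterior_normal B S y \<bullet> c) *\<^sub>R (?K y \<star> (c \<star> f y)))" for c
    by (intro integrable_on_bd continuous_on_scaleR continuous_on_inner continuous_normal omult.continuous_on cK cfB continuous_on_const)
  have "(\<integral>y. indicator S y *\<^sub>R (\<Sum>c\<in>B. ?K' c y \<star> (c \<star> f y)) \<partial>vol B) + (\<integral>y. indicator S y *\<^sub>R (\<Sum>c\<in>B. ?K y \<star> (c \<star> D c y)) \<partial>vol B)
     = (\<integral>y. (\<Sum>c\<in>B. indicator S y *\<^sub>R (?K y \<star> (c \<star> D c y) + ?K' c y \<star> (c \<star> f y))) \<partial>vol B)"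
    by (subst Bochner_Integration.integral_add[OF i1 i2, symmetric])
       (simp add: sum.distrib scaleR_sum_right scaleR_add_right add.commute)
  also have "\<dots> = (\<Sum>c\<in>B. (\<integral>y. indicator S y *\<^sub>R (?K y \<star> (c \<star> D c y) + ?K' c y \<star> (c \<star> f y)) \<partial>vol B))"
    by (intro Bochner_Integration.integral_sum integrable_on_S continuous_on_add c1 c2)
  also have "\<dots> = (\<Sum>c\<in>B. (\<integral>y. (exterior_normal B S y \<bullet> c) *\<^sub>R (?K y \<star> (c \<star> f y)) \<partial>surface_measure p bd))"
    by (intro sum.cong refl each)
  also have "\<dots> = (\<integral>y. (\<Sum>c\<in>B. (exterior_normal B S y \<bullet> c) *\<^sub>R (?K y \<star> (c \<star> f y))) \<partial>surface_measure p bd)"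
    by (intro Bochner_Integration.integral_sum[symmetric] i3)
  also have "\<dots> = (\<integral>y. ?K y \<star> (exterior_normal B S y \<star> f y) \<partial>surface_measure p bd)"
  proof (rule Bochner_Integration.integral_cong[OF refl])
    fix y assume "y \<in> space (surface_measure p bd)"
    then have "y \<in> bd" by (simp only: space_surface)
    then have "(\<Sum>c\<in>B. (exterior_normal B S y \<bullet> c) *\<^sub>R c) = exterior_normal B S y"
      using oproj_span[OF oB normal_at(3)] by (simp add: oproj_def)
    then have "?K y \<star> (exterior_normal B S y \<star> f y) = ?K y \<star> ((\<Sum>c\<in>B. (exterior_normal B S y \<bullet> c) *\<^sub>R c) \<star> f y)" by simp
    also have "\<dots> = (\<Sum>c\<in>B. (exterior_normal B S y \<bullet> c) *\<^sub>R (?K y \<star> (c \<star> f y)))"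
      by (simp add: omult.sum_left omult.sum_right omult.scaleR_left omult.scaleR_right)
    finally show "(\<Sum>c\<in>B. (exterior_normal B S y \<bullet> c) *\<^sub>R (?K y \<star> (c \<star> f y))) = ?K y \<star> (exterior_normal B S y \<star> f y)" by simp
  qed
  also have "(\<integral>y. indicator S y *\<^sub>R (\<Sum>c\<in>B. ?K' c y \<star> (c \<star> f y)) \<partial>vol B) =
      (\<integral>y. indicator S y *\<^sub>R ((real n * \<epsilon>\<^sup>2 * (\<epsilon>\<^sup>2 + (norm (y - x))\<^sup>2) powr (- real n / 2 - 1)) *\<^sub>R f y) \<partial>vol B)"
  proof (rule Bochner_Integration.integral_cong[OF refl])
    fix y
    have "(\<Sum>c\<in>B. ?K' c y \<star> (c \<star> f y)) = (real n * \<epsilon>\<^sup>2 * (\<epsilon>\<^sup>2 + (norm (y - x))\<^sup>2) powr (- real n / 2 - 1)) *\<^sub>R f y" if "y \<in> S"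
      by (rule reg_kernel_divergence[OF oB n span_diff[OF _ x] \<epsilon>]) (use that S_span in auto)
    then show "indicator S y *\<^sub>R (\<Sum>c\<in>B. ?K' c y \<star> (c \<star> f y)) =
        indicator S y *\<^sub>R ((real n * \<epsilon>\<^sup>2 * (\<epsilon>\<^sup>2 + (norm (y - x))\<^sup>2) powr (- real n / 2 - 1)) *\<^sub>R f y)"
      by (cases "y \<in> S") auto
  qed
  also have "(\<integral>y. indicator S y *\<^sub>R (\<Sum>c\<in>B. ?K y \<star> (c \<star> D c y)) \<partial>vol B) = (\<integral>y. indicator S y *\<^sub>R (?K y \<star> (\<Sum>c\<in>B. c \<star> D c y)) \<partial>vol B)"
    by (simp add: omult.sum_right)
  finally show ?thesis .
qed

text \<open>
  The substitution \<open>y = x + \<epsilon> w\<close> turns the factor into the fixed integrable density \<open>identity_profile n w\<close> and the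
  argument of \<open>f\<close> into a point that tends to \<open>x\<close>.
\<close>

lemma approximate_identity:
  fixes f :: "octonion \<Rightarrow> octonion"
  assumes cf: "continuous_on (closure S) f" and x: "x \<in> S" and n: "card B = n" "0 < n"
    and e: "\<And>k. 0 < e k" "e \<longlonglongrightarrow> 0"
  shows "(\<lambda>k. \<integral>y. indicator S y *\<^sub>R ((real n * (e k)\<^sup>2 * ((e k)\<^sup>2 + (norm (y - x))\<^sup>2) powr (- real n / 2 - 1)) *\<^sub>R f y) \<partial>vol B)
     \<longlonglongrightarrow> (2 * Gamma (1/2) ^ n / Gamma (real n / 2)) *\<^sub>R f x"
proof -
  have xB: "x \<in> span B" using x S_span by auto
  define F where "F y = indicator S y *\<^sub>R f y" for y
  have F[measurable]: "F \<in> borel_measurable borel" unfolding F_def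
    by (rule borel_measurable_continuous_on_indicator[OF S_borel continuous_on_subset[OF cf closure_subset]])
  obtain C where C: "\<And>y. y \<in> closure S \<Longrightarrow> norm (f y) \<le> C" using bounded_on_closure[OF cf] by blast
  have FC: "norm (F y) \<le> \<bar>C\<bar>" for y using C[of y] closure_subset[of S] by (auto simp: F_def indicator_def)
  have pd0: "0 \<le> identity_profile n w" for w by (simp add: identity_profile_def)
  have pdi: "integrable (vol B) (identity_profile n)"
    using vol_identity_profile[OF oB n] pd0 by (intro integrableI_nonneg) auto
  have pdI: "(\<integral>w. identity_profile n w \<partial>vol B) = 2 * Gamma (1/2) ^ n / Gamma (real n / 2)"
  proof (rule integral_eq_nn_integral[THEN trans])
    show "enn2real (\<integral>\<^sup>+w. ennreal (identity_profile n w) \<partial>vol B) = 2 * Gamma (1/2) ^ n / Gamma (real n / 2)"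
      unfolding vol_identity_profile[OF oB n] using n Gamma_real_pos[of "real n / 2"] Gamma_real_pos[of "1/2"] by simp
  qed (use pd0 in auto)
  have subst: "(\<integral>y. indicator S y *\<^sub>R ((real n * \<epsilon>\<^sup>2 * (\<epsilon>\<^sup>2 + (norm (y - x))\<^sup>2) powr (- real n / 2 - 1)) *\<^sub>R f y) \<partial>vol B) =
      (\<integral>w. identity_profile n w *\<^sub>R F (x + \<epsilon> *\<^sub>R w) \<partial>vol B)" if \<epsilon>: "0 < \<epsilon>" for \<epsilon>
  proof -
    have "(\<integral>y. indicator S y *\<^sub>R ((real n * \<epsilon>\<^sup>2 * (\<epsilon>\<^sup>2 + (norm (y - x))\<^sup>2) powr (- real n / 2 - 1)) *\<^sub>R f y) \<partial>vol B) =
       (\<integral>y. (real n * \<epsilon>\<^sup>2 * (\<epsilon>\<^sup>2 + (norm (y - x))\<^sup>2) powr (- real n / 2 - 1)) *\<^sub>R F y \<partial>vol B)"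
      by (simp add: F_def mult.commute)
    also have "\<dots> = (\<integral>w. \<epsilon> ^ card B *\<^sub>R ((real n * \<epsilon>\<^sup>2 * (\<epsilon>\<^sup>2 + (norm ((x + \<epsilon> *\<^sub>R w) - x))\<^sup>2) powr (- real n / 2 - 1)) *\<^sub>R F (x + \<epsilon> *\<^sub>R w)) \<partial>vol B)"
      by (rule vol_integral_affine[OF oB xB \<epsilon>]) measurable
    also have "\<dots> = (\<integral>w. identity_profile n w *\<^sub>R F (x + \<epsilon> *\<^sub>R w) \<partial>vol B)"
    proof (rule Bochner_Integration.integral_cong[OF refl])
      fix w :: octonion
      have p: "0 < 1 + (norm w)\<^sup>2" by (simp add: add_pos_nonneg)
      have eq: "\<epsilon>\<^sup>2 + (norm ((x + \<epsilon> *\<^sub>R w) - x))\<^sup>2 = \<epsilon>\<^sup>2 * (1 + (norm w)\<^sup>2)" by (simp add: power_mult_distrib distrib_left)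
      have "(\<epsilon>\<^sup>2 + (norm ((x + \<epsilon> *\<^sub>R w) - x))\<^sup>2) powr (- real n / 2 - 1) = (\<epsilon>\<^sup>2) powr (- (real (n + 2) / 2)) * (1 + (norm w)\<^sup>2) powr (- (real (n + 2) / 2))"
      proof -
        have ex: "- real n / 2 - 1 = - (real (n + 2) / 2)" by (simp add: field_simps)
        show ?thesis unfolding eq ex using p by (simp add: powr_mult)
      qed
      also have "\<dots> = (1 / \<epsilon> ^ (n + 2)) * (1 / sqrt (1 + (norm w)\<^sup>2) ^ (n + 2))"
        unfolding powr_minus_divide sqrt_power_powr[OF p, symmetric]
        using sqrt_power_powr[of "\<epsilon>\<^sup>2" "n + 2"] \<epsilon> by simp
      finally have "\<epsilon> ^ card B * (real n * \<epsilon>\<^sup>2 * (\<epsilon>\<^sup>2 + (norm ((x + \<epsilon> *\<^sub>R w) - x))\<^sup>2) powr (- real n / 2 - 1)) = identity_profile n w"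
        using \<epsilon> n by (simp add: identity_profile_def power_add power2_eq_square)
      then show "\<epsilon> ^ card B *\<^sub>R ((real n * \<epsilon>\<^sup>2 * (\<epsilon>\<^sup>2 + (norm ((x + \<epsilon> *\<^sub>R w) - x))\<^sup>2) powr (- real n / 2 - 1)) *\<^sub>R F (x + \<epsilon> *\<^sub>R w)) = identity_profile n w *\<^sub>R F (x + \<epsilon> *\<^sub>R w)"
        unfolding scaleR_scaleR by simp
    qed
    finally show ?thesis .
  qed
  have "(\<lambda>k. \<integral>w. identity_profile n w *\<^sub>R F (x + e k *\<^sub>R w) \<partial>vol B) \<longlonglongrightarrow> (\<integral>w. identity_profile n w *\<^sub>R f x \<partial>vol B)"
  proof (rule integral_dominated_convergence[where w = "\<lambda>w. \<bar>C\<bar> * identity_profile n w"])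
    show "integrable (vol B) (\<lambda>w. \<bar>C\<bar> * identity_profile n w)" using pdi by simp
    show "AE w in vol B. norm (identity_profile n w *\<^sub>R F (x + e k *\<^sub>R w)) \<le> \<bar>C\<bar> * identity_profile n w" for k
    proof (intro AE_I2)
      fix w
      show "norm (identity_profile n w *\<^sub>R F (x + e k *\<^sub>R w)) \<le> \<bar>C\<bar> * identity_profile n w"
        using mult_right_mono[OF FC[of "x + e k *\<^sub>R w"] pd0[of w]] pd0[of w] by (simp add: mult.commute)
    qed
    show "AE w in vol B. (\<lambda>k. identity_profile n w *\<^sub>R F (x + e k *\<^sub>R w)) \<longlonglongrightarrow> identity_profile n w *\<^sub>R f x"
      using AE_vol_span[OF orthonormal_finite[OF oB]]
    proof eventually_elim
      fix w assume w: "w \<in> span B"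
      have lim: "(\<lambda>k. x + e k *\<^sub>R w) \<longlonglongrightarrow> x" using tendsto_add[OF tendsto_const tendsto_scaleR[OF e(2) tendsto_const], of x w] by simp
      obtain T where T: "open T" "S = span B \<inter> T" using opS by (auto simp: openin_open)
      have "\<forall>\<^sub>F k in sequentially. x + e k *\<^sub>R w \<in> T" using lim by (rule topological_tendstoD) (use T x in auto)
      then have inS: "\<forall>\<^sub>F k in sequentially. x + e k *\<^sub>R w \<in> S"
        by eventually_elim (use T xB w in \<open>auto intro!: span_add span_scale\<close>)
      have "(f \<longlongrightarrow> f x) (at x within S)"
        using continuous_on_subset[OF cf closure_subset] x by (auto simp: continuous_on_def)
      then have "(f \<longlongrightarrow> f x) (inf (nhds x) (principal S))"
        using x by (simp add: tendsto_at_within_iff_tendsto_nhds)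
      moreover have "filterlim (\<lambda>k. x + e k *\<^sub>R w) (inf (nhds x) (principal S)) sequentially"
        using lim inS by (simp add: filterlim_inf filterlim_principal)
      ultimately have "(\<lambda>k. f (x + e k *\<^sub>R w)) \<longlonglongrightarrow> f x" by (rule filterlim_compose)
      moreover have "\<forall>\<^sub>F k in sequentially. f (x + e k *\<^sub>R w) = F (x + e k *\<^sub>R w)"
        using inS by eventually_elim (simp add: F_def)
      ultimately have "(\<lambda>k. F (x + e k *\<^sub>R w)) \<longlonglongrightarrow> f x" by (rule Lim_transform_eventually)
      then show "(\<lambda>k. identity_profile n w *\<^sub>R F (x + e k *\<^sub>R w)) \<longlonglongrightarrow> identity_profile n w *\<^sub>R f x" by (intro tendsto_intros)
    qed
  qed measurable
  then show ?thesis using subst[OF e(1)] pdi by (simp add: pdI)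
qed

text \<open>
  Dominated by a multiple of \<open>|y - x|\<close> to the power \<open>1 - n\<close>, restricted to a ball that contains \<open>S\<close>.
\<close>

lemma kernel_limit_volume:
  fixes g :: "octonion \<Rightarrow> octonion"
  assumes cg: "continuous_on (closure S) g" and x: "x \<in> S" and n: "card B = n" "0 < n"
    and e: "\<And>k. 0 < e k" "e \<longlonglongrightarrow> 0"
  shows "integrable (vol B) (\<lambda>y. indicator S y *\<^sub>R (((1 / norm (y - x) ^ n) *\<^sub>R oconj (y - x)) \<star> g y))"
    and "(\<lambda>k. \<integral>y. indicator S y *\<^sub>R (reg_kernel n (e k) (y - x) \<star> g y) \<partial>vol B) \<longlonglongrightarrow>
        (\<integral>y. indicator S y *\<^sub>R (((1 / norm (y - x) ^ n) *\<^sub>R oconj (y - x)) \<star> g y) \<partial>vol B)"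
proof -
  have xB: "x \<in> span B" using x S_span by auto
  obtain C where C: "\<And>y. y \<in> closure S \<Longrightarrow> norm (g y) \<le> C" using bounded_on_closure[OF cg] by blast
  obtain M where M: "0 \<le> M" "\<And>a b. norm (a \<star> b) \<le> norm a * norm b * M" using omult.nonneg_bounded by blast
  obtain R0 where R0: "\<And>y. y \<in> S \<Longrightarrow> norm y \<le> R0" using bdS by (auto simp: bounded_iff)
  define R where "R = R0 + norm x"
  have R: "y - x \<in> cball 0 R" if "y \<in> S" for y using R0[OF that] norm_triangle_ineq4[of y x] by (simp add: R_def)
  define h where "h y = 1 / norm (y - x) ^ (n - 1) * indicator (cball 0 R) (y - x)" for y
  have h0: "0 \<le> h y" for y by (simp add: h_def)
  have hi: "integrable (vol B) h"
  proof (rule integrableI_nonneg)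
    have "(\<lambda>y. indicator (cball 0 R) (y - x) :: real) \<in> borel_measurable borel"
    proof -
      have "(\<lambda>y. y - x) \<in> borel \<rightarrow>\<^sub>M borel" by measurable
      from measurable_compose[OF this borel_measurable_indicator[of "cball 0 R" borel]] show ?thesis by simp
    qed
    then have hm: "h \<in> borel_measurable borel" unfolding h_def[abs_def] by measurable
    then show "h \<in> borel_measurable (vol B)" by simp
    have "(\<integral>\<^sup>+y. ennreal (h y) \<partial>vol B) = ennreal (1 ^ card B) * (\<integral>\<^sup>+w. ennreal (h (x + 1 *\<^sub>R w)) \<partial>vol B)"
      by (rule vol_nn_integral_affine[OF orthonormal_finite[OF oB] xB]) (use hm in auto)
    also have "\<dots> = (\<integral>\<^sup>+w. ennreal (1 / norm w ^ (n - 1)) * indicator (cball 0 R) w \<partial>vol B)"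
      by (simp, intro nn_integral_cong) (auto simp: h_def indicator_def)
    also have "\<dots> < \<infinity>" by (rule vol_riesz_finite[OF oB n])
    finally show "(\<integral>\<^sup>+y. ennreal (h y) \<partial>vol B) < \<infinity>" .
  qed (use h0 in auto)
  have gm: "(\<lambda>y. indicator S y *\<^sub>R g y) \<in> borel_measurable borel"
    by (rule borel_measurable_continuous_on_indicator[OF S_borel continuous_on_subset[OF cg closure_subset]])
  have star_m: "(\<lambda>y. u y \<star> v y) \<in> borel_measurable borel"
    if "u \<in> borel_measurable borel" "v \<in> borel_measurable borel" for u v :: "octonion \<Rightarrow> octonion"
    by (rule borel_measurable_continuous_Pair[OF that]) (intro omult.continuous_on continuous_intros)
  have conj_m[measurable]: "oconj \<in> borel_measurable borel" by (intro borel_measurable_continuous_onI continuous_intros)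
  have eqS: "indicator S y *\<^sub>R (u \<star> g y) = u \<star> (indicator S y *\<^sub>R g y)" for u y by (simp add: omult.scaleR_right)
  have m0: "(\<lambda>y. indicator S y *\<^sub>R (((1 / norm (y - x) ^ n) *\<^sub>R oconj (y - x)) \<star> g y)) \<in> borel_measurable (vol B)"
    unfolding eqS using star_m[OF _ gm, of "\<lambda>y. (1 / norm (y - x) ^ n) *\<^sub>R oconj (y - x)"] by simp
  have mk: "(\<lambda>y. indicator S y *\<^sub>R (reg_kernel n (e k) (y - x) \<star> g y)) \<in> borel_measurable (vol B)" for k
  proof -
    have "(\<lambda>y. reg_kernel n (e k) (y - x)) \<in> borel_measurable borel"
      by (intro borel_measurable_continuous_onI continuous_reg_kernel e continuous_intros)
    from star_m[OF this gm] show ?thesis unfolding eqS by simp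
  qed
  have lim: "AE y in vol B. (\<lambda>k. indicator S y *\<^sub>R (reg_kernel n (e k) (y - x) \<star> g y)) \<longlonglongrightarrow>
      indicator S y *\<^sub>R (((1 / norm (y - x) ^ n) *\<^sub>R oconj (y - x)) \<star> g y)"
    by (intro AE_I2 tendsto_scaleR omult.tendsto tendsto_const reg_kernel_tendsto e(2))
  have dom: "AE y in vol B. norm (indicator S y *\<^sub>R (reg_kernel n (e k) (y - x) \<star> g y)) \<le> \<bar>C\<bar> * M * h y" for k
  proof (intro AE_I2)
    fix y
    show "norm (indicator S y *\<^sub>R (reg_kernel n (e k) (y - x) \<star> g y)) \<le> \<bar>C\<bar> * M * h y"
    proof (cases "y \<in> S")
      case True
      have "norm (reg_kernel n (e k) (y - x) \<star> g y) \<le> norm (reg_kernel n (e k) (y - x)) * norm (g y) * M" by (rule M(2))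
      also have "\<dots> \<le> h y * \<bar>C\<bar> * M"
      proof (intro mult_right_mono mult_mono M(1))
        show "norm (reg_kernel n (e k) (y - x)) \<le> h y"
          using reg_kernel_norm[OF n(2), of "e k" "y - x"] R[OF True] by (simp add: h_def)
        show "norm (g y) \<le> \<bar>C\<bar>" using C[of y] True closure_subset[of S] by auto
      qed (use h0 in auto)
      finally show ?thesis using True by (simp add: mult_ac)
    qed (use M h0 in simp)
  qed
  have wi: "integrable (vol B) (\<lambda>y. \<bar>C\<bar> * M * h y)" using hi by simp
  show "integrable (vol B) (\<lambda>y. indicator S y *\<^sub>R (((1 / norm (y - x) ^ n) *\<^sub>R oconj (y - x)) \<star> g y))"
    by (rule integrable_dominated_convergence[OF m0 mk wi lim dom])
  show "(\<lambda>k. \<integral>y. indicator S y *\<^sub>R (reg_kernel n (e k) (y - x) \<star> g y) \<partial>vol B) \<longlonglongrightarrow>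
        (\<integral>y. indicator S y *\<^sub>R (((1 / norm (y - x) ^ n) *\<^sub>R oconj (y - x)) \<star> g y) \<partial>vol B)"
    by (rule integral_dominated_convergence[OF m0 mk wi lim dom])
qed

text \<open>
  The boundary has finite area and keeps a positive distance from \<open>x \<in> S\<close>, so the singularity is not seen.
\<close>

lemma kernel_limit_boundary:
  fixes g :: "octonion \<Rightarrow> octonion"
  assumes cg: "continuous_on bd g" and x: "x \<in> S" and n: "0 < n"
    and e: "\<And>k. 0 < e k" "e \<longlonglongrightarrow> 0"
  shows "integrable (surface_measure p bd) (\<lambda>y. ((1 / norm (y - x) ^ n) *\<^sub>R oconj (y - x)) \<star> g y)"
    and "(\<lambda>k. \<integral>y. reg_kernel n (e k) (y - x) \<star> g y \<partial>surface_measure p bd) \<longlonglongrightarrow>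
        (\<integral>y. ((1 / norm (y - x) ^ n) *\<^sub>R oconj (y - x)) \<star> g y \<partial>surface_measure p bd)"
proof -
  have nx: "y - x \<noteq> 0" if "y \<in> bd" for y using that x by (auto simp: bd_def)
  obtain M where M: "0 \<le> M" "\<And>a b. norm (a \<star> b) \<le> norm a * norm b * M" using omult.nonneg_bounded by blast
  show i0: "integrable (surface_measure p bd) (\<lambda>y. ((1 / norm (y - x) ^ n) *\<^sub>R oconj (y - x)) \<star> g y)"
    by (intro integrable_on_bd omult.continuous_on cg continuous_intros) (use nx in auto)
  have ik: "integrable (surface_measure p bd) (\<lambda>y. reg_kernel n (e k) (y - x) \<star> g y)" for k
    by (intro integrable_on_bd omult.continuous_on cg continuous_reg_kernel e(1) continuous_intros)
  have wi: "integrable (surface_measure p bd) (\<lambda>y. 1 / norm (y - x) ^ (n - 1) * norm (g y) * M)"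
    by (intro integrable_on_bd cg continuous_intros) (use nx in auto)
  show "(\<lambda>k. \<integral>y. reg_kernel n (e k) (y - x) \<star> g y \<partial>surface_measure p bd) \<longlonglongrightarrow>
        (\<integral>y. ((1 / norm (y - x) ^ n) *\<^sub>R oconj (y - x)) \<star> g y \<partial>surface_measure p bd)"
  proof (rule integral_dominated_convergence[OF _ _ wi])
    show "AE y in surface_measure p bd. (\<lambda>k. reg_kernel n (e k) (y - x) \<star> g y) \<longlonglongrightarrow> ((1 / norm (y - x) ^ n) *\<^sub>R oconj (y - x)) \<star> g y"
      by (intro AE_I2 omult.tendsto tendsto_const reg_kernel_tendsto e(2))
    show "AE y in surface_measure p bd. norm (reg_kernel n (e k) (y - x) \<star> g y) \<le> 1 / norm (y - x) ^ (n - 1) * norm (g y) * M" for k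
    proof (intro AE_I2)
      fix y
      have "norm (reg_kernel n (e k) (y - x) \<star> g y) \<le> norm (reg_kernel n (e k) (y - x)) * norm (g y) * M" by (rule M(2))
      also have "\<dots> \<le> 1 / norm (y - x) ^ (n - 1) * norm (g y) * M"
        by (intro mult_right_mono M(1) reg_kernel_norm n) auto
      finally show "norm (reg_kernel n (e k) (y - x) \<star> g y) \<le> 1 / norm (y - x) ^ (n - 1) * norm (g y) * M" .
    qed
  qed (use i0 ik in \<open>auto dest: borel_measurable_integrable\<close>)
qed

text \<open>
  The limit \<open>\<epsilon> \<rightarrow> 0\<close> of \<open>regularised_formula\<close>, divided by the area of the unit sphere.
\<close>

theorem cauchy_pompeiu:
  assumes f: "C1_closure B S f" and x: "x \<in> S"
  shows "integrable (surface_measure p bd) (\<lambda>y. cauchy_kernel_at p y x \<star> (exterior_normal B S y \<star> f y))"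
    and "set_integrable (vol B) S (\<lambda>y. cauchy_kernel_at p y x \<star> dirac p \<eta> f y)"
    and "f x = (LINT y|surface_measure p bd. cauchy_kernel_at p y x \<star> (exterior_normal B S y \<star> f y))
       - (LINT y:S|vol B. cauchy_kernel_at p y x \<star> dirac p \<eta> f y)"
proof -
  define n where "n = p + 2"
  have n: "card B = n" "0 < n" using card_slice_basis[OF \<eta>S p6] by (simp_all add: n_def B_def)
  have cf: "continuous_on (closure S) f"
    and der: "\<And>y c. y \<in> S \<Longrightarrow> c \<in> B \<Longrightarrow> ((\<lambda>t. f (y + t *\<^sub>R c)) has_vector_derivative pderiv_along c f y) (at 0)"
    and ex: "\<And>c. c \<in> B \<Longrightarrow> \<exists>g. continuous_on (closure S) g \<and> (\<forall>y\<in>S. g y = pderiv_along c f y)"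
    using f unfolding C1_closure_def closure_in_eq by (auto simp: pderiv_along_def vector_derivative_works)
  from ex obtain D where D: "\<And>c. c \<in> B \<Longrightarrow> continuous_on (closure S) (D c)" "\<And>c y. c \<in> B \<Longrightarrow> y \<in> S \<Longrightarrow> D c y = pderiv_along c f y"
    by metis
  have der': "((\<lambda>t. f (y + t *\<^sub>R c)) has_vector_derivative D c y) (at 0)" if "y \<in> S" "c \<in> B" for y c
    using der[OF that] D(2)[OF that(2,1)] by simp
  define Df where "Df y = (\<Sum>c\<in>B. c \<star> D c y)" for y
  have cDf: "continuous_on (closure S) Df"
    unfolding Df_def by (intro continuous_on_sum omult.continuous_on continuous_on_const D(1))
  have Df: "Df y = dirac p \<eta> f y" if y: "y \<in> S" for y
  proof -
    have inj: "inj_on oe {..p}" by (rule inj_on_subset[OF inj_oe]) (use p6 in auto)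
    have "Df y = (\<Sum>c\<in>B. c \<star> pderiv_along c f y)" unfolding Df_def using D(2) y by (intro sum.cong) auto
    also have "\<dots> = (\<Sum>c\<in>pbasis p. c \<star> pderiv_along c f y) + \<eta> \<star> pderiv_along \<eta> f y"
      unfolding B_def slice_basis_def using eta_notin_pbasis[OF \<eta>S p6] by (simp add: pbasis_def add.commute)
    also have "(\<Sum>c\<in>pbasis p. c \<star> pderiv_along c f y) = (\<Sum>i\<le>p. oe i \<star> pderiv_along (oe i) f y)"
      unfolding pbasis_def by (simp add: sum.reindex[OF inj])
    finally show ?thesis by (simp add: dirac_def)
  qed
  define e where "e k = 1 / real (Suc k)" for k
  have e: "\<And>k. 0 < e k" "e \<longlonglongrightarrow> 0"
    using LIMSEQ_inverse_real_of_nat by (simp_all add: e_def[abs_def] inverse_eq_divide)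
  have cnf: "continuous_on bd (\<lambda>y. exterior_normal B S y \<star> f y)"
    by (intro omult.continuous_on continuous_normal continuous_on_subset[OF cf]) (auto simp: bd_def)
  have xB: "x \<in> span B" using x S_span by auto
  let ?E = "\<lambda>y. (1 / norm (y - x) ^ n) *\<^sub>R oconj (y - x)"
  define A where "A = sphere_area p"
  have A: "A = 2 * Gamma (1/2) ^ n / Gamma (real n / 2)" by (simp add: A_def sphere_area_def n_def add.commute)
  have "0 < A" unfolding A by (intro divide_pos_pos mult_pos_pos zero_less_power Gamma_real_pos) (use n in auto)
  then have A0: "A \<noteq> 0" by simp
  have E: "cauchy_kernel_at p y x = (1 / A) *\<^sub>R ?E y" for y
    by (simp add: cauchy_kernel_at_def cauchy_kernel_def A_def n_def)
  note V = kernel_limit_volume[OF cDf x n e]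
  note W = kernel_limit_boundary[OF cnf x n(2) e]
  note I = approximate_identity[OF cf x n e]
  have "A *\<^sub>R f x + (\<integral>y. indicator S y *\<^sub>R (?E y \<star> Df y) \<partial>vol B) = (\<integral>y. ?E y \<star> (exterior_normal B S y \<star> f y) \<partial>surface_measure p bd)"
  proof (rule LIMSEQ_unique[OF _ W(2)])
    show "(\<lambda>k. \<integral>y. reg_kernel n (e k) (y - x) \<star> (exterior_normal B S y \<star> f y) \<partial>surface_measure p bd) \<longlonglongrightarrow>
        A *\<^sub>R f x + (\<integral>y. indicator S y *\<^sub>R (?E y \<star> Df y) \<partial>vol B)"
      using tendsto_add[OF I V(2)] regularised_formula[OF cf D(1) der' e(1) xB n(1)] by (simp add: Df_def A)
  qed
  then have main: "A *\<^sub>R f x = (\<integral>y. ?E y \<star> (exterior_normal B S y \<star> f y) \<partial>surface_measure p bd) - (\<integral>y. indicator S y *\<^sub>R (?E y \<star> Df y) \<partial>vol B)"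
    by (simp add: eq_diff_eq)
  have eqV: "indicator S y *\<^sub>R (cauchy_kernel_at p y x \<star> dirac p \<eta> f y) = (1 / A) *\<^sub>R (indicator S y *\<^sub>R (?E y \<star> Df y))" for y
    unfolding E by (cases "y \<in> S") (simp_all add: Df omult.scaleR_left)
  have eqW: "cauchy_kernel_at p y x \<star> (exterior_normal B S y \<star> f y) = (1 / A) *\<^sub>R (?E y \<star> (exterior_normal B S y \<star> f y))" for y
    unfolding E by (simp only: omult.scaleR_left)
  show "integrable (surface_measure p bd) (\<lambda>y. cauchy_kernel_at p y x \<star> (exterior_normal B S y \<star> f y))"
    unfolding eqW by (intro integrable_scaleR_right impI W(1))
  show "set_integrable (vol B) S (\<lambda>y. cauchy_kernel_at p y x \<star> dirac p \<eta> f y)"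
    unfolding set_integrable_def eqV by (intro integrable_scaleR_right impI V(1))
  have "f x = (1 / A) *\<^sub>R (A *\<^sub>R f x)" using A0 by simp
  also have "\<dots> = (LINT y|surface_measure p bd. cauchy_kernel_at p y x \<star> (exterior_normal B S y \<star> f y))
       - (LINT y:S|vol B. cauchy_kernel_at p y x \<star> dirac p \<eta> f y)"
    unfolding main set_lebesgue_integral_def eqV eqW integral_scaleR_right by (simp only: scaleR_diff_right)
  finally show "f x = (LINT y|surface_measure p bd. cauchy_kernel_at p y x \<star> (exterior_normal B S y \<star> f y))
       - (LINT y:S|vol B. cauchy_kernel_at p y x \<star> dirac p \<eta> f y)" .
qed

end

theorem theorem4p6:
  fixes p :: nat and \<eta> :: octonion and U :: "octonion set" and f :: "octonion \<Rightarrow> octonion"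
  assumes "p \<le> 6"
    and "\<eta> \<in> unit_sphere p"
    and "open U" and "connected U" and "bounded U"
    and "has_smooth_boundary (slice_basis p \<eta>) (slice p \<eta> U)"
    and "C1_closure (slice_basis p \<eta>) (slice p \<eta> U) f"
  shows "\<forall>x \<in> slice p \<eta> U.
     integrable (surface_measure p (boundary_in (slice_basis p \<eta>) (slice p \<eta> U)))
       (\<lambda>y. cauchy_kernel_at p y x \<star> (exterior_normal (slice_basis p \<eta>) (slice p \<eta> U) y \<star> f y)) \<and>
     set_integrable (vol (slice_basis p \<eta>)) (slice p \<eta> U)
       (\<lambda>y. cauchy_kernel_at p y x \<star> dirac p \<eta> f y) \<and>
     f x =
       (LINT y|surface_measure p (boundary_in (slice_basis p \<eta>) (slice p \<eta> U)).
          cauchy_kernel_at p y x \<star> (exterior_normal (slice_basis p \<eta>) (slice p \<eta> U) y \<star> f y))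
       - (LINT y:slice p \<eta> U|vol (slice_basis p \<eta>). cauchy_kernel_at p y x \<star> dirac p \<eta> f y)"
proof -
  interpret slice_domain p \<eta> "slice_basis p \<eta>" "slice p \<eta> U"
  proof
    show "openin (top_of_set (span (slice_basis p \<eta>))) (slice p \<eta> U)"
      unfolding slice_def by (subst Int_commute) (rule openin_open_Int[OF assms(3)])
    show "bounded (slice p \<eta> U)" unfolding slice_def using assms(5) by (rule bounded_subset) auto
  qed (use assms in auto)
  show ?thesis unfolding boundary_in_eq using cauchy_pompeiu[OF assms(7)] by blast
qed

end
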